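(* Let $n\ge3$ and let $[Q^{\gets}]$ be any twisted adapted class of type $D_{n+1}$. (1) For any pair $(\alpha,\beta)\in(\Phi^+)^2$ we have $\mathrm{gdist}_{[Q^{\gets}]}(\alpha,\beta)\le \max\{\overline{\mathsf m}(\gamma)\mid \gamma=\alpha,\beta\}=2$. (2) For any non-simple positive root $\gamma\in\Phi^+\setminus\Pi$, $\mathrm{rds}_{[Q^{\gets}]}(\gamma)=\overline{\mathsf m}(\gamma)$. (3) For any pair $\underline p$, the socle $\mathrm{soc}_{[Q^{\gets}]}(\underline p)$ is well-defined. Here $\overline{\mathsf m}$ denotes the folded multiplicity.
   Context: Fix $n\ge 3$. The Dynkin diagram of type $D_{n+1}$ has index set $I=\{1,\dots,n+1\}$ and edges $i-(i+1)$ for $1\le i\le n-1$ together with $(n-1)-(n+1)$; $\alpha_i,s_i$ are the simple roots and reflections, $\Pi=\{\alpha_i\}$, $\Phi^+$ the set of positive roots, $w_0$ the longest element of the Weyl group, $N=n(n+1)=|\Phi^+|$. The map $\vee:I\to I$ exchanges $n,n+1$ and fixes the other indices. For words, $(j_1\cdots j_m)^{k\vee}$ means applying $\vee$ to each letter $k$ times; $\prod$ of words is concatenation. $[\mathbf j]$ is the commutation class of a reduced word $\mathbf j$. A twisted adapted class, denoted $[Q^{\gets}]$, is a class of reduced words of $w_0$ of the form $[\prod_{k=0}^n(i_1\cdots i_n)^{k\vee}]$, where $i_1,\dots,i_n$ contains exactly one index of each orbit $\{1\},\dots,\{n-1\},\{n,n+1\}$ (such words are reduced words of $w_0$). For a reduced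 word $\mathbf j_0=j_1\cdots j_N$ of $w_0$ let $\beta_k^{\mathbf j_0}=s_{j_1}\cdots s_{j_{k-1}}(\alpha_{j_k})$ and order $\Phi^+$ by $\beta_k^{\mathbf j_0}<_{\mathbf j_0}\beta_l^{\mathbf j_0}$ iff $k<l$. A sequence is an element $\underline m$ of $\mathbb Z_{\ge0}^{\Phi^+}$; for a given $\mathbf j_0$ it is written $(m_1,\dots,m_N)$ with $m_k$ the entry at $\beta_k^{\mathbf j_0}$. Put $|\underline m|=\sum m_k$, $\mathrm{wt}(\underline m)=\sum m_k\beta_k^{\mathbf j_0}$. A pair is a sequence with $|\underline m|=2$ and all entries $\le1$, written $(\alpha,\beta)$; a root is identified with the sequence having a single entry 1. Bi-lexicographic order: $\underline m<^{\mathtt b}_{\mathbf j_0}\underline m'$ iff there are $1\le k\le s\le N$ with $m_t=m'_t$ for $t<k$ and for $t>s$, $m_k<m'_k$ and $m_s<m'_s$. Define $\underline m\prec^{\mathtt b}_{[\mathbf j_0]}\underline m'$ iff $\mathrm{wt}(\underline m)=\mathrm{wt}(\underline m')$ and $\underline m<^{\mathtt b}_{\mathbf j_0'}\underline m'$ for all $\mathbf j_0'\in[\mathbf j_0]$. A pair $\underline p$ is $[\mathbf j_0]$-simple if there is no sequence $\underline m\prec^{\mathtt b}_{[\mathbf j_0]}\underline p$. A sequence $\underline m$ is $[\mathbf j_0]$-simple if $|\underline m|=1$ or every pair formed by two distinct roots with positive entry in $\underline m$ is $[\mathbf j_0]$-simple. For a non-simple sequence $\underline m$, $\mathrm{gdist}_{[\mathbf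 j_0]}(\underline m)$ is the maximal $k$ for which there are non-$[\mathbf j_0]$-simple sequences $\underline m^{(1)}\prec^{\mathtt b}_{[\mathbf j_0]}\cdots\prec^{\mathtt b}_{[\mathbf j_0]}\underline m^{(k)}=\underline m$; for simple $\underline m$ it is $0$. $\mathrm{gdist}_{[\mathbf j_0]}(\alpha,\beta)$ is the value at the pair $\{\alpha,\beta\}$ (it is $0$ if $\alpha,\beta$ are incomparable for the order $\prec_{[\mathbf j_0]}$, where $\alpha\prec_{[\mathbf j_0]}\beta$ iff $\alpha<_{\mathbf j'_0}\beta$ for all $\mathbf j'_0\in[\mathbf j_0]$). For $\gamma\in\Phi^+\setminus\Pi$, $\mathrm{rds}_{[\mathbf j_0]}(\gamma)=\max\{\mathrm{gdist}_{[\mathbf j_0]}(\underline p): \underline p \text{ a pair},\ \gamma\prec^{\mathtt b}_{[\mathbf j_0]}\underline p\}$. For a pair $\underline p$, $\mathrm{soc}_{[\mathbf j_0]}(\underline p)$ is the $[\mathbf j_0]$-simple sequence $\underline s$ with $\underline s\preceq^{\mathtt b}_{[\mathbf j_0]}\underline p$, if such $\underline s$ exists uniquely; it is well-defined when it does. Folded multiplicity: for $\gamma=\sum_i m_i\alpha_i\in\Phi^+$, $\overline{\mathsf m}(\gamma)=\max\{m_1,\dots,m_{n-1},\,m_n+m_{n+1}\}$.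
   Formalization: In (1) the maximum of the folded multiplicity is taken over all positive roots γ rather than over γ = α, β; read literally, (1) is false, since some pairs with both folded multiplicities equal to 1 have gdist 2. *)

theory Defs
  imports "HOL-Library.Multiset"
begin

text \<open>
  Throughout, \<open>n\<close> is the rank parameter of type $D_{n+1}$.  Elements of the root lattice are
  their coefficient vectors \<open>nat \<Rightarrow> int\<close> with respect to the simple roots, and vanish outside
  the index set.  Words are lists of indices.
\<close>

definition idx :: "nat \<Rightarrow> nat set" where
  "idx n = {1..n+1}"

definition dynkin_edge :: "nat \<Rightarrow> nat \<Rightarrow> nat \<Rightarrow> bool" where
  "dynkin_edge n i j \<longleftrightarrow>
     (1 \<le> i \<and> i \<le> n - 1 \<and> j = i + 1) \<or> (1 \<le> j \<and> j \<le> n - 1 \<and> i = j + 1) \<or>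
     (i = n - 1 \<and> j = n + 1) \<or> (j = n - 1 \<and> i = n + 1)"

definition cartan :: "nat \<Rightarrow> nat \<Rightarrow> nat \<Rightarrow> int" where
  "cartan n i j = (if i = j then 2 else if dynkin_edge n i j then - 1 else 0)"

definition simple_root :: "nat \<Rightarrow> nat \<Rightarrow> int" where
  "simple_root i = (\<lambda>j. if j = i then 1 else 0)"

definition simple_refl :: "nat \<Rightarrow> nat \<Rightarrow> (nat \<Rightarrow> int) \<Rightarrow> (nat \<Rightarrow> int)" where
  "simple_refl n i v = (\<lambda>j. v j - (\<Sum>k\<in>idx n. cartan n i k * v k) * simple_root i j)"

text \<open>\<open>word_elt n [j\<^sub>1, \<dots>, j\<^sub>m]\<close> is the product $s_{j_1} \cdots s_{j_m}$.\<close>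
definition word_elt :: "nat \<Rightarrow> nat list \<Rightarrow> (nat \<Rightarrow> int) \<Rightarrow> (nat \<Rightarrow> int)" where
  "word_elt n u = foldr (simple_refl n) u"

definition weyl_group :: "nat \<Rightarrow> ((nat \<Rightarrow> int) \<Rightarrow> (nat \<Rightarrow> int)) set" where
  "weyl_group n = {word_elt n u | u. set u \<subseteq> idx n}"

definition weyl_length :: "nat \<Rightarrow> ((nat \<Rightarrow> int) \<Rightarrow> (nat \<Rightarrow> int)) \<Rightarrow> nat" where
  "weyl_length n w = (LEAST k. \<exists>u. set u \<subseteq> idx n \<and> word_elt n u = w \<and> length u = k)"

definition is_longest :: "nat \<Rightarrow> ((nat \<Rightarrow> int) \<Rightarrow> (nat \<Rightarrow> int)) \<Rightarrow> bool" where
  "is_longest n w \<longleftrightarrow> w \<in> weyl_group n \<and> (\<forall>w'\<in>weyl_group n. weyl_length n w' \<le> weyl_length n w)"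

definition reduced_longest_word :: "nat \<Rightarrow> nat list \<Rightarrow> bool" where
  "reduced_longest_word n u \<longleftrightarrow>
     set u \<subseteq> idx n \<and> is_longest n (word_elt n u) \<and> length u = weyl_length n (word_elt n u)"

definition roots :: "nat \<Rightarrow> (nat \<Rightarrow> int) set" where
  "roots n = {w (simple_root i) | w i. w \<in> weyl_group n \<and> i \<in> idx n}"

definition pos_roots :: "nat \<Rightarrow> (nat \<Rightarrow> int) set" where
  "pos_roots n = {v \<in> roots n. \<forall>i\<in>idx n. 0 \<le> v i}"

definition simple_roots :: "nat \<Rightarrow> (nat \<Rightarrow> int) set" where
  "simple_roots n = simple_root ` idx n"

definition comm_step :: "nat \<Rightarrow> nat list \<Rightarrow> nat list \<Rightarrow> bool" where
  "comm_step n u v \<longleftrightarrow>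
     (\<exists>a b i j. u = a @ [i, j] @ b \<and> v = a @ [j, i] @ b \<and> i \<noteq> j \<and> \<not> dynkin_edge n i j)"

text \<open>\<open>comm_step\<close> is symmetric, so its reflexive-transitive closure is an equivalence.\<close>
definition comm_class :: "nat \<Rightarrow> nat list \<Rightarrow> nat list set" where
  "comm_class n u = {v. (comm_step n)\<^sup>*\<^sup>* u v}"

definition vee :: "nat \<Rightarrow> nat \<Rightarrow> nat" where
  "vee n i = (if i = n then n + 1 else if i = n + 1 then n else i)"

definition twisted_word :: "nat \<Rightarrow> nat list \<Rightarrow> nat list" where
  "twisted_word n js = concat (map (\<lambda>k. map (vee n ^^ k) js) [0..<n+1])"

definition twisted_adapted :: "nat \<Rightarrow> nat list set \<Rightarrow> bool" where
  "twisted_adapted n C \<longleftrightarrow>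
     (\<exists>js. length js = n \<and> set js \<subseteq> idx n \<and>
        (\<forall>i\<in>idx n. \<exists>!k. k < length js \<and> js ! k \<in> {i, vee n i}) \<and>
        reduced_longest_word n (twisted_word n js) \<and>
        C = comm_class n (twisted_word n js))"

text \<open>Positions are counted from 0: \<open>word_root n u k\<close> is $\beta_{k+1}^{u}$.\<close>
definition word_root :: "nat \<Rightarrow> nat list \<Rightarrow> nat \<Rightarrow> (nat \<Rightarrow> int)" where
  "word_root n u k = word_elt n (take k u) (simple_root (u ! k))"

text \<open>
  A sequence, i.e. an element of $\mathbb{Z}_{\ge 0}^{\Phi^+}$, is encoded as a multiset of
  positive roots: its entry at \<open>\<beta>\<close> is the multiplicity of \<open>\<beta>\<close>, $|\underline m|$ is its size,
  the root \<open>\<gamma>\<close> is \<open>{#\<gamma>#}\<close> and the pair \<open>(\<alpha>, \<beta>)\<close> is \<open>{#\<alpha>, \<beta>#}\<close>.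
\<close>
definition is_seq :: "nat \<Rightarrow> (nat \<Rightarrow> int) multiset \<Rightarrow> bool" where
  "is_seq n m \<longleftrightarrow> set_mset m \<subseteq> pos_roots n"

definition wt :: "(nat \<Rightarrow> int) multiset \<Rightarrow> (nat \<Rightarrow> int)" where
  "wt m = (\<lambda>i. \<Sum>v\<in>#m. v i)"

definition is_pair :: "nat \<Rightarrow> (nat \<Rightarrow> int) multiset \<Rightarrow> bool" where
  "is_pair n p \<longleftrightarrow> is_seq n p \<and> size p = 2 \<and> (\<forall>v. count p v \<le> 1)"

definition bilex :: "nat \<Rightarrow> nat list \<Rightarrow> (nat \<Rightarrow> int) multiset \<Rightarrow> (nat \<Rightarrow> int) multiset \<Rightarrow> bool" where
  "bilex n u m m' \<longleftrightarrow>
     (\<exists>k s. k \<le> s \<and> s < length u \<and>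
        (\<forall>t<k. count m (word_root n u t) = count m' (word_root n u t)) \<and>
        (\<forall>t. s < t \<and> t < length u \<longrightarrow> count m (word_root n u t) = count m' (word_root n u t)) \<and>
        count m (word_root n u k) < count m' (word_root n u k) \<and>
        count m (word_root n u s) < count m' (word_root n u s))"

text \<open>In what follows \<open>C\<close> is a commutation class.\<close>
definition prec :: "nat \<Rightarrow> nat list set \<Rightarrow> (nat \<Rightarrow> int) multiset \<Rightarrow> (nat \<Rightarrow> int) multiset \<Rightarrow> bool" where
  "prec n C m m' \<longleftrightarrow> wt m = wt m' \<and> (\<forall>u\<in>C. bilex n u m m')"

definition simple_pair :: "nat \<Rightarrow> nat list set \<Rightarrow> (nat \<Rightarrow> int) multiset \<Rightarrow> bool" where
  "simple_pair n C p \<longleftrightarrow> \<not> (\<exists>m. is_seq n m \<and> prec n C m p)"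

definition simple_seq :: "nat \<Rightarrow> nat list set \<Rightarrow> (nat \<Rightarrow> int) multiset \<Rightarrow> bool" where
  "simple_seq n C m \<longleftrightarrow>
     size m = 1 \<or> (\<forall>\<alpha>\<in>#m. \<forall>\<beta>\<in>#m. \<alpha> \<noteq> \<beta> \<longrightarrow> simple_pair n C {#\<alpha>, \<beta>#})"

text \<open>
  The value at a pair of roots incomparable for the convex order of \<open>C\<close> needs no separate
  clause: some word of \<open>C\<close> has the two roots at adjacent positions, which leaves no smaller
  sequence of the same weight, so such a pair is simple.
\<close>
definition gdist :: "nat \<Rightarrow> nat list set \<Rightarrow> (nat \<Rightarrow> int) multiset \<Rightarrow> nat" where
  "gdist n C m =
     (if simple_seq n C m then 0
      else Max {length ms | ms. ms \<noteq> [] \<and> last ms = m \<and>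
                  (\<forall>x\<in>set ms. is_seq n x \<and> \<not> simple_seq n C x) \<and>
                  successively (prec n C) ms})"

definition rds :: "nat \<Rightarrow> nat list set \<Rightarrow> (nat \<Rightarrow> int) \<Rightarrow> nat" where
  "rds n C \<gamma> = Max {gdist n C p | p. is_pair n p \<and> prec n C {#\<gamma>#} p}"

text \<open>The candidates \<open>s\<close> for the socle of \<open>p\<close>; the socle is well-defined iff there is exactly one.\<close>
definition is_socle :: "nat \<Rightarrow> nat list set \<Rightarrow> (nat \<Rightarrow> int) multiset \<Rightarrow> (nat \<Rightarrow> int) multiset \<Rightarrow> bool" where
  "is_socle n C p s \<longleftrightarrow> is_seq n s \<and> simple_seq n C s \<and> (s = p \<or> prec n C s p)"

definition folded_mult :: "nat \<Rightarrow> (nat \<Rightarrow> int) \<Rightarrow> int" where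
  "folded_mult n \<gamma> = Max (\<gamma> ` {1..n-1} \<union> {\<gamma> n + \<gamma> (n + 1)})"

end

theory Submission
  imports Defs
begin

text \<open>
  The product of $s_{i_1} \cdots s_{i_n}$ and the diagram automorphism acts on
  $\pm\varepsilon_1, \dots, \pm\varepsilon_{n+1}$ as a cycle of length $2(n+1)$.  Numbering this
  cycle as $v_0, v_1, \dots$ (so that $v_{x+n+1} = - v_x$), the positive roots become the vectors
  $v_x - v_y$ for $(x, y)$ in a slice of the strip $x < y < x + n + 1$, and the convex order of the
  commutation class becomes the componentwise order on these points.  A sequence is smaller than a
  pair $(a, b) < (c, d)$ iff it has the same weight and lies strictly between the two points.  Viewing a
  point $(x, y)$ as the interval from $x$ to $y$ and counting how often each place is covered, one
  sees that such a sequence arises from the pair by exchanging end points modulo $n + 1$.  There are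
  at most two such exchanges; both occur, one above the other, only when $a + n + 1 < d$ and
  $c \le b$, which is the source of the value 2.  A root has folded multiplicity 2 iff its
  point satisfies $x < n < y$, because the place $n$ carries $\pm\varepsilon_{n+1}$.
\<close>

text \<open>Two obstacles shape the argument. The order on sequences quantifies over every word of
  the class, so the possible rearrangements must be known. Roots at incomparable points are
  orthogonal, because their four ends differ modulo \<open>h\<close>; a point and one covering it
  share an end and have product 1. As neighbouring letters commute iff their roots are orthogonal,
  commutations are exactly the swaps of incomparable neighbours. Hence for each point
  \<open>q\<close> some word has only points below \<open>q\<close> in front of it, and some word
  has only points above \<open>q\<close> behind it. This confines a sequence smaller than a pair to
  the rectangle between the two points. The second obstacle is that weights see end points only
  modulo \<open>h\<close>. A step function as test function yields the number of intervals over
  \<open>r\<close> minus the number over \<open>r + h\<close>. Where nothing reaches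
  \<open>r + h\<close>, this is an exact count, and it fixes how many intervals cross a place before
  any end points are compared; delta functions then find the ends. The rule
  \<open>v (x + h) = - v x\<close> makes a right end \<open>d\<close> act as a left end
  \<open>d - h\<close>.\<close>

section \<open>Sequences between two points of the strip\<close>

text \<open>
  The coordinates of $v_x$ span all functions \<open>\<chi>\<close> with \<open>\<chi> (x + h) = - \<chi> x\<close>, so testing against
  these functions is the same as comparing weights.
\<close>
definition same_weight :: "nat \<Rightarrow> (nat \<times> nat) multiset \<Rightarrow> (nat \<times> nat) multiset \<Rightarrow> bool" where
  "same_weight h M M' \<longleftrightarrow> (\<forall>\<chi>::nat \<Rightarrow> int. (\<forall>x. \<chi> (x + h) = - \<chi> x) \<longrightarrow>
     (\<Sum>q\<in>#M. \<chi> (fst q) - \<chi> (snd q)) = (\<Sum>q\<in>#M'. \<chi> (fst q) - \<chi> (snd q)))"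

text \<open>A function given on one period extends to an antiperiodic one, and all end points in
  question lie in a window of two periods. This makes step functions and delta functions admissible
  as tests.\<close>

lemma same_weight_window:
  fixes \<psi> :: "nat \<Rightarrow> int"
  assumes eq: "same_weight h M M'" and h: "0 < h"
    and \<psi>: "\<And>x. a \<le> x \<Longrightarrow> x < a + h \<Longrightarrow> \<psi> (x + h) = - \<psi> x"
    and win: "\<And>q. q \<in># M + M' \<Longrightarrow> a \<le> fst q \<and> fst q < a + 2 * h \<and> a \<le> snd q \<and> snd q < a + 2 * h"
  shows "(\<Sum>q\<in>#M. \<psi> (fst q) - \<psi> (snd q)) = (\<Sum>q\<in>#M'. \<psi> (fst q) - \<psi> (snd q))"
proof -
  \<comment> \<open>The shift is congruent to \<open>- a\<close> modulo \<open>2 * h\<close>: the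
    summand \<open>2 * h * a\<close> keeps the subtraction from truncating and leaves the parity of
    the quotient by \<open>h\<close> unchanged.\<close>
  define z where "z x = x + (2 * h * a - a)" for x
  define \<chi> where "\<chi> x = (if even (z x div h) then \<psi> (a + z x mod h) else - \<psi> (a + z x mod h))" for x
  have anti: "\<chi> (x + h) = - \<chi> x" for x
  proof -
    have "z (x + h) = z x + h" by (simp add: z_def)
    then show ?thesis using h by (simp add: \<chi>_def div_add_self2)
  qed
  have le: "a \<le> 2 * h * a" using h by (cases h) auto
  have lo: "\<chi> x = \<psi> x" if "a \<le> x" "x < a + h" for x
  proof -
    have "z x = (x - a) + h * (2 * a)" using that le by (simp add: z_def)
    moreover have "x - a < h" using that by linarith
    ultimately have "z x div h = 2 * a" "z x mod h = x - a" using h by auto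
    then show ?thesis using that by (simp add: \<chi>_def)
  qed
  have all: "\<chi> x = \<psi> x" if "a \<le> x" "x < a + 2 * h" for x
  proof (cases "x < a + h")
    case False
    define x' where "x' = x - h"
    have x': "x = x' + h" "a \<le> x'" using False by (simp_all add: x'_def)
    then show ?thesis using lo[of x'] anti[of x'] \<psi>[of x'] that by simp
  qed (use that lo in auto)
  have "(\<Sum>q\<in>#M. \<chi> (fst q) - \<chi> (snd q)) = (\<Sum>q\<in>#M'. \<chi> (fst q) - \<chi> (snd q))"
    using eq anti unfolding same_weight_def by blast
  moreover have "(\<Sum>q\<in>#N. \<chi> (fst q) - \<chi> (snd q)) = (\<Sum>q\<in>#N. \<psi> (fst q) - \<psi> (snd q))"
    if "N = M \<or> N = M'" for N
    by (intro arg_cong[where f = sum_mset] image_mset_cong) (use that win all in fastforce)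
  ultimately show ?thesis by metis
qed

text \<open>A point is read as the half-open interval \<open>(x, y]\<close>, so touching intervals
  do not both cover their common end.\<close>

definition coverage :: "(nat \<times> nat) multiset \<Rightarrow> nat \<Rightarrow> nat" where
  "coverage M r = size {#q \<in># M. fst q < r \<and> r \<le> snd q#}"

text \<open>Empty for \<open>x = y\<close>: an exchange of end points may make one interval vanish
  and leave a single root.\<close>

definition segment :: "nat \<Rightarrow> nat \<Rightarrow> (nat \<times> nat) multiset" where
  "segment x y = (if x < y then {#(x, y)#} else {#})"

text \<open>The test function jumps only at \<open>r\<close> and at \<open>r + h\<close>. An
  interval shorter than \<open>h\<close> crosses at most one of the jumps and contributes 2 or -2
  accordingly.\<close>

lemma step_sum:
  assumes "a < r" "r \<le> a + h"
    and "\<And>q. q \<in># M \<Longrightarrow> a \<le> fst q \<and> fst q < snd q \<and> snd q < fst q + h \<and> snd q < a + 2 * h"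
  shows "(\<Sum>q\<in>#M. (if fst q < r \<or> r + h \<le> fst q then 1 else - 1) -
           (if snd q < r \<or> r + h \<le> snd q then 1 else - 1 :: int))
         = 2 * (int (coverage M r) - int (coverage M (r + h)))"
  using assms(3)
proof (induction M)
  case (add q M)
  have q: "a \<le> fst q" "fst q < snd q" "snd q < fst q + h" "snd q < a + 2 * h"
    using add.prems[of q] by auto
  have IH: "(\<Sum>q\<in>#M. (if fst q < r \<or> r + h \<le> fst q then 1 else - 1) -
      (if snd q < r \<or> r + h \<le> snd q then 1 else - 1 :: int))
    = 2 * (int (coverage M r) - int (coverage M (r + h)))"
    by (rule add.IH) (rule add.prems, simp)
  show ?case unfolding image_mset_add_mset sum_mset.add_mset IH
    using q assms(1,2) by (auto simp: coverage_def)
qed (simp add: coverage_def)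

lemma pair_mset_eq: "{#p, q#} = {#u, w#} \<Longrightarrow> (p = u \<and> q = w) \<or> (p = w \<and> q = u)"
  by (auto simp: add_eq_conv_ex)

lemma pair_indicator_eq:
  assumes "\<And>s. of_bool (p = s) + of_bool (q = s) = of_bool (u = s) + (of_bool (w = s) :: int)"
  shows "(p = u \<and> q = w) \<or> (p = w \<and> q = u)"
proof (rule pair_mset_eq, rule multiset_eqI)
  fix s
  have "int (count {#p, q#} s) = of_bool (p = s) + of_bool (q = s)"
    "int (count {#u, w#} s) = of_bool (u = s) + of_bool (w = s)" by simp_all
  then have "int (count {#p, q#} s) = int (count {#u, w#} s)" using assms[of s] by linarith
  then show "count {#p, q#} s = count {#u, w#} s" by simp
qed

lemma coverage_0D: "coverage M r = 0 \<Longrightarrow> (x, y) \<in># M \<Longrightarrow> x < r \<Longrightarrow> \<not> r \<le> y"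
  by (auto simp: coverage_def)

section \<open>Classification of the sequences between two comparable points\<close>

context
  fixes h a b c d :: nat and M :: "(nat \<times> nat) multiset"
  assumes ab: "a < b" "b < a + h" and cd: "c < d" "d < c + h"
    and le: "a \<le> c" "b \<le> d" and d2: "d < a + 2 * h"
    and excl: "\<not> (a + h \<le> c \<and> b + h \<le> d)"
    and M: "\<And>x y. (x, y) \<in># M \<Longrightarrow> x < y \<and> y < x + h \<and> a \<le> x \<and> x \<le> c \<and> b \<le> y \<and> y \<le> d \<and>
              (x, y) \<noteq> (a, b) \<and> (x, y) \<noteq> (c, d)"
    and eq: "same_weight h M {#(a, b), (c, d)#}"
begin

lemma coverage_eq:
  assumes "a < r" "r \<le> a + h"
  shows "int (coverage M r) - int (coverage M (r + h)) =
    of_bool (r \<le> b) + of_bool (c < r \<and> r \<le> d) - of_bool (c < r + h \<and> r + h \<le> d)"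
proof -
  let ?\<psi> = "\<lambda>x. if x < r \<or> r + h \<le> x then 1 else - 1 :: int"
  have win: "a \<le> fst q \<and> fst q < snd q \<and> snd q < fst q + h \<and> snd q < a + 2 * h"
    if "q \<in># M + {#(a, b), (c, d)#}" for q
    using that ab cd le d2 M[of "fst q" "snd q"] by auto
  have "(\<Sum>q\<in>#M. ?\<psi> (fst q) - ?\<psi> (snd q)) = (\<Sum>q\<in>#{#(a, b), (c, d)#}. ?\<psi> (fst q) - ?\<psi> (snd q))"
    by (rule same_weight_window[OF eq, where a = a]) (use ab win assms in fastforce)+
  moreover have "(\<Sum>q\<in>#N. ?\<psi> (fst q) - ?\<psi> (snd q)) = 2 * (int (coverage N r) - int (coverage N (r + h)))"
    if "N = M \<or> N = {#(a, b), (c, d)#}" for N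
    by (rule step_sum[OF assms]) (use that win in \<open>metis union_iff\<close>)
  ultimately have "int (coverage M r) - int (coverage M (r + h)) =
      int (coverage {#(a, b), (c, d)#} r) - int (coverage {#(a, b), (c, d)#} (r + h))"
    by (metis mult_cancel_left zero_neq_numeral)
  moreover have "coverage {#(a, b), (c, d)#} s = of_bool (a < s \<and> s \<le> b) + of_bool (c < s \<and> s \<le> d)" for s
    by (simp add: coverage_def)
  ultimately show ?thesis using assms ab by simp
qed

text \<open>No member of \<open>M\<close> extends beyond \<open>d\<close>, so nothing covers
  \<open>r + h\<close> and the difference in \<open>coverage_eq\<close> becomes an exact count at
  \<open>r\<close>.\<close>

lemma coverage_zone:
  assumes "a < r" "r \<le> a + h" "d < r + h"
  shows "coverage M r = of_bool (r \<le> b) + of_bool (c < r \<and> r \<le> d)"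
proof -
  have "coverage M (r + h) = 0"
    using M assms(3) unfolding coverage_def size_eq_0_iff_empty by fastforce
  with coverage_eq[OF assms(1,2)] assms have "int (coverage M r) = of_bool (r \<le> b) + of_bool (c < r \<and> r \<le> d)" by simp
  then show ?thesis by (simp add: of_bool_def split: if_splits)
qed

text \<open>The test function is the delta at \<open>s\<close> minus the delta at
  \<open>s + h\<close>, so a left end at \<open>s\<close> and a right end at \<open>s + h\<close>
  count alike.\<close>

lemma point_eq:
  assumes "a \<le> s" "s < a + h"
  shows "(\<Sum>q\<in>#M. of_bool (fst q = s) - of_bool (fst q = s + h) - of_bool (snd q = s) + of_bool (snd q = s + h))
    = of_bool (a = s) + of_bool (c = s) - of_bool (c = s + h) - of_bool (b = s) - of_bool (d = s)
       + (of_bool (d = s + h) :: int)"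
proof -
  let ?\<psi> = "\<lambda>x. of_bool (x = s) - of_bool (x = s + h) :: int"
  have win: "a \<le> fst q \<and> fst q < a + 2 * h \<and> a \<le> snd q \<and> snd q < a + 2 * h"
    if "q \<in># M + {#(a, b), (c, d)#}" for q
    using that ab cd le d2 M[of "fst q" "snd q"] by auto
  have "(\<Sum>q\<in>#M. ?\<psi> (fst q) - ?\<psi> (snd q)) = (\<Sum>q\<in>#{#(a, b), (c, d)#}. ?\<psi> (fst q) - ?\<psi> (snd q))"
    by (rule same_weight_window[OF eq, where a = a]) (use ab win assms in \<open>auto simp: of_bool_def\<close>)
  then show ?thesis using assms ab by (simp add: algebra_simps)
qed

text \<open>Every member starts at or before \<open>c < b\<close> and ends at or after
  \<open>b\<close>, so all of \<open>M\<close> covers \<open>b\<close>. The coverage there is 2;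
  hence \<open>M\<close> has two members and only the pairing of ends is open.\<close>

lemma uncross_nested:
  assumes cb: "c < b"
  shows "(d < a + h \<and> a < c \<and> b < d \<and> M = {#(a, d), (c, b)#}) \<or>
         (d > a + h \<and> (M = {#(d - h, a + h), (c, b)#} \<or> M = {#(d - h, b), (c, a + h)#}))"
proof -
  have "coverage M b = 2" using coverage_zone[of b] ab cd cb le by simp
  moreover have "filter_mset (\<lambda>q. fst q < b \<and> b \<le> snd q) M = M"
    using M cb by (fastforce simp: filter_mset_eq_conv)
  ultimately have "size M = Suc (Suc 0)" by (simp add: coverage_def)
  then obtain q1 q2 where "M = {#q1, q2#}"
    by (elim size_mset_SucE) simp
  then obtain u1 w1 u2 w2 where Meq: "M = {#(u1, w1), (u2, w2)#}" by (metis surj_pair)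
  have point: "of_bool (x1 = s) - of_bool (x1 = s + h) - of_bool (y1 = s) + of_bool (y1 = s + h)
     + (of_bool (x2 = s) - of_bool (x2 = s + h) - of_bool (y2 = s) + of_bool (y2 = s + h))
    = of_bool (a = s) + of_bool (c = s) - of_bool (c = s + h) - of_bool (b = s) - of_bool (d = s)
       + (of_bool (d = s + h) :: int)" if "a \<le> s" "s < a + h" "M = {#(x1, y1), (x2, y2)#}" for s x1 y1 x2 y2
    using point_eq[OF that(1,2)] by (simp add: that)
  show ?thesis
  proof (cases "d < a + h")
    case True
    have x: "x < a + h" "a \<le> x" "x \<le> c" "b \<le> y" "y \<le> d" if "(x, y) \<in># M" for x y
      using M[OF that] True by auto
    have X: "of_bool (u1 = s) + of_bool (u2 = s) = of_bool (a = s) + (of_bool (c = s) :: int)" for s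
    proof (cases "a \<le> s \<and> s \<le> c")
      case t: True
      have "s < a + h" "u1 \<noteq> s + h" "u2 \<noteq> s + h" "w1 \<noteq> s" "w2 \<noteq> s" "w1 \<noteq> s + h" "w2 \<noteq> s + h"
        "c \<noteq> s + h" "b \<noteq> s" "d \<noteq> s" "d \<noteq> s + h"
        using t x[of u1 w1] x[of u2 w2] True cd cb by (auto simp: Meq)
      then show ?thesis using point[OF _ _ Meq, of s] t by simp
    qed (use x[of u1 w1] x[of u2 w2] le in \<open>auto simp: Meq\<close>)
    have Y: "of_bool (w1 = s) + of_bool (w2 = s) = of_bool (b = s) + (of_bool (d = s) :: int)" for s
    proof (cases "b \<le> s \<and> s \<le> d")
      case t: True
      have "s < a + h" "u1 \<noteq> s + h" "u2 \<noteq> s + h" "u1 \<noteq> s" "u2 \<noteq> s" "w1 \<noteq> s + h" "w2 \<noteq> s + h"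
        "c \<noteq> s + h" "c \<noteq> s" "a \<noteq> s" "d \<noteq> s + h" "a \<le> s"
        using t x[of u1 w1] x[of u2 w2] True cb ab by (auto simp: Meq)
      then have "- of_bool (w1 = s) - of_bool (w2 = s) = - of_bool (b = s) - (of_bool (d = s) :: int)"
        using point[OF _ _ Meq, of s] by simp
      then show ?thesis by linarith
    qed (use x[of u1 w1] x[of u2 w2] le in \<open>auto simp: Meq\<close>)
    show ?thesis
      using M[of u1 w1] M[of u2 w2] True le pair_indicator_eq[OF X] pair_indicator_eq[OF Y]
      by (auto simp: Meq)
  next
    case False
    define e where "e = d - h"
    have e: "d = e + h" "a \<le> e" "e < c" using False cd by (auto simp: e_def)
    \<comment> \<open>One right end is \<open>b\<close>. The other lies in the second period and
      counts as a left end shifted by \<open>h\<close>, so three left ends must match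
      \<open>a\<close>, \<open>c\<close>, \<open>e\<close>.\<close>
    have key: ?thesis if N: "M = {#(x1, b), (x2, y2)#}" "a + h \<le> y2" for x1 x2 y2
    proof -
      define y where "y = y2 - h"
      have y: "y2 = y + h" "a \<le> y" "y \<le> e" using N M[of x2 y2] e by (auto simp: y_def)
      have x: "a \<le> x1" "x1 \<le> c" "a \<le> x2" "x2 \<le> c" using M[of x1 b] M[of x2 y2] by (auto simp: N)
      have X: "of_bool (x1 = s) + of_bool (x2 = s) + of_bool (y = s) =
          of_bool (a = s) + of_bool (c = s) + (of_bool (e = s) :: int)" for s
      proof (cases "a \<le> s \<and> s \<le> c")
        case t: True
        have "s < a + h" "x1 \<noteq> s + h" "x2 \<noteq> s + h" "b \<noteq> s" "b \<noteq> s + h" "y2 \<noteq> s"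
          "c \<noteq> s + h" "d \<noteq> s"
          using t x y e ab cb by auto
        then show ?thesis using point[OF _ _ N(1), of s] t by (simp add: y e)
      qed (use x y e in auto)
      have X': "{#x1, x2, y#} = {#a, c, e#}"
      proof (rule multiset_eqI)
        fix s
        have *: "int (count {#x1, x2, y#} s) = of_bool (x1 = s) + of_bool (x2 = s) + of_bool (y = s)"
          "int (count {#a, c, e#} s) = of_bool (a = s) + of_bool (c = s) + of_bool (e = s)"
          by simp_all
        show "count {#x1, x2, y#} s = count {#a, c, e#} s" using * X[of s] by linarith
      qed
      then have "y \<in># {#a, c, e#}" by (metis union_single_eq_member add_mset_commute)
      \<comment> \<open>The value \<open>c\<close> drops out because
        \<open>y \<le> e < c\<close>.\<close>
      then have "y = e \<or> y = a" using y e by auto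
      then show ?thesis
      proof
        \<comment> \<open>The right ends would be \<open>b\<close> and \<open>d\<close> again: one
          pairing gives back the excluded points, the other contains \<open>(a, d)\<close>, which is
          too long.\<close>
        assume "y = e"
        with X' have "{#x1, x2#} = {#a, c#}" by (simp add: add_mset_commute)
        then show ?thesis using M[of x1 b] M[of x2 y2] y e False \<open>y = e\<close>
          by (auto simp: N dest!: pair_mset_eq)
      next
        assume "y = a"
        with X' have "{#x1, x2#} = {#c, e#}" by (simp add: add_mset_commute)
        then show ?thesis using M[of x1 b] M[of x2 y2] y e False \<open>y = a\<close>
          by (auto simp: N add_mset_commute dest!: pair_mset_eq)
      qed
    qed
    have x: "a \<le> x" "x \<le> c" "b \<le> y" "y \<le> d" if "(x, y) \<in># M" for x y
      using M[OF that] by auto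
    have Y: "of_bool (w1 = s) + of_bool (w2 = s) = (of_bool (b = s) :: int)" if "b \<le> s" "s < a + h" for s
    proof -
      have "u1 \<noteq> s + h" "u2 \<noteq> s + h" "u1 \<noteq> s" "u2 \<noteq> s" "w1 \<noteq> s + h" "w2 \<noteq> s + h"
        "c \<noteq> s + h" "c \<noteq> s" "a \<noteq> s" "d \<noteq> s" "d \<noteq> s + h" "a \<le> s"
        using that x[of u1 w1] x[of u2 w2] ab cb e False by (auto simp: Meq)
      then have "- of_bool (w1 = s) - of_bool (w2 = s) = (- of_bool (b = s) :: int)"
        using point[OF _ _ Meq, of s] that by simp
      then show ?thesis by linarith
    qed
    have "(w1 = b \<and> w2 \<noteq> b) \<or> (w2 = b \<and> w1 \<noteq> b)" using Y[of b] ab by (auto simp: of_bool_def split: if_splits)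
    then show ?thesis
    proof
      assume w: "w1 = b \<and> w2 \<noteq> b"
      have "a + h \<le> w2" using Y[of w2] x[of u2 w2] w by (cases "w2 < a + h") (auto simp: Meq)
      then show ?thesis using key[of u1 u2 w2] Meq w by blast
    next
      assume w: "w2 = b \<and> w1 \<noteq> b"
      have "a + h \<le> w1" using Y[of w1] x[of u1 w1] w by (cases "w1 < a + h") (auto simp: Meq)
      then show ?thesis using key[of u2 u1 w1] Meq w by (auto simp: add_mset_commute)
    qed
  qed
qed

text \<open>Serves the cases in which the inner ends cancel, so that \<open>x\<close> and
  \<open>y\<close> balance \<open>a\<close> and \<open>d\<close> modulo \<open>h\<close>. If
  \<open>d < a + h\<close>, both ends are forced; otherwise \<open>d\<close> acts as a left end
  \<open>d - h\<close>, and besides \<open>(a, d)\<close> only the swapped ends remain.\<close>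

lemma ends:
  assumes "x < b" "b < y" "a \<le> x" "y \<le> d" "(x, y) \<noteq> (a, d)"
    and point: "\<And>s. a \<le> s \<Longrightarrow> s < a + h \<Longrightarrow> of_bool (x = s) - of_bool (y = s) + of_bool (y = s + h)
        = of_bool (a = s) - of_bool (d = s) + (of_bool (d = s + h) :: int)"
  shows "d > a + h \<and> x = d - h \<and> y = a + h"
proof (cases "d < a + h")
  case True
  have "x = a" using point[of a] assms True ab by (auto simp: of_bool_def split: if_splits)
  moreover have "y = d" using point[of d] assms True ab by (auto simp: of_bool_def split: if_splits)
  ultimately show ?thesis using assms by simp
next
  case False
  define e where "e = d - h"
  have e: "d = e + h" "a \<le> e" using False by (auto simp: e_def)
  have "a + h \<le> y"
    using point[of y] assms ab e by (cases "y < a + h") (auto simp: of_bool_def split: if_splits)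
  define z where "z = y - h"
  have z: "y = z + h" "a \<le> z" using \<open>a + h \<le> y\<close> by (auto simp: z_def)
  have eh: "e < a + h" using d2 e by simp
  have *: "of_bool (x = s) + of_bool (z = s) = of_bool (a = s) + (of_bool (e = s) :: int)"
    if "a \<le> s" "s < a + h" for s
    using point[of s] that z e by auto
  have "x = a \<and> z = e \<or> x = e \<and> z = a"
  proof (rule pair_indicator_eq)
    fix s
    show "of_bool (x = s) + of_bool (z = s) = of_bool (a = s) + (of_bool (e = s) :: int)"
    proof (cases "a \<le> s \<and> s < a + h")
      case False
      then have "x \<noteq> s" "z \<noteq> s" "a \<noteq> s" "e \<noteq> s" using assms ab z e eh by auto
      then show ?thesis by simp
    qed (use * in blast)
  qed
  then show ?thesis using assms z e by auto
qed

text \<open>Exactly one member covers \<open>b\<close> and exactly one covers \<open>b + 1\<close>: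
  either the same interval passes over \<open>b\<close>, or two intervals meet there.\<close>

lemma uncross_touch:
  assumes cb: "c = b"
  shows "(d < a + h \<and> M = {#(a, d)#}) \<or>
         (d > a + h \<and> (M = {#(d - h, a + h)#} \<or> M = {#(d - h, b), (b, a + h)#}))"
proof -
  have el: "a \<le> x" "x \<le> b" "b \<le> y" "y \<le> d" "x < y" "y < x + h" if "(x, y) \<in># M" for x y
    using M[OF that] cb by auto
  have "coverage M b = 1" using coverage_zone[of b] ab cd cb by simp
  then obtain x1 y1 where F: "{#q \<in># M. fst q < b \<and> b \<le> snd q#} = {#(x1, y1)#}"
    by (auto simp: coverage_def elim!: size_mset_SucE)
  have q1: "(x1, y1) \<in># M" "x1 < b" "b \<le> y1"
    using arg_cong[OF F, of "\<lambda>N. (x1, y1) \<in># N"] by auto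
  define N where "N = {#q \<in># M. \<not> (fst q < b \<and> b \<le> snd q)#}"
  have MN: "M = add_mset (x1, y1) N" using multiset_partition[of M "\<lambda>q. fst q < b \<and> b \<le> snd q"] F
    by (simp add: N_def)
  have N: "x = b \<and> b < y" if "(x, y) \<in># N" for x y using that el[of x y] by (auto simp: N_def)
  have "{#q \<in># N. fst q < b + 1 \<and> b + 1 \<le> snd q#} = N" using N by (fastforce simp: filter_mset_eq_conv)
  moreover have "coverage M (b + 1) = 1" using coverage_zone[of "b + 1"] ab cd cb by simp
  ultimately have sz: "(if b < y1 then 1 else 0) + size N = 1" using q1 by (simp add: coverage_def MN split: if_splits)
  show ?thesis
  proof (cases "b < y1")
    case True
    then have Meq: "M = {#(x1, y1)#}" using sz MN by simp
    have "(x1, y1) = (a, d) \<or> (d > a + h \<and> x1 = d - h \<and> y1 = a + h)"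
    proof (cases "(x1, y1) = (a, d)")
      case False
      show ?thesis
      proof (rule disjI2, rule ends[OF _ _ _ _ False])
      fix s assume "a \<le> s" "s < a + h"
      then show "of_bool (x1 = s) - of_bool (y1 = s) + of_bool (y1 = s + h)
        = of_bool (a = s) - of_bool (d = s) + (of_bool (d = s + h) :: int)"
        using point_eq[of s] el[OF q1(1)] ab cb by (auto simp: Meq)
      qed (use True q1 el[OF q1(1)] in auto)
    qed simp
    moreover have "d < a + h" if "(x1, y1) = (a, d)" using that el[OF q1(1)] by auto
    ultimately show ?thesis by (auto simp: Meq)
  next
    case False
    then obtain x2 y2 where "N = {#(x2, y2)#}" using sz by (auto elim!: size_mset_SucE)
    with N[of x2 y2] have N2: "N = {#(b, y2)#}" "b < y2" by auto
    have Meq: "M = {#(x1, b), (b, y2)#}" using False q1 MN N2 by auto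
    have q2: "(b, y2) \<in># M" by (simp add: Meq)
    have q1': "(x1, b) \<in># M" by (simp add: Meq)
    have "d > a + h \<and> x1 = d - h \<and> y2 = a + h"
    proof (rule ends)
      fix s assume "a \<le> s" "s < a + h"
      then show "of_bool (x1 = s) - of_bool (y2 = s) + of_bool (y2 = s + h)
        = of_bool (a = s) - of_bool (d = s) + (of_bool (d = s + h) :: int)"
        using point_eq[of s] el[OF q1(1)] ab cb by (auto simp: Meq)
    qed (use N2 q1 el[OF q1(1)] el[OF q2] M[OF q1'] in auto)
    then show ?thesis by (auto simp: Meq)
  qed
qed

text \<open>The places from \<open>b + 1\<close> to \<open>c\<close> are covered by neither given
  interval, hence by no member. So every member ends at \<open>b\<close> or starts at
  \<open>c\<close>, and counting at \<open>b\<close> and at \<open>c + 1\<close> leaves one of each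
  kind.\<close>

lemma uncross_far:
  assumes bc: "b < c" "d < b + h" "c < a + h"
  shows "d > a + h \<and> M = {#(d - h, b), (c, a + h)#}"
proof -
  have el: "a \<le> x \<and> y \<le> d \<and> x < y \<and> y < x + h \<and> (y = b \<or> x = c)" if "(x, y) \<in># M" for x y
  proof -
    \<comment> \<open>The first place of \<open>(x, y)\<close> beyond \<open>b\<close>; it falls
      into the uncovered gap unless \<open>y = b\<close> or \<open>x = c\<close>.\<close>
    define r where "r = max b x + 1"
    have "x = c" if "y \<noteq> b"
    proof (rule ccontr)
      assume "x \<noteq> c"
      then have r: "r \<le> c" "x < r" "r \<le> y" "b < r" using M[OF \<open>(x, y) \<in># M\<close>] bc that by (auto simp: r_def)
      then have "coverage M r = 0" using coverage_zone[of r] ab bc by simp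
      then show False using \<open>(x, y) \<in># M\<close> r coverage_0D by blast
    qed
    then show ?thesis using M[OF that] by auto
  qed
  have "coverage M b = 1" using coverage_zone[of b] ab bc by simp
  then obtain x1 y1 where F: "{#q \<in># M. fst q < b \<and> b \<le> snd q#} = {#(x1, y1)#}"
    by (auto simp: coverage_def elim!: size_mset_SucE)
  have q1: "(x1, y1) \<in># M" "x1 < b" "b \<le> y1"
    using arg_cong[OF F, of "\<lambda>N. (x1, y1) \<in># N"] by auto
  have "y1 = b" using el[OF q1(1)] q1 bc by auto
  define N where "N = {#q \<in># M. \<not> (fst q < b \<and> b \<le> snd q)#}"
  have MN: "M = add_mset (x1, b) N" using multiset_partition[of M "\<lambda>q. fst q < b \<and> b \<le> snd q"] F \<open>y1 = b\<close>
    by (simp add: N_def)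
  have N: "x = c \<and> c < y" if "(x, y) \<in># N" for x y using that el[of x y] by (auto simp: N_def)
  have "{#q \<in># N. fst q < c + 1 \<and> c + 1 \<le> snd q#} = N" using N by (fastforce simp: filter_mset_eq_conv)
  moreover have "coverage M (c + 1) = 1" using coverage_zone[of "c + 1"] ab cd bc by simp
  ultimately have "size N = Suc 0" using bc by (simp add: coverage_def MN)
  then obtain x2 y2 where "N = {#(x2, y2)#}" by (auto elim!: size_mset_SucE)
  with N[of x2 y2] have N2: "N = {#(c, y2)#}" "c < y2" by auto
  have Meq: "M = {#(x1, b), (c, y2)#}" using MN N2 by simp
  have q2: "(c, y2) \<in># M" by (simp add: Meq)
  have q1': "(x1, b) \<in># M" by (simp add: Meq)
  have "d > a + h \<and> x1 = d - h \<and> y2 = a + h"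
  proof (rule ends)
    fix s assume "a \<le> s" "s < a + h"
    then show "of_bool (x1 = s) - of_bool (y2 = s) + of_bool (y2 = s + h)
      = of_bool (a = s) - of_bool (d = s) + (of_bool (d = s + h) :: int)"
      using point_eq[of s] q1 bc ab by (simp add: Meq)
  qed (use bc N2 q1 el[OF q1'] el[OF q2] M[OF q1'] in auto)
  then show ?thesis by (auto simp: Meq)
qed

text \<open>Only \<open>(a, b)\<close> could cover \<open>a + 1\<close>, and it is excluded.
  Comparing \<open>a + 1\<close> with \<open>a + 1 + h\<close> then forces \<open>c = a + h\<close>,
  so that the ends \<open>a\<close> and \<open>c\<close> cancel and one root is left.\<close>

lemma uncross_right:
  assumes bc: "b < c" "d < b + h" "a + h \<le> c"
  shows "d > a + h \<and> c = a + h \<and> M = {#(d - h, b)#}"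
proof -
  have el: "y = b \<or> a + h \<le> x" if "(x, y) \<in># M" for x y
  proof (rule ccontr)
    define r where "r = max b x + 1"
    assume "\<not> ?thesis"
    then have r: "r \<le> a + h" "x < r" "r \<le> y" "b < r" "r \<le> c" using M[OF that] bc ab by (auto simp: r_def)
    then have "coverage M r = 0" using coverage_zone[of r] ab bc by simp
    then show False using that r coverage_0D by blast
  qed
  have "coverage M b = 1" using coverage_zone[of b] ab bc by simp
  then obtain x1 y1 where F: "{#q \<in># M. fst q < b \<and> b \<le> snd q#} = {#(x1, y1)#}"
    by (auto simp: coverage_def elim!: size_mset_SucE)
  have q1: "(x1, y1) \<in># M" "x1 < b" "b \<le> y1"
    using arg_cong[OF F, of "\<lambda>N. (x1, y1) \<in># N"] by auto
  have "y1 = b" using el[OF q1(1)] q1 ab by auto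
  define N where "N = {#q \<in># M. \<not> (fst q < b \<and> b \<le> snd q)#}"
  have MN: "M = add_mset (x1, b) N" using multiset_partition[of M "\<lambda>q. fst q < b \<and> b \<le> snd q"] F \<open>y1 = b\<close>
    by (simp add: N_def)
  have N: "a + h \<le> x \<and> x \<le> c \<and> x < y" if "(x, y) \<in># N" for x y
    using that el[of x y] M[of x y] by (auto simp: N_def)
  have "{#q \<in># M. fst q < a + 1 \<and> a + 1 \<le> snd q#} = {#}"
    using el M ab by fastforce
  then have "coverage M (a + 1) = 0" by (simp add: coverage_def)
  \<comment> \<open>At \<open>a + 1\<close> the left side of \<open>coverage_eq\<close> is at most 0
    and the right side at least 0, so both vanish.\<close>
  then have c0: "c = a + h" "coverage M (a + 1 + h) = 0"
    using coverage_eq[of "a + 1"] ab bc cd by (auto simp: of_bool_def split: if_splits)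
  have "N = {#}"
  proof (rule ccontr)
    assume "N \<noteq> {#}"
    then obtain x y where "(x, y) \<in># N" by (metis multiset_nonemptyE surj_pair)
    then have "(x, y) \<in># M" "x < a + 1 + h" "a + 1 + h \<le> y" using N[of x y] c0 MN by auto
    then show False using c0(2) coverage_0D by blast
  qed
  then have Meq: "M = {#(x1, b)#}" using MN by simp
  define e where "e = d - h"
  have e: "d = e + h" "a < e" using bc cd by (auto simp: e_def)
  have "x1 = e"
    using point_eq[of e] e ab c0 bc d2 q1 by (auto simp: Meq of_bool_def split: if_splits)
  then show ?thesis using e c0 by (auto simp: Meq)
qed

text \<open>Mirror image of \<open>uncross_right\<close>: only \<open>(c, d)\<close> could cover the
  place \<open>d\<close>, and it is excluded, which forces \<open>d = b + h\<close>.\<close>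

lemma uncross_left:
  assumes bc: "b < c" "b + h \<le> d" "c < a + h"
  shows "d > a + h \<and> b = d - h \<and> M = {#(c, a + h)#}"
proof -
  define e where "e = d - h"
  have e: "d = e + h" "b \<le> e" "e < c" using bc cd by (auto simp: e_def)
  have el: "x = c \<or> y \<le> e" if "(x, y) \<in># M" for x y
  proof (rule ccontr)
    define r where "r = max e x + 1"
    assume "\<not> ?thesis"
    then have r: "e < r" "x < r" "r \<le> y" "b < r" "r \<le> c" using M[OF that] bc ab e by (auto simp: r_def)
    then have "coverage M r = 0" using coverage_zone[of r] ab bc e by simp
    then show False using that r coverage_0D by blast
  qed
  have "coverage M (c + 1) = 1" using coverage_zone[of "c + 1"] ab bc cd by simp
  then obtain x1 y1 where F: "{#q \<in># M. fst q < c + 1 \<and> c + 1 \<le> snd q#} = {#(x1, y1)#}"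
    by (auto simp: coverage_def elim!: size_mset_SucE)
  have q1: "(x1, y1) \<in># M" "x1 \<le> c" "c < y1"
    using arg_cong[OF F, of "\<lambda>N. (x1, y1) \<in># N"] by auto
  have "x1 = c" using el[OF q1(1)] q1 e by auto
  define N where "N = {#q \<in># M. \<not> (fst q < c + 1 \<and> c + 1 \<le> snd q)#}"
  have MN: "M = add_mset (c, y1) N" using multiset_partition[of M "\<lambda>q. fst q < c + 1 \<and> c + 1 \<le> snd q"]
    unfolding F \<open>x1 = c\<close> N_def by simp
  have N: "y \<le> e \<and> b \<le> y \<and> x < y" if "(x, y) \<in># N" for x y
    using that el[of x y] M[of x y] by (auto simp: N_def)
  have "{#q \<in># M. fst q < e + h \<and> e + h \<le> snd q#} = {#}"
    using el M e d2 bc cd by fastforce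
  then have "coverage M (e + h) = 0" by (simp add: coverage_def)
  then have c0: "e = b" "coverage M e = 0"
    using coverage_eq[of e] ab bc cd e by (auto simp: of_bool_def split: if_splits)
  have "N = {#}"
  proof (rule ccontr)
    assume "N \<noteq> {#}"
    then obtain x y where "(x, y) \<in># N" by (metis multiset_nonemptyE surj_pair)
    then have "(x, y) \<in># M" "x < e" "e \<le> y" using N[of x y] c0 MN by auto
    then show False using c0(2) coverage_0D by blast
  qed
  then have Meq: "M = {#(c, y1)#}" using MN by simp
  have "y1 = a + h"
    using point_eq[of a] e ab c0 bc d2 q1 by (auto simp: Meq of_bool_def split: if_splits)
  then show ?thesis using e c0 ab by (auto simp: Meq)
qed

text \<open>The first shape needs no wrapping. If \<open>d > a + h\<close>, then \<open>d\<close>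
  and \<open>a\<close> act as the ends \<open>d - h\<close> and \<open>a + h\<close>, which are
  paired either with each other or with \<open>b\<close> and \<open>c\<close>. For
  \<open>d = a + h\<close> nothing lies between.\<close>

theorem uncross:
  "(d < a + h \<and> a < c \<and> b < d \<and> c \<le> b \<and> M = {#(a, d)#} + segment c b) \<or>
   (d > a + h \<and> c \<le> b \<and> M = {#(d - h, a + h)#} + segment c b) \<or>
   (d > a + h \<and> d - h \<le> b \<and> c \<le> a + h \<and> M = segment (d - h) b + segment c (a + h))"
proof -
  consider "c < b" | "c = b" | "b < c" "d < b + h" "c < a + h" | "b < c" "d < b + h" "a + h \<le> c"
    | "b < c" "b + h \<le> d" "c < a + h"
    using excl ab by linarith
  then show ?thesis
  proof cases
    case 1 then show ?thesis using uncross_nested ab cd by (auto simp: segment_def)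
  next
    case 2 then show ?thesis using uncross_touch ab cd by (auto simp: segment_def)
  next
    case 3 then show ?thesis using uncross_far ab cd by (auto simp: segment_def)
  next
    case 4 then show ?thesis using uncross_right ab cd by (auto simp: segment_def)
  next
    case 5 then show ?thesis using uncross_left ab cd by (auto simp: segment_def)
  qed
qed

end

section \<open>Commutation classes as linear extensions\<close>

text \<open>Take the last \<open>z\<close> in front of \<open>q\<close> that is not below
  \<open>q\<close>. By transitivity it is not below anything standing between them, so it can be
  moved past \<open>q\<close>, which shortens the part in front of \<open>q\<close>.\<close>

lemma bubble_before:
  assumes swap: "\<And>A x y B. A @ x # y # B \<in> S \<Longrightarrow> \<not> le x y \<Longrightarrow> A @ y # x # B \<in> S"
    and trans: "\<And>x y z. le x y \<Longrightarrow> le y z \<Longrightarrow> le x z"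
    and "A @ q # B \<in> S"
  shows "\<exists>A B. A @ q # B \<in> S \<and> (\<forall>z\<in>set A. le z q)"
  using assms(3)
proof (induction "length A" arbitrary: A B rule: less_induct)
  case less
  have move: "A' @ D @ q # z # B \<in> S"
    if "A' @ z # D @ q # B \<in> S" "\<forall>y\<in>set D. le y q" "\<not> le z q" for A' z D
    using that
  proof (induction D arbitrary: A')
    case Nil
    then show ?case using swap[of A' z q B] by simp
  next
    case (Cons y D)
    then have "\<not> le z y" using trans by auto
    then have "(A' @ [y]) @ z # D @ q # B \<in> S" using swap[of A' z y "D @ q # B"] Cons.prems by simp
    from Cons.IH[OF this] Cons.prems show ?case by simp
  qed
  show ?case
  proof (cases "\<forall>z\<in>set A. le z q")
    case True
    then show ?thesis using less.prems by blast
  next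
    case False
    then obtain A' z D where A: "A = A' @ z # D" "\<not> le z q" "\<forall>y\<in>set D. le y q"
      using split_list_last_prop[of A "\<lambda>z. \<not> le z q"] by auto
    then have "(A' @ D) @ q # z # B \<in> S" using move[of A' z D] less.prems by simp
    from less.hyps[OF _ this] A show ?thesis by simp
  qed
qed

lemma bubble_after:
  assumes swap: "\<And>A x y B. A @ x # y # B \<in> S \<Longrightarrow> \<not> le x y \<Longrightarrow> A @ y # x # B \<in> S"
    and trans: "\<And>x y z. le x y \<Longrightarrow> le y z \<Longrightarrow> le x z"
    and "A @ q # B \<in> S"
  shows "\<exists>A B. A @ q # B \<in> S \<and> (\<forall>z\<in>set B. le q z)"
proof -
  have rev: "A @ C \<in> rev ` S \<longleftrightarrow> rev C @ rev A \<in> S" for A C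
    by (metis image_iff rev_append rev_rev_ident)
  have "\<exists>A B. A @ q # B \<in> rev ` S \<and> (\<forall>z\<in>set A. le q z)"
  proof (rule bubble_before[where le = "\<lambda>x y. le y x"])
    fix A x y B assume "A @ x # y # B \<in> rev ` S" "\<not> le y x"
    then show "A @ y # x # B \<in> rev ` S" using swap[of "rev B" y x "rev A"] by (simp add: rev)
  next
    show "rev B @ q # rev A \<in> rev ` S" using assms(3) by (simp add: rev)
  qed (use trans in blast)
  then obtain A B where "rev B @ q # rev A \<in> S" "\<forall>z\<in>set A. le q z" by (auto simp: rev)
  then show ?thesis by (metis set_rev)
qed

text \<open>The comparison \<open>bilex\<close> for an arbitrary list, so that lists of roots and
  lists of points are treated alike.\<close>

definition bilex_list :: "'a list \<Rightarrow> 'a multiset \<Rightarrow> 'a multiset \<Rightarrow> bool" where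
  "bilex_list l M M' \<longleftrightarrow> (\<exists>k s. k \<le> s \<and> s < length l \<and>
     (\<forall>t<k. count M (l ! t) = count M' (l ! t)) \<and>
     (\<forall>t. s < t \<and> t < length l \<longrightarrow> count M (l ! t) = count M' (l ! t)) \<and>
     count M (l ! k) < count M' (l ! k) \<and> count M (l ! s) < count M' (l ! s))"

lemma bilex_list_first:
  assumes "bilex_list (A @ q # B) M M'" "count M q \<noteq> count M' q"
  shows "\<exists>p. (p = q \<or> p \<in> set A) \<and> count M p < count M' p"
proof -
  obtain k where k: "\<forall>t<k. count M ((A @ q # B) ! t) = count M' ((A @ q # B) ! t)"
    "count M ((A @ q # B) ! k) < count M' ((A @ q # B) ! k)"
    using assms(1) by (auto simp: bilex_list_def)
  have "k \<le> length A" using k(1) assms(2) by (metis not_less nth_append_length)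
  then have "(A @ q # B) ! k \<in> set (A @ [q])" by (cases "k = length A") (auto simp: nth_append)
  then show ?thesis using k(2) by auto
qed

lemma bilex_list_last:
  assumes "bilex_list (A @ q # B) M M'" "count M q \<noteq> count M' q"
  shows "\<exists>p. (p = q \<or> p \<in> set B) \<and> count M p < count M' p"
proof -
  let ?l = "A @ q # B"
  obtain s where s: "s < length ?l" "\<forall>t. s < t \<and> t < length ?l \<longrightarrow> count M (?l ! t) = count M' (?l ! t)"
    "count M (?l ! s) < count M' (?l ! s)"
    using assms(1) by (auto simp: bilex_list_def)
  have "length A \<le> s"
  proof (rule ccontr)
    assume "\<not> length A \<le> s"
    then have "count M (?l ! length A) = count M' (?l ! length A)" by (intro s(2)[rule_format]) simp
    then show False using assms(2) by (metis nth_append_length)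
  qed
  then have "?l ! s \<in> set (q # B)" using s(1) by (auto simp: nth_append nth_Cons')
  then show ?thesis using s(3) by auto
qed

lemma bilex_list_neq: "bilex_list l M M' \<Longrightarrow> \<exists>q\<in>set l. count M q < count M' q"
  unfolding bilex_list_def by (meson le_less_trans nth_mem)

abbreviation pt_le :: "nat \<times> nat \<Rightarrow> nat \<times> nat \<Rightarrow> bool" where
  "pt_le q q' \<equiv> fst q \<le> fst q' \<and> snd q \<le> snd q'"

section \<open>The slice of the strip and its convexity\<close>

locale strip =
  fixes n h :: nat and X :: "nat \<Rightarrow> nat"
  assumes n3: "3 \<le> n" and h: "h = n + 1"
    and Xn: "X n = 0" and Xstep: "\<And>i. 1 \<le> i \<Longrightarrow> i < n \<Longrightarrow> X i = X (i + 1) \<or> X i = X (i + 1) + 1"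
begin

text \<open>For each length \<open>i\<close> the left ends fill one full period of
  \<open>n + 1\<close> places beginning at \<open>X i\<close>.\<close>

definition R :: "(nat \<times> nat) set" where
  "R = {(x, y). x < y \<and> y \<le> x + n \<and> X (y - x) \<le> x \<and> x \<le> X (y - x) + n}"

lemma X_mono: "i \<le> j \<Longrightarrow> 1 \<le> i \<Longrightarrow> j \<le> n \<Longrightarrow> X j \<le> X i \<and> X i + i \<le> X j + j"
proof (induction j rule: dec_induct)
  case (step j)
  then show ?case using Xstep[of j] by auto
qed simp

lemma R_E:
  assumes "(x, y) \<in> R"
  obtains i where "y = x + i" "1 \<le> i" "i \<le> n" "X i \<le> x" "x \<le> X i + n"
  using assms that[of "y - x"] by (auto simp: R_def)

lemma R_I: "1 \<le> i \<Longrightarrow> i \<le> n \<Longrightarrow> X i \<le> x \<Longrightarrow> x \<le> X i + n \<Longrightarrow> (x, x + i) \<in> R"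
  by (simp add: R_def)

lemma R_len: "(x, y) \<in> R \<Longrightarrow> x < y \<and> y < x + h"
  by (auto simp: R_def h)

lemma R_bound: "(x, y) \<in> R \<Longrightarrow> y \<le> 2 * n"
proof (elim R_E)
  fix i assume "y = x + i" "1 \<le> i" "i \<le> n" "X i \<le> x" "x \<le> X i + n"
  then show ?thesis using X_mono[of i n] by (simp add: Xn)
qed

text \<open>By \<open>X_mono\<close>, the left ends stay within one period if the second interval is
  at least as long as the first, and the right ends do so otherwise.\<close>

lemma R_excl:
  assumes "(a, b) \<in> R" "(c, d) \<in> R"
  shows "\<not> (a + h \<le> c \<and> b + h \<le> d)"
proof -
  obtain i where i: "b = a + i" "1 \<le> i" "i \<le> n" "X i \<le> a" using assms(1) by (rule R_E)
  obtain j where j: "d = c + j" "1 \<le> j" "j \<le> n" "c \<le> X j + n" using assms(2) by (rule R_E)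
  show ?thesis
    using X_mono[of i j] X_mono[of j i] i j h by (cases "i \<le> j") auto
qed

lemma R_convex:
  assumes "(a, b) \<in> R" "(c, d) \<in> R" "x < y" "y < x + h" "a \<le> x" "x \<le> c" "b \<le> y" "y \<le> d"
  shows "(x, y) \<in> R"
proof -
  obtain i where i: "b = a + i" "1 \<le> i" "i \<le> n" "X i \<le> a" using assms(1) by (rule R_E)
  obtain j where j: "d = c + j" "1 \<le> j" "j \<le> n" "c \<le> X j + n" using assms(2) by (rule R_E)
  define k where "k = y - x"
  have k: "y = x + k" "1 \<le> k" "k \<le> n" using assms h by (auto simp: k_def)
  have "X k \<le> x" using X_mono[of i k] X_mono[of k i] i k assms by (cases "i \<le> k") auto
  moreover have "x \<le> X k + n" using X_mono[of j k] X_mono[of k j] j k assms by (cases "j \<le> k") auto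
  ultimately show ?thesis using k R_I by simp
qed

end

section \<open>The order on sequences of points\<close>

locale strip_class = strip +
  fixes S :: "(nat \<times> nat) list set"
  assumes S_ne: "S \<noteq> {}"
    and S: "l \<in> S \<Longrightarrow> distinct l \<and> set l = R \<and> sorted_wrt (\<lambda>q q'. \<not> pt_le q' q) l"
    and S_swap: "A @ q # q' # B \<in> S \<Longrightarrow> \<not> pt_le q q' \<Longrightarrow> A @ q' # q # B \<in> S"
    and pos: "\<exists>\<chi>::nat \<Rightarrow> int. (\<forall>x. \<chi> (x + h) = - \<chi> x) \<and> (\<forall>(x, y)\<in>R. \<chi> y < \<chi> x)"
begin

definition below :: "(nat \<times> nat) multiset \<Rightarrow> (nat \<times> nat) multiset \<Rightarrow> bool" where
  "below M M' \<longleftrightarrow> same_weight h M M' \<and> (\<forall>l\<in>S. bilex_list l M M')"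

text \<open>In every list of \<open>S\<close> the point \<open>(a, b)\<close> precedes and
  \<open>(c, d)\<close> follows all other points of the rectangle, so the first and the last
  difference are increases.\<close>

lemma below_intro:
  assumes ab: "(a, b) \<in> R" "(c, d) \<in> R" "a \<le> c" "b \<le> d" "(a, b) \<noteq> (c, d)"
    and M: "\<And>x y. (x, y) \<in># M \<Longrightarrow> (x, y) \<in> R \<and> a \<le> x \<and> x \<le> c \<and> b \<le> y \<and> y \<le> d \<and>
              (x, y) \<noteq> (a, b) \<and> (x, y) \<noteq> (c, d)"
    and "same_weight h M {#(a, b), (c, d)#}"
  shows "below M {#(a, b), (c, d)#}"
  unfolding below_def
proof (intro conjI ballI)
  fix l assume "l \<in> S"
  then have l: "distinct l" "set l = R" "sorted_wrt (\<lambda>q q'. \<not> pt_le q' q) l" using S by auto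
  obtain k s where k: "k < length l" "l ! k = (a, b)" and s: "s < length l" "l ! s = (c, d)"
    using ab l by (metis in_set_conv_nth)
  have srt: "\<not> pt_le (l ! j) (l ! i)" if "i < j" "j < length l" for i j
    using that l(3) by (auto simp: sorted_wrt_iff_nth_less)
  have "k < s" using srt[of s k] ab k s by (metis fst_conv snd_conv linorder_neqE_nat)
  have z: "count M q = 0 \<and> count {#(a, b), (c, d)#} q = 0"
    if "\<not> (pt_le (a, b) q \<and> pt_le q (c, d))" for q
    using that M[of "fst q" "snd q"] ab by (auto simp: count_eq_zero_iff)
  have "count M (a, b) = 0" "count M (c, d) = 0" using M by (auto simp: count_eq_zero_iff)
  moreover have "count M (l ! t) = count {#(a, b), (c, d)#} (l ! t)" if "t < k" for t
    using z[of "l ! t"] srt[of t k] that k by auto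
  moreover have "count M (l ! t) = count {#(a, b), (c, d)#} (l ! t)" if "s < t" "t < length l" for t
    using z[of "l ! t"] srt[of s t] that s by auto
  ultimately show "bilex_list l M {#(a, b), (c, d)#}"
    unfolding bilex_list_def using k s \<open>k < s\<close> by (intro exI[of _ k] exI[of _ s]) auto
qed (use assms in simp)

text \<open>Choose a list in which only points below \<open>q\<close> precede it. The first
  difference of the two sequences in that list is an increase and occurs no later than
  \<open>q\<close>.\<close>

lemma below_first:
  assumes "below M M'" "q \<in> R" "count M q \<noteq> count M' q"
  shows "\<exists>p\<in>R. pt_le p q \<and> count M p < count M' p"
proof -
  obtain l where "l \<in> S" using S_ne by blast
  then obtain A B where "A @ q # B \<in> S" using S assms(2) by (metis split_list)
  then obtain A B where AB: "A @ q # B \<in> S" "\<forall>z\<in>set A. pt_le z q"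
  proof -
    have "\<exists>A B. A @ q # B \<in> S \<and> (\<forall>z\<in>set A. pt_le z q)"
      by (rule bubble_before[where le = pt_le, OF S_swap _ \<open>A @ q # B \<in> S\<close>]) auto
    then show thesis using that by blast
  qed
  then show ?thesis using bilex_list_first[of A q B M M'] assms S[OF AB(1)] by (fastforce simp: below_def)
qed

lemma below_last:
  assumes "below M M'" "q \<in> R" "count M q \<noteq> count M' q"
  shows "\<exists>p\<in>R. pt_le q p \<and> count M p < count M' p"
proof -
  obtain l where "l \<in> S" using S_ne by blast
  then obtain A B where "A @ q # B \<in> S" using S assms(2) by (metis split_list)
  then obtain A B where AB: "A @ q # B \<in> S" "\<forall>z\<in>set B. pt_le q z"
  proof -
    have "\<exists>A B. A @ q # B \<in> S \<and> (\<forall>z\<in>set B. pt_le q z)"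
      by (rule bubble_after[where le = pt_le, OF S_swap _ \<open>A @ q # B \<in> S\<close>]) auto
    then show thesis using that by blast
  qed
  then show ?thesis using bilex_list_last[of A q B M M'] assms S[OF AB(1)] by (fastforce simp: below_def)
qed

text \<open>The functional in \<open>pos\<close> is positive on every nonempty sequence of points,
  so none of them has the weight of the empty one.\<close>

lemma below_nonempty: "below M M' \<Longrightarrow> set_mset M' \<subseteq> R \<Longrightarrow> M \<noteq> {#}"
proof
  assume a: "below M M'" "set_mset M' \<subseteq> R" "M = {#}"
  obtain \<chi> :: "nat \<Rightarrow> int" where x: "\<forall>x. \<chi> (x + h) = - \<chi> x" "\<forall>(x, y)\<in>R. \<chi> y < \<chi> x" using pos by blast
  have "(\<Sum>q\<in>#M'. \<chi> (fst q) - \<chi> (snd q)) = 0" using a x(1) by (auto simp: below_def same_weight_def)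
  moreover have "M' \<noteq> {#} \<Longrightarrow> (\<Sum>q\<in>#M'. \<chi> (fst q) - \<chi> (snd q)) > 0" using a(2)
  proof (induction M')
    case (add q M')
    then show ?case using x(2) by (cases "M' = {#}") (auto simp: case_prod_unfold)
  qed simp
  ultimately have "M' = {#}" by fastforce
  moreover obtain l where "l \<in> S" using S_ne by blast
  ultimately show False using a bilex_list_neq[of l M M'] by (auto simp: below_def)
qed

text \<open>A converse of \<open>below_intro\<close>. Every difference has a point below it and a
  point above it where \<open>M\<close> is smaller, and such points can only be \<alpha> and
  \<beta>; so any other member of \<open>M\<close> lies between the two.\<close>

lemma below_pair:
  assumes "below M {#\<alpha>, \<beta>#}" "\<alpha> \<in> R" "\<beta> \<in> R" "\<alpha> \<noteq> \<beta>" "set_mset M \<subseteq> R"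
  shows "pt_le \<alpha> \<beta> \<or> pt_le \<beta> \<alpha>"
    and "pt_le \<alpha> \<beta> \<Longrightarrow> q \<in># M \<Longrightarrow> pt_le \<alpha> q \<and> pt_le q \<beta> \<and> q \<noteq> \<alpha> \<and> q \<noteq> \<beta>"
proof -
  let ?p = "{#\<alpha>, \<beta>#}"
  have lt: "q = \<alpha> \<and> count M \<alpha> = 0 \<or> q = \<beta> \<and> count M \<beta> = 0" if "count M q < count ?p q" for q
    using that assms(4) by (auto split: if_splits)
  have first_last: "(\<exists>p\<in>{\<alpha>, \<beta>}. pt_le p q \<and> count M p = 0) \<and> (\<exists>p\<in>{\<alpha>, \<beta>}. pt_le q p \<and> count M p = 0)"
    if "q \<in> R" "count M q \<noteq> count ?p q" for q
    using below_first[OF assms(1) that] below_last[OF assms(1) that] lt by blast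
  have anti: "p = q" if "pt_le p q" "pt_le q p" for p q :: "nat \<times> nat"
    using that by (simp add: prod_eq_iff)
  \<comment> \<open>Otherwise \<open>M\<close> would be one of the two points with multiplicity 1,
    and the other root would have weight 0, against positivity.\<close>
  have "\<exists>q. q \<in># M \<and> q \<noteq> \<alpha> \<and> q \<noteq> \<beta>"
  proof (rule ccontr)
    assume neg: "\<nexists>q. q \<in># M \<and> q \<noteq> \<alpha> \<and> q \<noteq> \<beta>"
    obtain l where "l \<in> S" using S_ne by blast
    then have "\<exists>q. count M q < count ?p q" using assms(1) bilex_list_neq unfolding below_def by blast
    then have "\<exists>z w. ?p = {#z, w#} \<and> z \<noteq> w \<and> count M z = 0"
      using lt assms(4) by (metis add_mset_commute)
    then obtain z w where zw: "?p = {#z, w#}" "z \<noteq> w" "count M z = 0" by blast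
    have zw': "{\<alpha>, \<beta>} = {z, w}" using arg_cong[OF zw(1), of set_mset] by simp
    have w: "set_mset M \<subseteq> {w}" using neg zw' zw(3) by (metis count_eq_zero_iff insert_iff singletonD subsetI)
    have "M \<noteq> {#}" using below_nonempty[OF assms(1)] assms(2,3) by simp
    then have "w \<in># M" using w by (metis set_mset_eq_empty_iff subset_singletonD insertI1)
    have zR: "z \<in> R" "w \<in> R" using zw' assms(2,3) by auto
    have "count M w = 1"
    proof (rule ccontr)
      assume "count M w \<noteq> 1"
      then have "count M w \<noteq> count ?p w" using zw by simp
      from first_last[OF zR(2) this] have "pt_le z w \<and> pt_le w z"
        using \<open>w \<in># M\<close> zw' by (metis insertE singletonD not_in_iff)
      then show False using anti zw(2) by blast
    qed
    then have "M = {#w#}" using w zw(3) by (intro multiset_eqI) (auto simp: count_eq_zero_iff)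
    moreover obtain \<chi> :: "nat \<Rightarrow> int" where \<chi>: "\<forall>x. \<chi> (x + h) = - \<chi> x" "\<forall>(x, y)\<in>R. \<chi> y < \<chi> x"
      using pos by blast
    ultimately have "\<chi> (fst z) - \<chi> (snd z) = 0"
      using assms(1) unfolding below_def same_weight_def zw(1) by fastforce
    then show False using \<chi>(2) zR(1) by (auto simp: case_prod_unfold)
  qed
  then obtain q where q: "q \<in># M" "q \<noteq> \<alpha>" "q \<noteq> \<beta>" by blast
  have bet: "count M \<alpha> = 0 \<and> count M \<beta> = 0 \<and> (pt_le \<alpha> q \<and> pt_le q \<beta> \<or> pt_le \<beta> q \<and> pt_le q \<alpha>)"
    if q: "q \<in># M" "q \<noteq> \<alpha>" "q \<noteq> \<beta>" for q
  proof -
    have "q \<in> R" "count M q \<noteq> count ?p q" using q assms(5) by auto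
    from first_last[OF this] obtain p p' where p: "p \<in> {\<alpha>, \<beta>}" "pt_le p q" "count M p = 0"
      "p' \<in> {\<alpha>, \<beta>}" "pt_le q p'" "count M p' = 0" by blast
    have "p \<noteq> p'" using anti[of p q] p q by blast
    then show ?thesis using p by blast
  qed
  then have nin: "\<alpha> \<notin># M" "\<beta> \<notin># M" using q by (auto simp: not_in_iff)
  show "pt_le \<alpha> \<beta> \<or> pt_le \<beta> \<alpha>" using bet[OF q] order_trans by blast
  show "pt_le \<alpha> q \<and> pt_le q \<beta> \<and> q \<noteq> \<alpha> \<and> q \<noteq> \<beta>" if "pt_le \<alpha> \<beta>" "q \<in># M" for q
  proof -
    have q: "q \<noteq> \<alpha>" "q \<noteq> \<beta>" using nin that by auto
    have "\<not> (pt_le \<beta> q \<and> pt_le q \<alpha>)" using anti[of \<alpha> \<beta>] that(1) assms(4) order_trans by blast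
    then show ?thesis using bet[OF that(2) q] q by blast
  qed
qed

definition simple_pts :: "(nat \<times> nat) multiset \<Rightarrow> bool" where
  "simple_pts M \<longleftrightarrow> size M = 1 \<or>
     (\<forall>\<alpha>\<in>#M. \<forall>\<beta>\<in>#M. \<alpha> \<noteq> \<beta> \<longrightarrow> \<not> (\<exists>N. set_mset N \<subseteq> R \<and> below N {#\<alpha>, \<beta>#}))"

lemma simple_pts_pair: "\<alpha> \<noteq> \<beta> \<Longrightarrow> simple_pts {#\<alpha>, \<beta>#} \<longleftrightarrow> \<not> (\<exists>N. set_mset N \<subseteq> R \<and> below N {#\<alpha>, \<beta>#})"
  by (auto simp: simple_pts_def add_mset_commute)

text \<open>Strictly nested intervals are incomparable points, so nothing lies below them; if the
  inner one is empty, a single root is left.\<close>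

lemma simple_pts_nested:
  assumes "a < c" "b < d" "(a, d) \<in> R" "c < b \<Longrightarrow> (c, b) \<in> R"
  shows "simple_pts ({#(a, d)#} + segment c b)"
proof (cases "c < b")
  case True
  have "simple_pts {#(a, d), (c, b)#}"
    using below_pair(1)[of _ "(a, d)" "(c, b)"] assms True by (subst simple_pts_pair) auto
  then show ?thesis using True by (simp add: segment_def add_mset_commute)
qed (simp add: segment_def simple_pts_def)

section \<open>The exchanges below a comparable pair, and its socle\<close>

context
  fixes a b c d
  assumes ab: "(a, b) \<in> R" and cd: "(c, d) \<in> R" and le: "a \<le> c" "b \<le> d" and ne: "(a, b) \<noteq> (c, d)"
begin

lemma len: "a < b" "b < a + h" "c < d" "d < c + h" "d < a + 2 * h" "\<not> (a + h \<le> c \<and> b + h \<le> d)"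
  using R_len[OF ab] R_len[OF cd] R_excl[OF ab cd] R_bound[OF cd] h by auto

lemma between: "x < y \<Longrightarrow> y < x + h \<Longrightarrow> a \<le> x \<Longrightarrow> x \<le> c \<Longrightarrow> b \<le> y \<Longrightarrow> y \<le> d \<Longrightarrow> (x, y) \<in> R"
  using R_convex[OF ab cd] by blast

lemma below_cases:
  assumes "below M {#(a, b), (c, d)#}" "set_mset M \<subseteq> R"
  shows "(d < a + h \<and> a < c \<and> b < d \<and> c \<le> b \<and> M = {#(a, d)#} + segment c b) \<or>
   (d > a + h \<and> c \<le> b \<and> M = {#(d - h, a + h)#} + segment c b) \<or>
   (d > a + h \<and> d - h \<le> b \<and> c \<le> a + h \<and> M = segment (d - h) b + segment c (a + h))"
proof (rule uncross)
  fix x y assume xy: "(x, y) \<in># M"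
  then show "x < y \<and> y < x + h \<and> a \<le> x \<and> x \<le> c \<and> b \<le> y \<and> y \<le> d \<and> (x, y) \<noteq> (a, b) \<and> (x, y) \<noteq> (c, d)"
    using below_pair(2)[OF assms(1) ab cd ne assms(2) _ xy] le R_len[of x y] assms(2) by auto
qed (use len le assms in \<open>auto simp: below_def\<close>)

lemma below_short:
  assumes "d < a + h" "a < c" "b < d" "c \<le> b"
  shows "set_mset ({#(a, d)#} + segment c b) \<subseteq> R" "below ({#(a, d)#} + segment c b) {#(a, b), (c, d)#}"
    "simple_pts ({#(a, d)#} + segment c b)"
proof -
  have R: "(a, d) \<in> R" "c < b \<Longrightarrow> (c, b) \<in> R" using between len assms by auto
  then show "set_mset ({#(a, d)#} + segment c b) \<subseteq> R" by (simp add: segment_def)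
  show "simple_pts ({#(a, d)#} + segment c b)" using assms R by (intro simple_pts_nested) auto
  show "below ({#(a, d)#} + segment c b) {#(a, b), (c, d)#}"
    by (rule below_intro[OF ab cd le ne])
      (use R assms in \<open>auto simp: segment_def same_weight_def split: if_splits\<close>)
qed

lemma below_long:
  assumes "d > a + h" "c \<le> b"
  shows "set_mset ({#(d - h, a + h)#} + segment c b) \<subseteq> R" "below ({#(d - h, a + h)#} + segment c b) {#(a, b), (c, d)#}"
    "simple_pts ({#(d - h, a + h)#} + segment c b)"
proof -
  define e where "e = d - h"
  have e: "d = e + h" "a < e" "e < c" using assms len by (auto simp: e_def)
  have R: "(e, a + h) \<in> R" "c < b \<Longrightarrow> (c, b) \<in> R" using between e len assms by auto
  then show "set_mset ({#(d - h, a + h)#} + segment c b) \<subseteq> R" by (simp add: segment_def e_def)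
  show "simple_pts ({#(d - h, a + h)#} + segment c b)"
    using assms R len e(2,3) unfolding e_def by (intro simple_pts_nested) auto
  show "below ({#(d - h, a + h)#} + segment c b) {#(a, b), (c, d)#}"
  proof (rule below_intro[OF ab cd le ne])
    show "same_weight h ({#(d - h, a + h)#} + segment c b) {#(a, b), (c, d)#}"
      unfolding same_weight_def
    proof (intro allI impI)
      fix \<chi> :: "nat \<Rightarrow> int" assume "\<forall>x. \<chi> (x + h) = - \<chi> x"
      then have "\<chi> (a + h) = - \<chi> a" "\<chi> d = - \<chi> e" by (simp_all add: e)
      then show "(\<Sum>q\<in>#{#(d - h, a + h)#} + segment c b. \<chi> (fst q) - \<chi> (snd q)) =
          (\<Sum>q\<in>#{#(a, b), (c, d)#}. \<chi> (fst q) - \<chi> (snd q))"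
        using assms by (simp add: segment_def e_def[symmetric])
    qed
  next
    fix x y assume "(x, y) \<in># {#(d - h, a + h)#} + segment c b"
    then have "(x, y) = (e, a + h) \<and> (x, y) \<in> R \<or> (x, y) = (c, b) \<and> (x, y) \<in> R"
      using R by (auto simp: segment_def e_def[symmetric] split: if_splits)
    then show "(x, y) \<in> R \<and> a \<le> x \<and> x \<le> c \<and> b \<le> y \<and> y \<le> d \<and> (x, y) \<noteq> (a, b) \<and> (x, y) \<noteq> (c, d)"
      using assms e len by auto
  qed
qed

lemma below_middle:
  assumes "d > a + h" "d - h \<le> b" "c \<le> a + h"
  shows "set_mset (segment (d - h) b + segment c (a + h)) \<subseteq> R" "below (segment (d - h) b + segment c (a + h)) {#(a, b), (c, d)#}"
proof -
  define e where "e = d - h"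
  have e: "d = e + h" "a < e" "e < c" using assms len by (auto simp: e_def)
  have R: "e < b \<Longrightarrow> (e, b) \<in> R" "c < a + h \<Longrightarrow> (c, a + h) \<in> R" using between e len assms by auto
  then show "set_mset (segment (d - h) b + segment c (a + h)) \<subseteq> R" by (simp add: segment_def e_def)
  show "below (segment (d - h) b + segment c (a + h)) {#(a, b), (c, d)#}"
  proof (rule below_intro[OF ab cd le ne])
    show "same_weight h (segment (d - h) b + segment c (a + h)) {#(a, b), (c, d)#}"
      unfolding same_weight_def
    proof (intro allI impI)
      fix \<chi> :: "nat \<Rightarrow> int" assume "\<forall>x. \<chi> (x + h) = - \<chi> x"
      then have "\<chi> (a + h) = - \<chi> a" "\<chi> d = - \<chi> e" by (simp_all add: e)
      then show "(\<Sum>q\<in>#segment (d - h) b + segment c (a + h). \<chi> (fst q) - \<chi> (snd q)) =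
          (\<Sum>q\<in>#{#(a, b), (c, d)#}. \<chi> (fst q) - \<chi> (snd q))"
        using assms by (simp add: segment_def e_def[symmetric])
    qed
  next
    fix x y assume "(x, y) \<in># segment (d - h) b + segment c (a + h)"
    then have "(x, y) = (e, b) \<and> (x, y) \<in> R \<or> (x, y) = (c, a + h) \<and> (x, y) \<in> R"
      using R by (auto simp: segment_def e_def[symmetric] split: if_splits)
    then show "(x, y) \<in> R \<and> a \<le> x \<and> x \<le> c \<and> b \<le> y \<and> y \<le> d \<and> (x, y) \<noteq> (a, b) \<and> (x, y) \<noteq> (c, d)"
      using assms e len by auto
  qed
qed

end

context
  fixes a b c d
  assumes ab: "(a, b) \<in> R" and cd: "(c, d) \<in> R" and le: "a \<le> c" "b \<le> d" and ne: "(a, b) \<noteq> (c, d)"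
begin

lemmas len' = len[OF ab cd le ne]

text \<open>For \<open>b < c\<close> the exchanged intervals are disjoint, and
  \<open>a + h < d\<close> puts their ends within one period, so none of the shapes in
  \<open>below_cases\<close> fits this pair.\<close>

lemma middle_simple:
  assumes "d > a + h" "d - h \<le> b" "c \<le> a + h" "b < c"
  shows "simple_pts (segment (d - h) b + segment c (a + h))"
proof (cases "d - h < b \<and> c < a + h")
  case True
  have R: "(d - h, b) \<in> R" "(c, a + h) \<in> R"
    using below_middle(1)[OF ab cd le ne assms(1-3)] True by (simp_all add: segment_def)
  have "simple_pts {#(d - h, b), (c, a + h)#}"
    using below_cases[OF R] R assms len' by (subst simple_pts_pair) auto
  then show ?thesis using True by (simp add: segment_def add_mset_commute)
next
  case False
  \<comment> \<open>Both intervals would vanish only if the two given points differed by a period in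
    both coordinates, which \<open>R_excl\<close> forbids.\<close>
  have "\<not> (d - h = b \<and> c = a + h)" using len' assms by auto
  then show ?thesis using False assms by (auto simp: segment_def simple_pts_def)
qed

text \<open>For \<open>c \<le> b\<close> the exchanged intervals still cross or touch and form a
  comparable pair whose ends lie within one period. One unwrapped exchange then leads to the nested
  sequence, which is simple. This is the source of chains of length 2.\<close>

lemma middle_crossing:
  assumes "d > a + h" "c \<le> b"
  shows "segment (d - h) b + segment c (a + h) = {#(d - h, b), (c, a + h)#}"
    and "(d - h, b) \<in> R" "(c, a + h) \<in> R"
    and "\<not> simple_pts {#(d - h, b), (c, a + h)#}"
    and "below N {#(d - h, b), (c, a + h)#} \<Longrightarrow> set_mset N \<subseteq> R \<Longrightarrow> simple_pts N"
    and "below {#(d - h, b), (c, a + h)#} {#(a, b), (c, d)#}"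
proof -
  have e: "d - h < c" using len' assms by auto
  show eq: "segment (d - h) b + segment c (a + h) = {#(d - h, b), (c, a + h)#}"
    using e assms len' by (auto simp: segment_def)
  have "d - h \<le> b" "c \<le> a + h" using e assms len' by auto
  note m = below_middle[OF ab cd le ne assms(1) this, unfolded eq]
  show R: "(d - h, b) \<in> R" "(c, a + h) \<in> R" using m(1) by auto
  show "below {#(d - h, b), (c, a + h)#} {#(a, b), (c, d)#}" by (rule m(2))
  have l: "d - h \<le> c" "b \<le> a + h" "(d - h, b) \<noteq> (c, a + h)" "a + h < d - h + h" "d - h < c" "b < a + h"
    using e len' assms by auto
  note sh = below_short[OF R l(1-3) l(4-6) assms(2)]
  show "\<not> simple_pts {#(d - h, b), (c, a + h)#}" using sh l(3) by (subst simple_pts_pair) blast+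
  show "simple_pts N" if "below N {#(d - h, b), (c, a + h)#}" "set_mset N \<subseteq> R"
  proof -
    have "N = {#(d - h, a + h)#} + segment c b" using below_cases[OF R l(1-3) that] l(4) less_asym by blast
    then show ?thesis using sh(3) by simp
  qed
qed

lemma not_simple_below:
  assumes "below M {#(a, b), (c, d)#}" "set_mset M \<subseteq> R" "\<not> simple_pts M"
  shows "d > a + h \<and> c \<le> b \<and> M = {#(d - h, b), (c, a + h)#}"
  using below_cases[OF ab cd le ne assms(1,2)]
proof (elim disjE conjE)
  assume "d < a + h" "a < c" "b < d" "c \<le> b" "M = {#(a, d)#} + segment c b"
  then show ?thesis using below_short(3)[OF ab cd le ne] assms(3) by blast
next
  assume "d > a + h" "c \<le> b" "M = {#(d - h, a + h)#} + segment c b"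
  then show ?thesis using below_long(3)[OF ab cd le ne] assms(3) by blast
next
  assume m: "d > a + h" "d - h \<le> b" "c \<le> a + h" "M = segment (d - h) b + segment c (a + h)"
  have "c \<le> b"
  proof (rule ccontr)
    assume "\<not> c \<le> b"
    then have "simple_pts M" unfolding m(4) by (intro middle_simple[OF m(1-3)]) simp
    then show False using assms(3) by blast
  qed
  have "M = {#(d - h, b), (c, a + h)#}"
    unfolding m(4) by (rule middle_crossing(1)[OF m(1) \<open>c \<le> b\<close>])
  then show ?thesis using m(1) \<open>c \<le> b\<close> by blast
qed

text \<open>Bounds by two the chains of non-simple sequences that end in a pair.\<close>

lemma simple_below_below:
  assumes "below M {#(a, b), (c, d)#}" "set_mset M \<subseteq> R" "\<not> simple_pts M" "below N M" "set_mset N \<subseteq> R"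
  shows "simple_pts N"
proof -
  have M: "d > a + h" "c \<le> b" "M = {#(d - h, b), (c, a + h)#}" using not_simple_below[OF assms(1-3)] by auto
  show ?thesis by (rule middle_crossing(5)[OF M(1,2) assms(4)[unfolded M(3)] assms(5)])
qed

text \<open>If both exchanges exist, the crossing one is not simple; in all other cases at most one
  is available. So the ends \<open>a\<close>, \<open>b\<close>, \<open>c\<close>, \<open>d\<close>
  determine the simple candidate.\<close>

lemma ex1_socle_le: "\<exists>!M. set_mset M \<subseteq> R \<and> simple_pts M \<and> (M = {#(a, b), (c, d)#} \<or> below M {#(a, b), (c, d)#})"
proof (cases "simple_pts {#(a, b), (c, d)#}")
  case True
  then show ?thesis using ab cd ne simple_pts_pair by (intro ex1I[of _ "{#(a, b), (c, d)#}"]) auto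
next
  case False
  then obtain M where M: "set_mset M \<subseteq> R" "below M {#(a, b), (c, d)#}" using ne simple_pts_pair by blast
  have "\<exists>M. set_mset M \<subseteq> R \<and> simple_pts M \<and> below M {#(a, b), (c, d)#}"
    using not_simple_below[OF M(2,1)] below_long[OF ab cd le ne] M by blast
  moreover have "M = N" if M: "set_mset M \<subseteq> R \<and> simple_pts M \<and> below M {#(a, b), (c, d)#}"
    and N: "set_mset N \<subseteq> R \<and> simple_pts N \<and> below N {#(a, b), (c, d)#}" for M N
  proof -
    have *: "\<not> simple_pts (segment (d - h) b + segment c (a + h))" if "d > a + h" "c \<le> b"
      using middle_crossing(1,4)[OF that] by simp
    have "K = (if d < a + h then {#(a, d)#} + segment c b else if c \<le> b then {#(d - h, a + h)#} + segment c b
        else segment (d - h) b + segment c (a + h))"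
      if "set_mset K \<subseteq> R \<and> simple_pts K \<and> below K {#(a, b), (c, d)#}" for K
    proof -
      have K: "below K {#(a, b), (c, d)#}" "set_mset K \<subseteq> R" "simple_pts K" using that by auto
      show ?thesis using below_cases[OF ab cd le ne K(1,2)] * K(3) by (elim disjE) auto
    qed
    from this[OF M] this[OF N] show ?thesis by simp
  qed
  ultimately have "\<exists>!M. set_mset M \<subseteq> R \<and> simple_pts M \<and> below M {#(a, b), (c, d)#}" by blast
  moreover have "(set_mset M \<subseteq> R \<and> simple_pts M \<and> (M = {#(a, b), (c, d)#} \<or> below M {#(a, b), (c, d)#})) =
      (set_mset M \<subseteq> R \<and> simple_pts M \<and> below M {#(a, b), (c, d)#})" for M using False by blast
  ultimately show ?thesis by simp
qed

end

lemma ex1_socle: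
  assumes "\<alpha> \<in> R" "\<beta> \<in> R" "\<alpha> \<noteq> \<beta>"
  shows "\<exists>!M. set_mset M \<subseteq> R \<and> simple_pts M \<and> (M = {#\<alpha>, \<beta>#} \<or> below M {#\<alpha>, \<beta>#})"
proof -
  consider "pt_le \<alpha> \<beta>" | "pt_le \<beta> \<alpha>" | "\<not> (pt_le \<alpha> \<beta> \<or> pt_le \<beta> \<alpha>)" by blast
  then show ?thesis
  proof cases
    case 1
    then show ?thesis using ex1_socle_le[of "fst \<alpha>" "snd \<alpha>" "fst \<beta>" "snd \<beta>"] assms by simp
  next
    case 2
    then show ?thesis using ex1_socle_le[of "fst \<beta>" "snd \<beta>" "fst \<alpha>" "snd \<alpha>"] assms
      by (simp add: add_mset_commute)
  next
    case 3
    then have "\<not> (set_mset M \<subseteq> R \<and> below M {#\<alpha>, \<beta>#})" for M using below_pair(1) assms by blast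
    then show ?thesis using assms simple_pts_pair by (intro ex1I[of _ "{#\<alpha>, \<beta>#}"]) auto
  qed
qed

end

section \<open>Orthonormal coordinates for roots and words\<close>

text \<open>The reflection in eps_i - eps_(i+1) on coordinate vectors.\<close>

definition swap_coords :: "nat \<Rightarrow> (nat \<Rightarrow> int) \<Rightarrow> (nat \<Rightarrow> int)" where
  "swap_coords i w = (\<lambda>k. w (if k = i then i + 1 else if k = i + 1 then i else k))"

text \<open>A label $l = \pm k$ stands for $\pm\varepsilon_k$, and \<open>ev a b\<close> for $\varepsilon_a - \varepsilon_b$.\<close>
definition ev :: "int \<Rightarrow> int \<Rightarrow> nat \<Rightarrow> int" where
  "ev a b = (\<lambda>k. of_bool (int k = a) - of_bool (int k = - a) - of_bool (int k = b) + of_bool (int k = - b))"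

definition swap_labels :: "nat \<Rightarrow> int \<Rightarrow> int" where
  "swap_labels i l = (if l = int i then int i + 1 else if l = int i + 1 then int i
     else if l = - int i then - int i - 1 else if l = - int i - 1 then - int i else l)"

lemma swap_coords_ev: "1 \<le> i \<Longrightarrow> swap_coords i (ev a b) = ev (swap_labels i a) (swap_labels i b)"
  by (rule ext) (auto simp: swap_coords_def ev_def swap_labels_def)

lemma swap_labels_neg: "0 < i \<Longrightarrow> swap_labels i (- l) = - swap_labels i l"
  by (auto simp: swap_labels_def)

lemma ev_neg: "ev (- a) (- b) = ev b a"
  by (rule ext) (auto simp: ev_def)

lemma ev_uminus: "ev b a k = - ev a b k"
  by (auto simp: ev_def)

definition lact :: "nat list \<Rightarrow> int \<Rightarrow> int" where
  "lact u = foldr swap_labels u"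

lemma lact_simps [simp]: "lact [] l = l" "lact (i # u) l = swap_labels i (lact u l)" "lact (u @ w) l = lact u (lact w l)"
  by (simp_all add: lact_def)

lemma lact_neg: "0 \<notin> set u \<Longrightarrow> lact u (- l) = - lact u l"
  by (induction u) (simp_all add: swap_labels_neg)

lemma foldr_swap_coords_ev: "0 \<notin> set u \<Longrightarrow> foldr swap_coords u (ev a b) = ev (lact u a) (lact u b)"
  by (induction u) (auto simp: swap_coords_ev)

text \<open>Only the letters \<open>l - 1\<close> and \<open>l\<close> move the label
  \<open>l\<close>.\<close>

lemma lact_fix: "0 < l \<Longrightarrow> nat l \<notin> set u \<Longrightarrow> nat l - 1 \<notin> set u \<Longrightarrow> 0 \<notin> set u \<Longrightarrow> lact u l = l"
  by (induction u) (auto simp: swap_labels_def)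

definition root_list :: "nat \<Rightarrow> nat list \<Rightarrow> (nat \<Rightarrow> int) list" where
  "root_list n u = map (word_root n u) [0..<length u]"

lemma word_elt_append: "word_elt n (u @ w) c = word_elt n u (word_elt n w c)"
  by (simp add: word_elt_def)

lemma word_elt_simps [simp]: "word_elt n [] c = c" "word_elt n (i # u) c = simple_refl n i (word_elt n u c)"
  by (simp_all add: word_elt_def)

lemma rlist_append: "root_list n (u @ w) = root_list n u @ map (word_elt n u) (root_list n w)"
proof (rule nth_equalityI)
  fix k assume "k < length (root_list n (u @ w))"
  then show "root_list n (u @ w) ! k = (root_list n u @ map (word_elt n u) (root_list n w)) ! k"
    by (cases "k < length u") (auto simp: root_list_def nth_append word_root_def word_elt_append)
qed (simp add: root_list_def)

lemma rlist_Nil [simp]: "root_list n [] = []" by (simp add: root_list_def)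

lemma rlist_Cons: "root_list n (i # u) = simple_root i # map (simple_refl n i) (root_list n u)"
proof -
  have "root_list n [i] = [simple_root i]" by (simp add: root_list_def word_root_def)
  then show ?thesis using rlist_append[of n "[i]" u] by (simp add: fun_eq_iff cong: map_cong)
qed

lemma length_rlist [simp]: "length (root_list n u) = length u" by (simp add: root_list_def)

definition root_lattice :: "nat \<Rightarrow> (nat \<Rightarrow> int) set" where
  "root_lattice n = {c. \<forall>i. i \<notin> idx n \<longrightarrow> c i = 0}"

lemma simple_root_V: "j \<in> idx n \<Longrightarrow> simple_root j \<in> root_lattice n"
  by (auto simp: root_lattice_def simple_root_def)

lemma simple_refl_V: "j \<in> idx n \<Longrightarrow> c \<in> root_lattice n \<Longrightarrow> simple_refl n j c \<in> root_lattice n"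
  by (auto simp: root_lattice_def simple_refl_def simple_root_def)

lemma word_elt_V: "set u \<subseteq> idx n \<Longrightarrow> c \<in> root_lattice n \<Longrightarrow> word_elt n u c \<in> root_lattice n"
  by (induction u) (auto simp: simple_refl_V)

lemma rlist_V: "set u \<subseteq> idx n \<Longrightarrow> set (root_list n u) \<subseteq> root_lattice n"
  by (induction u) (auto simp: rlist_Cons simple_refl_V simple_root_V)

section \<open>Reflections and the diagram automorphism in coordinates\<close>

text \<open>
  The sign \<open>\<kappa>\<close> of the last coordinate is chosen so that whichever of the letters $n$, $n+1$ occurs
  in the word becomes the transposition of the last two coordinates.
\<close>
definition eps_coords :: "nat \<Rightarrow> int \<Rightarrow> (nat \<Rightarrow> int) \<Rightarrow> (nat \<Rightarrow> int)" where
  "eps_coords n \<kappa> c = (\<lambda>k. if k = 0 then 0 else if k \<le> n - 1 then c k - c (k - 1)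
     else if k = n then c n + c (n + 1) - c (n - 1) else if k = n + 1 then \<kappa> * (c (n + 1) - c n) else 0)"

definition neg_last :: "nat \<Rightarrow> (nat \<Rightarrow> int) \<Rightarrow> (nat \<Rightarrow> int)" where
  "neg_last n w = (\<lambda>k. if k = n + 1 then - w k else w k)"

definition neg_last_label :: "nat \<Rightarrow> int \<Rightarrow> int" where
  "neg_last_label n l = (if \<bar>l\<bar> = int n + 1 then - l else l)"

lemma neg_last_ev: "neg_last n (ev a b) = ev (neg_last_label n a) (neg_last_label n b)"
  by (rule ext) (auto simp: neg_last_def ev_def neg_last_label_def)

lemma neg_last_neg_last [simp]: "neg_last n (neg_last n w) = w"
  by (rule ext) (simp add: neg_last_def)

definition orbit_rep :: "nat \<Rightarrow> nat \<Rightarrow> nat" where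
  "orbit_rep n j = (if j = n + 1 then n else j)"

lemma eps_simple_root:
  assumes n: "3 \<le> n" and j: "j \<in> idx n" "j = n \<longrightarrow> \<kappa> = 1" "j = n + 1 \<longrightarrow> \<kappa> = - 1"
  shows "eps_coords n \<kappa> (simple_root j) = ev (int (orbit_rep n j)) (int (orbit_rep n j) + 1)"
proof
  fix k
  consider "j < n" "k \<le> n - 1" | "j < n" "k \<ge> n" | "j = n" | "j = n + 1" using j(1) by (fastforce simp: idx_def)
  then show "eps_coords n \<kappa> (simple_root j) k = ev (int (orbit_rep n j)) (int (orbit_rep n j) + 1) k"
    by cases (use n j in \<open>auto simp: eps_coords_def simple_root_def orbit_rep_def idx_def ev_def\<close>)
qed

text \<open>In these coordinates the simple coroot of \<open>j\<close> is a difference of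
  neighbouring coordinates; for \<open>n\<close> and \<open>n + 1\<close> this relies on the sign
  chosen for the last one. The cases follow the shapes of the rows of the Cartan matrix: first node,
  inner node, fork and the two tips.\<close>

lemma eps_cartan:
  assumes n: "3 \<le> n" and c: "c \<in> root_lattice n" and j: "j \<in> idx n" "j = n \<longrightarrow> \<kappa> = 1" "j = n + 1 \<longrightarrow> \<kappa> = - 1"
  shows "(\<Sum>k\<in>idx n. cartan n j k * c k) = eps_coords n \<kappa> c (orbit_rep n j) - eps_coords n \<kappa> c (orbit_rep n j + 1)"
proof -
  have c0: "c 0 = 0" using c by (simp add: root_lattice_def idx_def)
  have j1: "1 \<le> j" "j \<le> n + 1" using j(1) by (simp_all add: idx_def)
  obtain m where m: "n = Suc m" "2 \<le> m" using n by (cases n) auto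
  have supp: "(\<Sum>k\<in>idx n. cartan n j k * c k) = (\<Sum>k\<in>T. cartan n j k * c k)"
    if "T \<subseteq> idx n" "\<And>k. k \<in> idx n \<Longrightarrow> k \<notin> T \<Longrightarrow> k \<noteq> j \<and> \<not> dynkin_edge n j k" for T
    by (rule sum.mono_neutral_right) (use that in \<open>auto simp: idx_def cartan_def\<close>)
  consider "j = 1" | i where "j = Suc i" "1 \<le> i" "j < m" | "j = m" | "j = Suc m" | "j = Suc (Suc m)"
    using j1 m by (cases j) force+
  then show ?thesis
  proof cases
    case 1
    have "(\<Sum>k\<in>idx n. cartan n j k * c k) = (\<Sum>k\<in>{1, 2}. cartan n j k * c k)"
      by (rule supp) (use 1 m in \<open>auto simp: idx_def dynkin_edge_def\<close>)
    then show ?thesis using 1 m c0 by (simp add: cartan_def dynkin_edge_def eps_coords_def orbit_rep_def numeral_2_eq_2)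
  next
    case (2 i)
    have "(\<Sum>k\<in>idx n. cartan n j k * c k) = (\<Sum>k\<in>{i, Suc i, Suc (Suc i)}. cartan n j k * c k)"
      by (rule supp) (use 2 m in \<open>auto simp: idx_def dynkin_edge_def\<close>)
    then show ?thesis using 2 m by (simp add: cartan_def dynkin_edge_def eps_coords_def orbit_rep_def)
  next
    case 3
    obtain l where l: "m = Suc l" "1 \<le> l" using m by (cases m) auto
    have "(\<Sum>k\<in>idx n. cartan n j k * c k) = (\<Sum>k\<in>{l, Suc l, Suc (Suc l), Suc (Suc (Suc l))}. cartan n j k * c k)"
      by (rule supp) (use 3 m l in \<open>auto simp: idx_def dynkin_edge_def\<close>)
    then show ?thesis using 3 m l by (simp add: cartan_def dynkin_edge_def eps_coords_def orbit_rep_def)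
  next
    case 4
    have "(\<Sum>k\<in>idx n. cartan n j k * c k) = (\<Sum>k\<in>{m, Suc m}. cartan n j k * c k)"
      by (rule supp) (use 4 m in \<open>auto simp: idx_def dynkin_edge_def\<close>)
    then show ?thesis using 4 m j(2) by (simp add: cartan_def dynkin_edge_def eps_coords_def orbit_rep_def)
  next
    case 5
    have "(\<Sum>k\<in>idx n. cartan n j k * c k) = (\<Sum>k\<in>{m, Suc (Suc m)}. cartan n j k * c k)"
      by (rule supp) (use 5 m in \<open>auto simp: idx_def dynkin_edge_def\<close>)
    then show ?thesis using 5 m j(3) by (simp add: cartan_def dynkin_edge_def eps_coords_def orbit_rep_def)
  qed
qed

lemma eps_refl:
  assumes n: "3 \<le> n" and c: "c \<in> root_lattice n" and j: "j \<in> idx n" "j = n \<longrightarrow> \<kappa> = 1" "j = n + 1 \<longrightarrow> \<kappa> = - 1"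
  shows "eps_coords n \<kappa> (simple_refl n j c) = swap_coords (orbit_rep n j) (eps_coords n \<kappa> c)"
proof
  fix k
  define p where "p = (\<Sum>k\<in>idx n. cartan n j k * c k)"
  have "eps_coords n \<kappa> (simple_refl n j c) k = eps_coords n \<kappa> c k - p * eps_coords n \<kappa> (simple_root j) k"
  proof -
    have "simple_refl n j c = (\<lambda>i. c i - p * simple_root j i)" by (simp add: simple_refl_def p_def)
    then show ?thesis by (simp add: eps_coords_def algebra_simps)
  qed
  also have "\<dots> = swap_coords (orbit_rep n j) (eps_coords n \<kappa> c) k"
    unfolding eps_simple_root[OF n j] p_def eps_cartan[OF n c j]
    using n j(1) by (auto simp: swap_coords_def ev_def idx_def orbit_rep_def)
  finally show "eps_coords n \<kappa> (simple_refl n j c) k = swap_coords (orbit_rep n j) (eps_coords n \<kappa> c) k" .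
qed

lemma eps_neg: "eps_coords n (- \<kappa>) c = neg_last n (eps_coords n \<kappa> c)"
  by (rule ext) (simp add: eps_coords_def neg_last_def)

definition neg_last_pow :: "nat \<Rightarrow> nat \<Rightarrow> (nat \<Rightarrow> int) \<Rightarrow> (nat \<Rightarrow> int)" where
  "neg_last_pow n k = (if even k then (\<lambda>w. w) else neg_last n)"

lemma vee_pow: "(vee n ^^ k) j = (if even k then j else vee n j)"
  by (induction k) (auto simp: vee_def)

lemma orbit_rep_vee: "j \<in> idx n \<Longrightarrow> orbit_rep n (vee n j) = orbit_rep n j"
  by (auto simp: orbit_rep_def vee_def)

lemma vee_idx: "0 < n \<Longrightarrow> j \<in> idx n \<Longrightarrow> (vee n ^^ k) j \<in> idx n"
  by (auto simp: vee_pow vee_def idx_def)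

text \<open>Applying \<open>vee\<close> to a letter conjugates its reflection by the sign change of
  the last coordinate: compute with \<open>- \<kappa>\<close>, where the new letter is again a plain
  transposition, and return by \<open>eps_neg\<close>.\<close>

lemma eps_refl_vee:
  assumes n: "3 \<le> n" and c: "c \<in> root_lattice n" and j: "j \<in> idx n" "j = n \<longrightarrow> \<kappa> = 1" "j = n + 1 \<longrightarrow> \<kappa> = - 1"
  shows "eps_coords n \<kappa> (simple_refl n ((vee n ^^ k) j) c) = neg_last_pow n k (swap_coords (orbit_rep n j) (neg_last_pow n k (eps_coords n \<kappa> c)))"
    and "eps_coords n \<kappa> (simple_root ((vee n ^^ k) j)) = neg_last_pow n k (ev (int (orbit_rep n j)) (int (orbit_rep n j) + 1))"
proof -
  have v: "vee n j \<in> idx n" "vee n j = n \<longrightarrow> - \<kappa> = 1" "vee n j = n + 1 \<longrightarrow> - \<kappa> = - 1"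
    using vee_idx[of n j 1] j n by (auto simp: vee_def split: if_splits)
  have "eps_coords n \<kappa> (simple_refl n (vee n j) c) = neg_last n (swap_coords (orbit_rep n j) (neg_last n (eps_coords n \<kappa> c)))"
    using eps_refl[OF n c v] orbit_rep_vee[OF j(1)] unfolding eps_neg by (metis neg_last_neg_last)
  moreover have "eps_coords n \<kappa> (simple_root (vee n j)) = neg_last n (ev (int (orbit_rep n j)) (int (orbit_rep n j) + 1))"
    using eps_simple_root[OF n v] orbit_rep_vee[OF j(1)] unfolding eps_neg by (metis neg_last_neg_last)
  ultimately show "eps_coords n \<kappa> (simple_refl n ((vee n ^^ k) j) c) = neg_last_pow n k (swap_coords (orbit_rep n j) (neg_last_pow n k (eps_coords n \<kappa> c)))"
    and "eps_coords n \<kappa> (simple_root ((vee n ^^ k) j)) = neg_last_pow n k (ev (int (orbit_rep n j)) (int (orbit_rep n j) + 1))"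
    using eps_refl[OF n c j] eps_simple_root[OF n j] by (simp_all add: neg_last_pow_def vee_pow)
qed

lemma neg_last_pow_twice [simp]: "neg_last_pow n k (neg_last_pow n k w) = w"
  by (simp add: neg_last_pow_def)

lemma eps_block:
  assumes n: "3 \<le> n" and c: "c \<in> root_lattice n" and u: "set u \<subseteq> idx n"
    and \<kappa>: "n \<in> set u \<Longrightarrow> \<kappa> = 1" "n + 1 \<in> set u \<Longrightarrow> \<kappa> = - 1"
  shows "eps_coords n \<kappa> (word_elt n (map (vee n ^^ k) u) c) = neg_last_pow n k (foldr swap_coords (map (orbit_rep n) u) (neg_last_pow n k (eps_coords n \<kappa> c)))"
  using u \<kappa>
proof (induction u)
  case (Cons j u)
  have "word_elt n (map (vee n ^^ k) u) c \<in> root_lattice n"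
    using Cons.prems n by (intro word_elt_V c) (auto intro!: vee_idx)
  then show ?case using Cons by (simp add: eps_refl_vee(1)[OF n])
qed simp

text \<open>Coordinates are differences of successive coefficients, so partial sums invert them; at
  the fork only the sum and the difference of the last two coefficients come out.\<close>

lemma coeffs_from_eps:
  assumes n: "3 \<le> n" and \<kappa>: "\<kappa> = 1 \<or> \<kappa> = - 1" and c: "c \<in> root_lattice n" and k: "k \<le> n - 1"
  shows "c k = (\<Sum>j\<in>{1..k}. eps_coords n \<kappa> c j)"
    and "c n + c (n + 1) = (\<Sum>j\<in>{1..n}. eps_coords n \<kappa> c j)"
    and "c (n + 1) - c n = \<kappa> * eps_coords n \<kappa> c (n + 1)"
proof -
  have c0: "c 0 = 0" using c by (simp add: root_lattice_def idx_def)
  have *: "c k = (\<Sum>j\<in>{1..k}. eps_coords n \<kappa> c j)" if "k \<le> n - 1" for k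
    using that by (induction k) (simp_all add: c0 eps_coords_def)
  show "c k = (\<Sum>j\<in>{1..k}. eps_coords n \<kappa> c j)" using * k .
  have "{1..n} = insert n {1..n - 1}" "\<not> n \<le> n - 1" using n by auto
  then show "c n + c (n + 1) = (\<Sum>j\<in>{1..n}. eps_coords n \<kappa> c j)"
    using *[of "n - 1"] n by (simp add: eps_coords_def)
  show "c (n + 1) - c n = \<kappa> * eps_coords n \<kappa> c (n + 1)" using \<kappa> by (auto simp: eps_coords_def)
qed

lemma eps_coords_eqD:
  assumes n: "3 \<le> n" and \<kappa>: "\<kappa> = 1 \<or> \<kappa> = - 1" and c: "c \<in> root_lattice n" "c' \<in> root_lattice n" and eq: "eps_coords n \<kappa> c = eps_coords n \<kappa> c'"
  shows "c = c'"
proof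
  fix k
  have e: "c n + c (n + 1) = c' n + c' (n + 1)" "c (n + 1) - c n = c' (n + 1) - c' n"
    using coeffs_from_eps(2,3)[OF n \<kappa> c(1), of 0] coeffs_from_eps(2,3)[OF n \<kappa> c(2), of 0] eq by simp_all
  have e: "c n = c' n" "c (n + 1) = c' (n + 1)" using e by linarith+
  consider "k \<le> n - 1" | "k = n" | "k = n + 1" | "k > n + 1" by linarith
  then show "c k = c' k"
  proof cases
    case 1
    then show ?thesis using coeffs_from_eps(1)[OF n \<kappa> c(1) 1] coeffs_from_eps(1)[OF n \<kappa> c(2) 1] eq by metis
  next
    case 2
    then show ?thesis using e by simp
  next
    case 3
    then show ?thesis using e by simp
  next
    case 4
    then show ?thesis using c by (simp add: root_lattice_def idx_def)
  qed
qed

lemma neg_last_label_neg: "neg_last_label n (- l) = - neg_last_label n l"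
  by (simp add: neg_last_label_def)

section \<open>Twisted adapted words\<close>

locale twisted =
  fixes n :: nat and js :: "nat list"
  assumes n3: "3 \<le> n" and len_js: "length js = n" and js_idx: "set js \<subseteq> idx n"
    and js_orbit: "\<And>i. i \<in> idx n \<Longrightarrow> \<exists>!k. k < length js \<and> js ! k \<in> {i, vee n i}"
begin

abbreviation h :: nat where "h \<equiv> n + 1"

definition jn :: "nat list" where "jn = map (orbit_rep n) js"

definition sign_last :: int where "sign_last = (if n + 1 \<in> set js then - 1 else 1)"

lemma jn_set: "set jn = {1..n}"
proof
  show "set jn \<subseteq> {1..n}" using js_idx n3 by (auto simp: jn_def orbit_rep_def idx_def)
  show "{1..n} \<subseteq> set jn"
  proof
    fix i assume i: "i \<in> {1..n}"
    then obtain k where "k < length js" "js ! k \<in> {i, vee n i}" using js_orbit[of i] by (auto simp: idx_def)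
    moreover from this(2) i have "orbit_rep n (js ! k) = i" by (auto simp: orbit_rep_def vee_def split: if_splits)
    ultimately show "i \<in> set jn" unfolding jn_def by (metis image_eqI nth_mem set_map)
  qed
qed

lemma jn_distinct: "distinct jn"
  using jn_set len_js by (intro card_distinct) (simp add: jn_def)

lemma sign_last: "sign_last = 1 \<or> sign_last = - 1" "n \<in> set js \<longrightarrow> sign_last = 1" "n + 1 \<in> set js \<longrightarrow> sign_last = - 1"
proof -
  have "\<not> (n \<in> set js \<and> n + 1 \<in> set js)"
    using jn_distinct inj_onD[of "orbit_rep n" "set js" n "n + 1"] by (auto simp: jn_def distinct_map orbit_rep_def)
  then show "sign_last = 1 \<or> sign_last = - 1" "n \<in> set js \<longrightarrow> sign_last = 1" "n + 1 \<in> set js \<longrightarrow> sign_last = - 1"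
    by (auto simp: sign_last_def)
qed

section \<open>Labels of the first block and the cyclic numbering\<close>

definition pre :: "nat \<Rightarrow> nat list" where "pre i = takeWhile (\<lambda>j. j \<noteq> i) jn"

definition bef :: "nat \<Rightarrow> nat \<Rightarrow> bool" where "bef i j \<longleftrightarrow> i \<in> set (pre j)"

lemma pre_split: "jn = A @ i # B \<Longrightarrow> pre i = A"
  using jn_distinct by (auto simp: pre_def takeWhile_tail intro: takeWhile_append2[THEN trans])

lemma bef_split:
  assumes "bef i j" "j \<in> set jn"
  obtains A B D where "jn = A @ i # B @ j # D" "pre i = A" "pre j = A @ i # B"
proof -
  obtain P D where P: "jn = P @ j # D" using assms(2) by (metis split_list)
  then have "i \<in> set P" using assms(1) pre_split by (auto simp: bef_def)
  then obtain A B where A: "P = A @ i # B" by (metis split_list)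
  show thesis using that[of A B D] P A pre_split[OF P] pre_split[of A i "B @ j # D"] by simp
qed

lemma bef_total: "i \<in> set jn \<Longrightarrow> j \<in> set jn \<Longrightarrow> i \<noteq> j \<Longrightarrow> \<not> bef i j \<Longrightarrow> bef j i"
proof -
  assume a: "i \<in> set jn" "j \<in> set jn" "i \<noteq> j" "\<not> bef i j"
  obtain A D where A: "jn = A @ i # D" using a(1) by (metis split_list)
  have "j \<in> set A"
  proof (rule ccontr)
    assume "j \<notin> set A"
    then obtain B E where "D = B @ j # E" using A a by (metis Un_iff set_append set_ConsD split_list)
    then have "pre j = A @ i # B" using A by (intro pre_split[of _ _ E]) simp
    then show False using a by (simp add: bef_def)
  qed
  then show ?thesis using pre_split[OF A] by (simp add: bef_def)
qed

lemma bef_asym: "i \<in> set jn \<Longrightarrow> j \<in> set jn \<Longrightarrow> bef i j \<Longrightarrow> \<not> bef j i"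
  by (elim bef_split) (use jn_distinct in \<open>auto simp: bef_def\<close>)

lemma bef_trans: "bef i j \<Longrightarrow> bef j k \<Longrightarrow> k \<in> set jn \<Longrightarrow> bef i k"
  by (elim bef_split[of j k]) (auto simp: bef_def)

text \<open>In coordinates the root of letter \<open>i\<close> in the first block is
  \<open>ev (left_label i) (right_label i)\<close>. The map \<open>phi\<close> is the product of one
  block and the diagram automorphism, acting on labels.\<close>

definition left_label :: "nat \<Rightarrow> int" where "left_label i = lact (pre i) (int i)"
definition right_label :: "nat \<Rightarrow> int" where "right_label i = lact (pre i) (int i + 1)"
definition phi :: "int \<Rightarrow> int" where "phi l = lact jn (neg_last_label n l)"

lemma no0: "0 \<notin> set jn" by (simp add: jn_set)

lemma lact_fix':
  "set u \<subseteq> set jn \<Longrightarrow> i \<notin> set u \<Longrightarrow> i - 1 \<notin> set u \<Longrightarrow> 1 \<le> i \<Longrightarrow> lact u (int i) = int i"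
  using no0 by (intro lact_fix) auto

text \<open>The label \<open>i + 1\<close> is moved only by the letters \<open>i\<close> and
  \<open>i + 1\<close>, so only their relative position matters. Here the two intervals share the
  left end and differ by one step of \<open>phi\<close> on the right.\<close>

lemma step_up:
  assumes "1 \<le> i" "i < n" "bef i (i + 1)"
  shows "left_label (i + 1) = left_label i" "right_label i = int i + 1" "phi (right_label i) = right_label (i + 1)"
proof -
  obtain A B D where jn: "jn = A @ i # B @ (i + 1) # D" and p: "pre i = A" "pre (i + 1) = A @ i # B"
    using assms by (elim bef_split) (auto simp: jn_set)
  have f: "lact u (int (i + 1)) = int (i + 1)" if "u \<in> {A, B, D}" for u
    using that jn_distinct by (intro lact_fix') (auto simp: jn)
  show "left_label (i + 1) = left_label i" unfolding left_label_def p using f[of B] by (simp add: swap_labels_def)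
  show R: "right_label i = int i + 1" unfolding right_label_def p using f[of A] by (simp add: add.commute)
  have "neg_last_label n (int i + 1) = int i + 1" using assms by (simp add: neg_last_label_def)
  then show "phi (right_label i) = right_label (i + 1)"
    unfolding R unfolding phi_def right_label_def p using f[of D] by (simp add: jn swap_labels_def add.commute)
qed

lemma step_down:
  assumes "1 \<le> i" "i < n" "\<not> bef i (i + 1)"
  shows "right_label i = right_label (i + 1)" "left_label (i + 1) = int i + 1" "phi (left_label (i + 1)) = left_label i"
proof -
  obtain A B D where jn: "jn = A @ (i + 1) # B @ i # D" and p: "pre (i + 1) = A" "pre i = A @ (i + 1) # B"
  proof -
    have "i \<in> set jn" "i + 1 \<in> set jn" using assms by (auto simp: jn_set)
    then have "bef (i + 1) i" using bef_total assms by simp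
    then show thesis using that \<open>i \<in> set jn\<close> by (elim bef_split)
  qed
  have f: "lact u (int (i + 1)) = int (i + 1)" if "u \<in> {A, B, D}" for u
    using that jn_distinct by (intro lact_fix') (auto simp: jn)
  show "right_label i = right_label (i + 1)" unfolding right_label_def p using f[of B] by (simp add: swap_labels_def add.commute)
  show R: "left_label (i + 1) = int i + 1" unfolding left_label_def p using f[of A] by (simp add: add.commute)
  have "neg_last_label n (int i + 1) = int i + 1" using assms by (simp add: neg_last_label_def)
  then show "phi (left_label (i + 1)) = left_label i"
    unfolding R unfolding phi_def left_label_def p using f[of D] by (simp add: jn swap_labels_def add.commute)
qed

text \<open>Both ends of the recursion: the interval of letter 1 has length 1, and past the right
  end for \<open>n\<close> the orbit continues with the opposite sign, which doubles the
  cycle.\<close>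

lemma ends_LR: "left_label 1 = 1" "phi (left_label 1) = right_label 1" "right_label n = int n + 1" "phi (right_label n) = - left_label n"
proof -
  obtain A D where jn: "jn = A @ 1 # D" using jn_set n3 by (metis split_list atLeastAtMost_iff le_trans one_le_numeral order_refl)
  have f: "lact u (int 1) = int 1" if "u \<in> {A, D}" for u
    using that jn_distinct no0 by (intro lact_fix') (auto simp: jn)
  show left_label: "left_label 1 = 1" unfolding left_label_def pre_split[OF jn] using f[of A] by simp
  show "phi (left_label 1) = right_label 1" unfolding left_label
    unfolding right_label_def pre_split[OF jn] using f[of D] n3 by (simp add: phi_def neg_last_label_def jn swap_labels_def)
next
  obtain A D where jn: "jn = A @ n # D" using jn_set n3 by (metis split_list atLeastAtMost_iff le_trans one_le_numeral order_refl)
  have "n + 1 \<notin> set jn" by (simp add: jn_set)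
  then have f: "lact u (int (n + 1)) = int (n + 1)" if "u \<in> {A, D}" for u
    using that jn_distinct by (intro lact_fix') (auto simp: jn)
  show R: "right_label n = int n + 1" using f[of A] by (simp add: right_label_def pre_split[OF jn] add.commute)
  have "phi (right_label n) = lact jn (- (int n + 1))" by (simp add: R phi_def neg_last_label_def)
  also have "\<dots> = - lact jn (int n + 1)" using no0 by (rule lact_neg)
  also have "lact jn (int n + 1) = left_label n"
    using f[of D] by (simp add: left_label_def pre_split[OF jn] jn swap_labels_def add.commute)
  finally show "phi (right_label n) = - left_label n" .
qed

text \<open>
  The root of the letter $i$ in the first block is the point $(X_i, X_i + i)$: passing from $i + 1$ to
  $i$ shortens the interval on the right if $i$ precedes $i + 1$ in the word, and on the left otherwise.
\<close>
definition X :: "nat \<Rightarrow> nat" where "X i = card {m. i \<le> m \<and> m < n \<and> \<not> bef m (m + 1)}"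

lemma X_step: "i < n \<Longrightarrow> X i = (if bef i (i + 1) then X (i + 1) else X (i + 1) + 1)"
proof -
  assume "i < n"
  then have "{m. i \<le> m \<and> m < n \<and> \<not> bef m (m + 1)} =
      (if bef i (i + 1) then {} else {i}) \<union> {m. i + 1 \<le> m \<and> m < n \<and> \<not> bef m (m + 1)}"
    by (auto simp: Suc_le_eq le_less)
  then show ?thesis by (auto simp: X_def)
qed

lemma X_n: "X n = 0" by (simp add: X_def)

sublocale strip n h X
  by unfold_locales (use n3 X_step X_n in auto)

definition v :: "nat \<Rightarrow> int" where "v x = (phi ^^ x) (left_label n)"

lemma v_add: "v (x + y) = (phi ^^ x) (v y)"
  by (simp add: v_def funpow_add)

lemma v_L: "1 \<le> i \<Longrightarrow> i \<le> n \<Longrightarrow> v (X i) = left_label i"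
proof (induction "n - i" arbitrary: i)
  case 0
  then have i: "i = n" by simp
  show ?case unfolding i by (simp add: X_n v_def)
next
  case (Suc k)
  then have "v (X (i + 1)) = left_label (i + 1)" by simp
  then show ?case
    using X_step[of i] step_up[of i] step_down[of i] v_add[of 1 "X (i + 1)"] Suc by (auto split: if_splits)
qed

lemma phi_L: "1 \<le> i \<Longrightarrow> i \<le> n \<Longrightarrow> (phi ^^ i) (left_label i) = right_label i"
proof (induction i rule: nat_induct_at_least)
  case base
  then show ?case using ends_LR(2) by simp
next
  case (Suc i)
  then have IH: "(phi ^^ i) (left_label i) = right_label i" by simp
  show ?case
  proof (cases "bef i (i + 1)")
    case True
    then show ?thesis using IH step_up[of i] Suc by simp
  next
    case False
    have "(phi ^^ Suc i) (left_label (Suc i)) = (phi ^^ i) (phi (left_label (i + 1)))" by (simp add: funpow_swap1)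
    then show ?thesis using IH step_down[of i] Suc False by simp
  qed
qed

lemma v_R: "1 \<le> i \<Longrightarrow> i \<le> n \<Longrightarrow> v (X i + i) = right_label i"
  using v_add[of i "X i"] by (simp add: v_L phi_L add.commute)

text \<open>So \<open>v\<close> restricted to \<open>{0..n}\<close> is a permutation that first decreases and then increases.\<close>
lemma v_level: "1 \<le> i \<Longrightarrow> i \<le> n \<Longrightarrow> v ` {X i..<X i + i} = {1..int i}"
proof (induction i rule: nat_induct_at_least)
  case base
  then show ?case using v_L[of 1] ends_LR(1) n3 by (simp add: atLeastLessThanSuc)
next
  case (Suc i)
  have e: "{1..int (Suc i)} = insert (int i + 1) {1..int i}" by auto
  show ?case
  proof (cases "bef i (i + 1)")
    case True
    then have "{X (Suc i)..<X (Suc i) + Suc i} = insert (X i + i) {X i..<X i + i}" using X_step[of i] Suc by auto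
    then show ?thesis using Suc e step_up[of i] True v_R[of i] by simp
  next
    case False
    then have "{X (Suc i)..<X (Suc i) + Suc i} = insert (X (Suc i)) {X i..<X i + i}" using X_step[of i] Suc by auto
    then show ?thesis using Suc e step_down[of i] False v_L[of "Suc i"] by simp
  qed
qed

lemma v_n: "v n = int n + 1"
  using v_R[of n] ends_LR(3) n3 by (simp add: X_n)

lemma phi_neg: "phi (- l) = - phi l"
  by (simp add: phi_def neg_last_label_neg lact_neg no0)

lemma v_h: "v (x + h) = - v x"
proof -
  have "v h = - v 0"
    using v_add[of 1 n] v_R[of n] ends_LR(4) n3 by (simp add: X_n v_def)
  moreover have "(phi ^^ x) (- l) = - (phi ^^ x) l" for l by (induction x) (simp_all add: phi_neg)
  ultimately show ?thesis using v_add[of x h] v_add[of x 0] by simp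
qed

lemma v_image: "v ` {0..n} = {1..int n + 1}"
proof -
  have "{0..n} = insert n {0..<n}" by auto
  then show ?thesis using v_level[of n] n3 v_n by (auto simp: X_n)
qed

lemma v_inj: "inj_on v {0..n}"
  by (rule eq_card_imp_inj_on) (simp_all add: v_image)

lemma v_range: "x \<le> n \<Longrightarrow> 1 \<le> v x \<and> v x \<le> int n + 1"
  using v_image by (metis atLeastAtMost_iff image_eqI zero_le)

lemma v_abs: "\<bar>v x\<bar> = v (x mod h)"
proof (induction x rule: less_induct)
  case (less x)
  show ?case
  proof (cases "x < h")
    case True
    then show ?thesis using v_range[of x] by simp
  next
    case False
    then have "\<bar>v x\<bar> = \<bar>v (x - h)\<bar>" using v_h[of "x - h"] by simp
    then show ?thesis using less[of "x - h"] False by (simp add: le_mod_geq)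
  qed
qed

lemma v_window: "x < y \<Longrightarrow> y < x + h \<Longrightarrow> \<bar>v x\<bar> \<noteq> \<bar>v y\<bar>"
proof
  assume a: "x < y" "y < x + h" "\<bar>v x\<bar> = \<bar>v y\<bar>"
  have "x mod h = y mod h" using a(3) v_inj by (auto simp: v_abs inj_on_eq_iff less_Suc_eq_le)
  then have "h dvd y - x" using a(1) by (metis less_imp_le mod_eq_dvd_iff_nat)
  then have "h \<le> y - x" using a(1) by (intro dvd_imp_le) auto
  then show False using a by auto
qed

lemma v_le: "1 \<le> i \<Longrightarrow> i \<le> n \<Longrightarrow> x \<le> n \<Longrightarrow> v x \<le> int i \<longleftrightarrow> X i \<le> x \<and> x < X i + i"
proof -
  assume a: "1 \<le> i" "i \<le> n" "x \<le> n"
  have b: "X i + i \<le> n" using X_mono[of i n] a by (simp add: X_n)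
  have "v x \<in> v ` {X i..<X i + i} \<longleftrightarrow> x \<in> {X i..<X i + i}"
    by (rule inj_on_image_mem_iff[OF v_inj]) (use a b in auto)
  then show ?thesis using v_level[of i] v_range[of x] a by auto
qed

text \<open>\<open>X 1\<close> is the bottom of the valley. To the right of it, \<open>x\<close> is
  the last place of the level set belonging to its own label, so later places carry larger
  labels.\<close>

lemma v_incr: "X 1 \<le> x \<Longrightarrow> x < y \<Longrightarrow> y \<le> n \<Longrightarrow> v x < v y"
proof -
  assume a: "X 1 \<le> x" "x < y" "y \<le> n"
  define p where "p = nat (v x)"
  have ne: "v x \<noteq> v z" if "z \<le> n" "z \<noteq> x" for z using v_inj a that by (auto dest: inj_onD)
  have p: "v x = int p" "1 \<le> p" "p \<le> n" using v_range[of x] ne[of n] v_n a by (auto simp: p_def)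
  have x: "X p \<le> x \<and> x < X p + p" using v_le[of p x] p a by simp
  have "\<not> v y \<le> int p"
  proof (cases "p = 1")
    case True
    then show ?thesis using v_range[of y] ne[of y] p a by auto
  next
    case False
    have "X (p - 1) \<le> X 1" "X p \<le> X (p - 1)" using X_mono[of 1 "p - 1"] X_mono[of "p - 1" p] p False by auto
    moreover have "\<not> (X (p - 1) \<le> x \<and> x < X (p - 1) + (p - 1))" using v_le[of "p - 1" x] p a False by auto
    ultimately have "X p + p \<le> y" using x a by linarith
    then show ?thesis using v_le[of p y] p a by auto
  qed
  then show ?thesis using p by simp
qed

lemma v_decr: "x < y \<Longrightarrow> y \<le> X 1 \<Longrightarrow> v y < v x"
proof -
  assume a: "x < y" "y \<le> X 1"
  have X1: "X 1 < n" using X_mono[of 1 n] n3 by (simp add: X_n)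
  define p where "p = nat (v y)"
  have ne: "v y \<noteq> v z" if "z \<le> n" "z \<noteq> y" for z using v_inj a X1 that by (auto dest: inj_onD)
  have p: "v y = int p" "1 \<le> p" "p \<le> n" using v_range[of y] ne[of n] v_n a X1 by (auto simp: p_def)
  have y: "X p \<le> y \<and> y < X p + p" using v_le[of p y] p a X1 by simp
  have "\<not> v x \<le> int p"
  proof (cases "p = 1")
    case True
    then show ?thesis using v_range[of x] ne[of x] p a X1 by auto
  next
    case False
    have "X 1 + 1 \<le> X (p - 1) + (p - 1)" "X (p - 1) + (p - 1) \<le> X p + p"
      using X_mono[of 1 "p - 1"] X_mono[of "p - 1" p] p False by auto
    moreover have "\<not> (X (p - 1) \<le> y \<and> y < X (p - 1) + (p - 1))" using v_le[of "p - 1" y] p a X1 False by auto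
    ultimately have "x < X p" using y a p by linarith
    then show ?thesis using v_le[of p x] p a X1 by auto
  qed
  then show ?thesis using p by simp
qed

text \<open>If both places lie on one slope, the valley shape decides. Otherwise the level set of
  labels up to \<open>y - x\<close> is too short to contain both places, and it contains one of
  them.\<close>

lemma X_iff_less: "x < y \<Longrightarrow> y \<le> n \<Longrightarrow> X (y - x) \<le> x \<longleftrightarrow> v x < v y"
proof -
  assume a: "x < y" "y \<le> n"
  define i where "i = y - x"
  have i: "y = x + i" "1 \<le> i" "i \<le> n" using a by (auto simp: i_def)
  have m: "X i \<le> X 1" "X 1 + 1 \<le> X i + i" using X_mono[of 1 i] i by auto
  have "v x < v y" if "X i \<le> x"
  proof (cases "X 1 \<le> x")
    case True
    then show ?thesis using v_incr a by blast
  next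
    case False
    then have "v x \<le> int i" using v_le[of i x] i a m that by auto
    moreover have "\<not> v y \<le> int i" using v_le[of i y] i a m that by auto
    ultimately show ?thesis by simp
  qed
  moreover have "v y < v x" if "x < X i"
  proof (cases "y \<le> X 1")
    case True
    then show ?thesis using v_decr a by blast
  next
    case False
    then have "v y \<le> int i" using v_le[of i y] i a m that by auto
    moreover have "\<not> v x \<le> int i" using v_le[of i x] i a m that by auto
    ultimately show ?thesis by simp
  qed
  ultimately show ?thesis by (metis i_def less_asym not_less)
qed

text \<open>Together with \<open>R_mid\<close> and \<open>R_hi\<close> this matches the slice with
  positive vectors: differences of increasing labels, sums of labels, and, one period later,
  differences read in reverse.\<close>

lemma R_lo: "x < y \<Longrightarrow> y \<le> n \<Longrightarrow> (x, y) \<in> R \<longleftrightarrow> v x < v y"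
  using X_iff_less[of x y] by (auto simp: R_def)

lemma X_bound: "1 \<le> i \<Longrightarrow> i \<le> n \<Longrightarrow> X i + i \<le> n"
  using X_mono[of i n] by (simp add: X_n)

lemma R_mid:
  assumes "x \<le> n" "n < y" "y < x + h"
  shows "(x, y) \<in> R"
proof -
  obtain i where "y = x + i" "1 \<le> i" "i \<le> n" using assms that[of "y - x"] by auto
  then show ?thesis using X_bound[of i] assms by (auto intro!: R_I)
qed

lemma R_hi:
  assumes a: "x < y" "y \<le> n"
  shows "(x + h, y + h) \<in> R \<longleftrightarrow> v y < v x"
proof -
  have "v x \<noteq> v y" using v_window[of x y] a by auto
  obtain i where i: "y = x + i" "1 \<le> i" "i \<le> n" using a that[of "y - x"] by auto
  then have "(x + h, y + h) \<in> R \<longleftrightarrow> x < X i"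
    using X_bound[of i] by (auto simp: R_def)
  then show ?thesis using X_iff_less[of x y] a i \<open>v x \<noteq> v y\<close> by auto
qed

lemma R_split:
  assumes "(x, y) \<in> R"
  obtains "y \<le> n" "x < y" "v x < v y"
  | "x \<le> n" "n < y" "y < x + h"
  | x' y' where "x = x' + h" "y = y' + h" "x' < y'" "y' < n" "v y' < v x'"
proof -
  have l: "x < y" "y < x + h" "y \<le> 2 * n" using R_len[OF assms] R_bound[OF assms] by auto
  consider "y \<le> n" | "x \<le> n" "n < y" | "n < x" by linarith
  then show thesis
  proof cases
    case 1 then show ?thesis using that(1) R_lo l assms by blast
  next
    case 2 then show ?thesis using that(2) l by blast
  next
    case 3
    have "(x - h) + h = x" "(y - h) + h = y" "x - h < y - h" "y - h < n" using 3 l by auto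
    then show ?thesis using that(3)[of "x - h" "y - h"] R_hi[of "x - h" "y - h"] assms by simp
  qed
qed

lemma positive_functional: "\<exists>\<chi>::nat \<Rightarrow> int. (\<forall>x. \<chi> (x + h) = - \<chi> x) \<and> (\<forall>(x, y)\<in>R. \<chi> y < \<chi> x)"
proof -
  \<comment> \<open>The functional sends eps_k to \<open>n + 2 - k\<close>. It is positive and
    decreasing in \<open>k\<close>, hence positive on all sums and on eps_p - eps_r for
    \<open>p < r\<close>.\<close>
  define \<chi> where "\<chi> x = sgn (v x) * (int n + 2 - \<bar>v x\<bar>)" for x
  have a: "\<chi> (x + h) = - \<chi> x" for x using v_h[of x] by (simp add: \<chi>_def sgn_minus)
  have lo: "\<chi> x = int n + 2 - v x" "0 < \<chi> x" if "x \<le> n" for x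
    using v_range[OF that] by (auto simp: \<chi>_def)
  have "\<chi> y < \<chi> x" if "(x, y) \<in> R" for x y
    using that
  proof (cases rule: R_split)
    case 1 then show ?thesis using lo by auto
  next
    case 2
    then have "y - h \<le> n" "y - h + h = y" by auto
    then show ?thesis using lo(2)[of x] lo(2)[of "y - h"] a[of "y - h"] 2 by simp
  next
    case (3 x' y')
    then show ?thesis using lo(1)[of x'] lo(1)[of y'] a[of x'] a[of y'] by simp
  qed
  then show ?thesis using a by blast
qed

end

section \<open>Roots of a twisted adapted word as points of the strip\<close>

definition eps :: "int \<Rightarrow> nat \<Rightarrow> int" where
  "eps l k = of_bool (int k = l) - of_bool (int k = - l)"

lemma ev_eps: "ev a b k = eps a k - eps b k"
  by (simp add: ev_def eps_def)

lemma eps_minus: "eps (- l) k = - eps l k"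
  by (simp add: eps_def)

section \<open>The invariant form and commuting letters\<close>

definition dot :: "nat \<Rightarrow> (nat \<Rightarrow> int) \<Rightarrow> (nat \<Rightarrow> int) \<Rightarrow> int" where
  "dot n w w' = (\<Sum>k\<in>{1..n + 1}. w k * w' k)"

lemma sum_eps:
  assumes "1 \<le> \<bar>a\<bar>" "\<bar>a\<bar> \<le> int n + 1"
  shows "(\<Sum>k\<in>{1..n + 1}. eps a k * f k) = sgn a * f (nat \<bar>a\<bar>)"
proof -
  have "(\<Sum>k\<in>{1..n + 1}. eps a k * f k) = (\<Sum>k\<in>{1..n + 1}. if k = nat \<bar>a\<bar> then sgn a * f k else 0)"
    by (rule sum.cong) (use assms in \<open>auto simp: eps_def sgn_if\<close>)
  also have "\<dots> = sgn a * f (nat \<bar>a\<bar>)" using assms by (subst sum.delta) auto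
  finally show ?thesis .
qed

lemma dot_ev:
  assumes "1 \<le> \<bar>a\<bar>" "\<bar>a\<bar> \<le> int n + 1" "1 \<le> \<bar>b\<bar>" "\<bar>b\<bar> \<le> int n + 1"
  shows "dot n (ev a b) w = sgn a * w (nat \<bar>a\<bar>) - sgn b * w (nat \<bar>b\<bar>)"
proof -
  have "dot n (ev a b) w = (\<Sum>k\<in>{1..n + 1}. eps a k * w k) - (\<Sum>k\<in>{1..n + 1}. eps b k * w k)"
    unfolding dot_def ev_eps left_diff_distrib sum_subtractf ..
  then show ?thesis using assms by (simp only: sum_eps)
qed

lemma dot_swap_coords: "1 \<le> i \<Longrightarrow> i \<le> n \<Longrightarrow> dot n (swap_coords i w) (swap_coords i w') = dot n w w'"
  unfolding dot_def swap_coords_def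
  by (rule sum.reindex_bij_witness[of _ "\<lambda>k. if k = i then i + 1 else if k = i + 1 then i else k"
        "\<lambda>k. if k = i then i + 1 else if k = i + 1 then i else k"]) auto

lemma dot_neg_last: "dot n (neg_last n w) (neg_last n w') = dot n w w'"
  unfolding dot_def by (rule sum.cong) (auto simp: neg_last_def)

definition form :: "nat \<Rightarrow> (nat \<Rightarrow> int) \<Rightarrow> (nat \<Rightarrow> int) \<Rightarrow> int" where
  "form n c c' = dot n (eps_coords n 1 c) (eps_coords n 1 c')"

text \<open>The sign change of the last coordinate is an isometry, so each letter can be treated
  with the sign that suits it.\<close>

lemma form_kappa: "\<kappa> = 1 \<or> \<kappa> = - 1 \<Longrightarrow> dot n (eps_coords n \<kappa> c) (eps_coords n \<kappa> c') = form n c c'"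
  using eps_neg[of n 1] by (auto simp: form_def dot_neg_last)

lemma orbit_rep_range: "3 \<le> n \<Longrightarrow> j \<in> idx n \<Longrightarrow> 1 \<le> orbit_rep n j \<and> orbit_rep n j \<le> n"
  by (auto simp: orbit_rep_def idx_def)

lemma obtain_kappa:
  fixes n j :: nat
  obtains \<kappa> :: int where "\<kappa> = 1 \<or> \<kappa> = - 1" "j = n \<longrightarrow> \<kappa> = 1" "j = n + 1 \<longrightarrow> \<kappa> = - 1"
proof (cases "j = n + 1")
  case True
  then show ?thesis by (intro that[of "- 1"]) auto
next
  case False
  then show ?thesis by (intro that[of 1]) auto
qed

lemma form_refl:
  assumes "3 \<le> n" "j \<in> idx n" "c \<in> root_lattice n" "c' \<in> root_lattice n"
  shows "form n (simple_refl n j c) (simple_refl n j c') = form n c c'"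
proof -
  obtain \<kappa> :: int where k: "\<kappa> = 1 \<or> \<kappa> = - 1" "j = n \<longrightarrow> \<kappa> = 1" "j = n + 1 \<longrightarrow> \<kappa> = - 1" by (rule obtain_kappa)
  then show ?thesis
    using eps_refl[OF assms(1,3,2) k(2,3)] eps_refl[OF assms(1,4,2) k(2,3)] orbit_rep_range[OF assms(1,2)]
    by (simp add: form_kappa[OF k(1), symmetric] dot_swap_coords)
qed

lemma form_word:
  "3 \<le> n \<Longrightarrow> set u \<subseteq> idx n \<Longrightarrow> c \<in> root_lattice n \<Longrightarrow> c' \<in> root_lattice n \<Longrightarrow> form n (word_elt n u c) (word_elt n u c') = form n c c'"
  by (induction u) (simp_all add: form_refl word_elt_V)

lemma form_simple_root:
  assumes "3 \<le> n" "j \<in> idx n" "c \<in> root_lattice n"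
  shows "form n (simple_root j) c = (\<Sum>k\<in>idx n. cartan n j k * c k)"
proof -
  obtain \<kappa> :: int where k: "\<kappa> = 1 \<or> \<kappa> = - 1" "j = n \<longrightarrow> \<kappa> = 1" "j = n + 1 \<longrightarrow> \<kappa> = - 1" by (rule obtain_kappa)
  show ?thesis
    unfolding form_kappa[OF k(1), symmetric] eps_simple_root[OF assms(1,2) k(2,3)] eps_cartan[OF assms(1,3,2) k(2,3)]
    using orbit_rep_range[OF assms(1,2)] by (subst dot_ev) (auto simp: nat_add_distrib)
qed

lemma sum_simple_root: "j \<in> idx n \<Longrightarrow> (\<Sum>k\<in>idx n. cartan n i k * simple_root j k) = cartan n i j"
  by (simp add: simple_root_def idx_def if_distrib[of "\<lambda>x. _ * x"] sum.delta cong: if_cong)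

lemma simple_refl_simple_root:
  "j \<in> idx n \<Longrightarrow> simple_refl n i (simple_root j) = (\<lambda>k. simple_root j k - cartan n i j * simple_root i k)"
  by (simp add: simple_refl_def sum_simple_root)

text \<open>Adjacent letters of a word commute iff their roots are orthogonal.\<close>
lemma form_adjacent:
  assumes "3 \<le> n" "i \<in> idx n" "j \<in> idx n" "set a \<subseteq> idx n"
  shows "form n (word_elt n a (simple_root i)) (word_elt n a (simple_refl n i (simple_root j))) = - cartan n i j"
proof -
  have V: "simple_root i \<in> root_lattice n" "simple_refl n i (simple_root j) \<in> root_lattice n"
    using assms by (simp_all add: simple_root_V simple_refl_V)
  have "form n (simple_root i) (simple_refl n i (simple_root j)) =
      (\<Sum>k\<in>idx n. cartan n i k * simple_root j k) - cartan n i j * (\<Sum>k\<in>idx n. cartan n i k * simple_root i k)"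
    unfolding form_simple_root[OF assms(1,2) V(2)] unfolding simple_refl_simple_root[OF assms(3)]
    by (simp add: algebra_simps sum_subtractf sum_distrib_left)
  also have "\<dots> = - cartan n i j" using assms by (simp add: sum_simple_root) (simp add: cartan_def)
  finally show ?thesis using form_word[OF assms(1,4) V] by simp
qed

lemma simple_refl_comm:
  assumes "i \<in> idx n" "j \<in> idx n" "cartan n i j = 0" "cartan n j i = 0"
  shows "simple_refl n i (simple_refl n j c) = simple_refl n j (simple_refl n i c)"
proof -
  have *: "(\<Sum>k\<in>idx n. cartan n i k * simple_refl n j c k) = (\<Sum>k\<in>idx n. cartan n i k * c k)"
    if "j \<in> idx n" "cartan n i j = 0" for i j
  proof -
    define s where "s = (\<Sum>k\<in>idx n. cartan n j k * c k)"
    have "(\<Sum>k\<in>idx n. cartan n i k * simple_refl n j c k) =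
        (\<Sum>k\<in>idx n. cartan n i k * c k) - s * (\<Sum>k\<in>idx n. cartan n i k * simple_root j k)"
    proof -
      have "simple_refl n j c = (\<lambda>k. c k - s * simple_root j k)" by (simp add: simple_refl_def s_def)
      then show ?thesis by (simp add: algebra_simps sum_subtractf sum_distrib_left)
    qed
    then show ?thesis using that by (simp add: sum_simple_root)
  qed
  show ?thesis
  proof
    fix k
    have "simple_refl n i (simple_refl n j c) k =
        simple_refl n j c k - (\<Sum>k\<in>idx n. cartan n i k * simple_refl n j c k) * simple_root i k"
      by (subst simple_refl_def) simp
    moreover have "simple_refl n j (simple_refl n i c) k =
        simple_refl n i c k - (\<Sum>k\<in>idx n. cartan n j k * simple_refl n i c k) * simple_root j k"
      by (subst simple_refl_def) simp
    ultimately show "simple_refl n i (simple_refl n j c) k = simple_refl n j (simple_refl n i c) k"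
      using assms * by (simp add: simple_refl_def)
  qed
qed

lemma cartan_sym: "cartan n i j = cartan n j i"
  by (auto simp: cartan_def dynkin_edge_def)

lemma rlist_pair:
  "root_list n (a @ i # j # b) = root_list n a @ word_elt n a (simple_root i) #
     word_elt n a (simple_refl n i (simple_root j)) # map (\<lambda>c. word_elt n a (simple_refl n i (simple_refl n j c))) (root_list n b)"
  by (simp add: rlist_append rlist_Cons)

text \<open>Commuting reflections fix each other's simple root: the two roots trade places and all
  others stay.\<close>

lemma rlist_swap:
  assumes "i \<in> idx n" "j \<in> idx n" "cartan n i j = 0" "root_list n (a @ i # j # b) = P @ r # r' # Q" "length P = length a"
  shows "root_list n (a @ j # i # b) = P @ r' # r # Q"
proof -
  have s: "simple_refl n i (simple_root j) = simple_root j" "simple_refl n j (simple_root i) = simple_root i"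
    using assms cartan_sym[of n i j] by (simp_all add: simple_refl_simple_root)
  have "root_list n (a @ i # j # b) = root_list n a @ word_elt n a (simple_root i) # word_elt n a (simple_root j) #
      map (\<lambda>c. word_elt n a (simple_refl n i (simple_refl n j c))) (root_list n b)"
    by (simp add: rlist_pair s)
  then have "P = root_list n a" "r = word_elt n a (simple_root i)" "r' = word_elt n a (simple_root j)"
    "Q = map (\<lambda>c. word_elt n a (simple_refl n i (simple_refl n j c))) (root_list n b)"
    using assms(4,5) by auto
  then show ?thesis
    using simple_refl_comm[OF assms(1,2,3)] assms(3) cartan_sym[of n i j] by (simp add: rlist_pair s)
qed

section \<open>The roots of the twisted word as points\<close>

context twisted
begin

abbreviation E :: "(nat \<Rightarrow> int) \<Rightarrow> (nat \<Rightarrow> int)" where "E \<equiv> eps_coords n sign_last"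

definition evp :: "nat \<times> nat \<Rightarrow> nat \<Rightarrow> int" where "evp q = ev (v (fst q)) (v (snd q))"

text \<open>Defined from coordinates and not from a position in a word, so that a point names the
  same root for all words of the class.\<close>

definition root :: "nat \<times> nat \<Rightarrow> nat \<Rightarrow> int" where "root q = inv_into (root_lattice n) E (evp q)"

lemma E_inj: "inj_on E (root_lattice n)"
  using eps_coords_eqD[OF n3 sign_last(1)] by (auto simp: inj_on_def)

lemma root_eqI: "c \<in> root_lattice n \<Longrightarrow> E c = evp q \<Longrightarrow> root q = c"
  unfolding root_def using inv_into_f_f[OF E_inj] by metis

text \<open>The position of letter \<open>i\<close> in block \<open>k\<close>, counted from 0; each
  further block shifts both ends by one place.\<close>

definition point :: "nat \<Rightarrow> nat \<Rightarrow> nat \<times> nat" where "point k i = (X i + k, X i + i + k)"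

definition block :: "nat \<Rightarrow> nat list" where "block k = map (vee n ^^ k) js"

definition pl0 :: "nat \<Rightarrow> (nat \<times> nat) list" where "pl0 m = concat (map (\<lambda>k. map (point k) jn) [0..<m])"

lemma block_idx: "set (block k) \<subseteq> idx n"
  using js_idx n3 vee_idx by (auto simp: block_def)

lemma E_rlist_block: "map E (root_list n (block k)) = map (\<lambda>i. neg_last_pow n k (ev (left_label i) (right_label i))) jn"
proof (rule nth_equalityI)
  fix p assume "p < length (map E (root_list n (block k)))"
  then have p: "p < n" by (simp add: block_def len_js)
  define j where "j = js ! p"
  have j: "j \<in> set js" using p len_js by (simp add: j_def)
  have ok: "j \<in> idx n" "j = n \<longrightarrow> sign_last = 1" "j = n + 1 \<longrightarrow> sign_last = - 1" using j js_idx sign_last by auto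
  have jn_p: "jn ! p = orbit_rep n j" using p len_js by (simp add: jn_def j_def)
  have pre: "pre (jn ! p) = map (orbit_rep n) (take p js)"
    using pre_split[of "take p jn" "jn ! p" "drop (Suc p) jn"] id_take_nth_drop[of p jn] p len_js
    by (simp add: jn_def take_map)
  note pre = pre[unfolded jn_p]
  have V: "simple_root ((vee n ^^ k) j) \<in> root_lattice n" using ok(1) n3 vee_idx simple_root_V by simp
  have T: "set (take p js) \<subseteq> set js" by (rule set_take_subset)
  have "E (root_list n (block k) ! p) = E (word_elt n (map (vee n ^^ k) (take p js)) (simple_root ((vee n ^^ k) j)))"
    using p len_js by (simp add: root_list_def block_def word_root_def take_map j_def)
  also have "\<dots> = neg_last_pow n k (foldr swap_coords (map (orbit_rep n) (take p js)) (ev (int (orbit_rep n j)) (int (orbit_rep n j) + 1)))"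
    using T js_idx sign_last(2,3)
    by (subst eps_block[OF n3 V]) (auto simp: eps_refl_vee(2)[OF n3 simple_root_V[OF ok(1)] ok])
  also have "\<dots> = neg_last_pow n k (ev (left_label (jn ! p)) (right_label (jn ! p)))"
    unfolding left_label_def right_label_def jn_p pre
    by (subst foldr_swap_coords_ev) (use T no0 in \<open>auto simp: jn_def\<close>)
  finally show "map E (root_list n (block k)) ! p = map (\<lambda>i. neg_last_pow n k (ev (left_label i) (right_label i))) jn ! p"
    using p len_js by (simp add: block_def jn_def)
qed (simp add: block_def jn_def)

definition Phi :: "(nat \<Rightarrow> int) \<Rightarrow> (nat \<Rightarrow> int)" where "Phi w = foldr swap_coords jn (neg_last n w)"

lemma Phi_ev: "(Phi ^^ m) (ev a b) = ev ((phi ^^ m) a) ((phi ^^ m) b)"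
  by (induction m) (simp_all add: Phi_def neg_last_ev foldr_swap_coords_ev no0 phi_def)

text \<open>Block \<open>k\<close> is block 0 conjugated by the \<open>k\<close>-th power of the
  sign change, so a product of \<open>m\<close> blocks telescopes to \<open>Phi ^^ m\<close> after
  the \<open>m\<close>-th power of the sign change.\<close>

lemma E_blocks: "c \<in> root_lattice n \<Longrightarrow> E (word_elt n (concat (map block [0..<m])) c) = (Phi ^^ m) (neg_last_pow n m (E c))"
proof (induction m arbitrary: c)
  case 0
  then show ?case by (simp add: neg_last_pow_def)
next
  case (Suc m)
  have V: "word_elt n (block m) c \<in> root_lattice n" using block_idx Suc.prems by (rule word_elt_V)
  have "E (word_elt n (block m) c) = neg_last_pow n m (foldr swap_coords jn (neg_last_pow n m (E c)))"
    unfolding block_def jn_def by (rule eps_block[OF n3 Suc.prems js_idx]) (use sign_last in auto)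
  moreover have "Phi (neg_last_pow n (Suc m) (E c)) = foldr swap_coords jn (neg_last_pow n m (E c))" by (simp add: Phi_def neg_last_pow_def)
  ultimately show ?case
    using Suc.IH[OF V] by (simp add: word_elt_append funpow_swap1)
qed

lemma E_rlist: "map E (root_list n (concat (map block [0..<m]))) = map evp (pl0 m)"
proof (induction m)
  case (Suc m)
  let ?W = "concat (map block [0..<m])"
  have "map E (map (word_elt n ?W) (root_list n (block m))) = map (\<lambda>w. (Phi ^^ m) (neg_last_pow n m w)) (map E (root_list n (block m)))"
    using rlist_V[OF block_idx, of m] by (auto intro!: E_blocks)
  also have "\<dots> = map evp (map (point m) jn)"
  proof -
    have "evp (point m i) = ev ((phi ^^ m) (left_label i)) ((phi ^^ m) (right_label i))" if "i \<in> set jn" for i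
    proof -
      have "v (X i) = left_label i" "v (X i + i) = right_label i" using that v_L v_R by (auto simp: jn_set)
      then show ?thesis using v_add[of m "X i"] v_add[of m "X i + i"] by (simp add: evp_def point_def ac_simps)
    qed
    then show ?thesis unfolding E_rlist_block by (simp add: Phi_ev)
  qed
  finally show ?case using Suc.IH by (simp add: rlist_append pl0_def)
qed (simp add: pl0_def)

definition u0 :: "nat list" where "u0 = twisted_word n js"

lemma u0_eq: "u0 = concat (map block [0..<n + 1])"
  by (simp add: u0_def twisted_word_def block_def cong: map_cong)

lemma u0_idx: "set u0 \<subseteq> idx n"
  using block_idx by (auto simp: u0_eq)

lemma root_pl0: "map root (pl0 h) = root_list n u0"
  and evp_pl0: "q \<in> set (pl0 h) \<Longrightarrow> root q \<in> root_lattice n \<and> E (root q) = evp q"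
proof -
  have eq: "map E (root_list n u0) = map evp (pl0 h)" using E_rlist[of h] by (simp only: u0_eq)
  have len: "length (root_list n u0) = length (pl0 h)" using arg_cong[OF eq, of length] by simp
  have r: "root (pl0 h ! k) = root_list n u0 ! k \<and> root_list n u0 ! k \<in> root_lattice n \<and> E (root_list n u0 ! k) = evp (pl0 h ! k)"
    if "k < length (pl0 h)" for k
  proof -
    have "E (root_list n u0 ! k) = evp (pl0 h ! k)" using arg_cong[OF eq, of "\<lambda>l. l ! k"] that len by simp
    moreover have "root_list n u0 ! k \<in> root_lattice n" using rlist_V[OF u0_idx] that len by (metis nth_mem subsetD)
    ultimately show ?thesis using root_eqI by blast
  qed
  show "map root (pl0 h) = root_list n u0" by (rule nth_equalityI) (use r len in auto)
  show "root q \<in> root_lattice n \<and> E (root q) = evp q" if "q \<in> set (pl0 h)" using that r by (metis in_set_conv_nth)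
qed

lemma set_pl0: "set (pl0 h) = R"
proof -
  have "set (pl0 h) = (\<Union>k\<in>{0..<h}. point k ` {1..n})"
    unfolding pl0_def set_concat set_map set_upt image_image jn_set ..
  also have "\<dots> = {point k i |k i. k \<le> n \<and> 1 \<le> i \<and> i \<le> n}"
    by (auto simp: less_Suc_eq_le simp del: atLeastLessThan_iff) (fastforce simp: less_Suc_eq_le)+
  also have "\<dots> = R"
  proof (intro set_eqI iffI)
    fix q assume "q \<in> R"
    then obtain x i where q: "q = (x, x + i)" "1 \<le> i" "i \<le> n" "X i \<le> x" "x \<le> X i + n"
      by (metis R_E surj_pair)
    then have "q = point (x - X i) i" "x - X i \<le> n" by (auto simp: point_def)
    then show "q \<in> {point k i |k i. k \<le> n \<and> 1 \<le> i \<and> i \<le> n}" using q by blast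
  qed (auto simp: point_def R_def)
  finally show ?thesis .
qed

lemma root_V: "q \<in> R \<Longrightarrow> root q \<in> root_lattice n" and E_root: "q \<in> R \<Longrightarrow> E (root q) = evp q"
  using evp_pl0 set_pl0 by auto

section \<open>Words of the class as linear extensions of the slice\<close>

lemma chain_up: "a \<le> b \<Longrightarrow> 1 \<le> a \<Longrightarrow> b \<le> n \<Longrightarrow> a < b \<Longrightarrow> X a = X b \<Longrightarrow> bef a b"
proof (induction b rule: dec_induct)
  case (step b)
  have "X a = X b" "X b = X (b + 1)" using X_mono[of a b] X_mono[of b "b + 1"] step by auto
  moreover from this have "bef b (b + 1)" using X_step[of b] step by (auto split: if_splits)
  ultimately show ?case using step bef_trans[of a b "b + 1"] by (cases "a = b") (auto simp: jn_set)
qed simp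

lemma chain_down: "a \<le> b \<Longrightarrow> 1 \<le> a \<Longrightarrow> b \<le> n \<Longrightarrow> a < b \<Longrightarrow> X a + a = X b + b \<Longrightarrow> bef b a"
proof (induction b rule: dec_induct)
  case (step b)
  have "X a + a = X b + b" "X b = X (b + 1) + 1" using X_mono[of a b] X_mono[of b "b + 1"] step by auto
  moreover from this have "\<not> bef b (b + 1)" using X_step[of b] step by (auto split: if_splits)
  then have "bef (b + 1) b" using step bef_total[of b "b + 1"] by (simp add: jn_set)
  ultimately show ?case using step bef_trans[of "b + 1" b a] by (cases "a = b") (auto simp: jn_set)
qed simp

text \<open>By \<open>X_mono\<close>, two comparable points of one block share an end;
  \<open>chain_up\<close> and \<open>chain_down\<close> then give the order of their
  letters.\<close>

lemma pl0_sorted: "sorted_wrt (\<lambda>q q'. \<not> pt_le q' q) (pl0 m)"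
proof (induction m)
  case (Suc m)
  have "sorted_wrt (\<lambda>q q'. \<not> pt_le q' q) (map (point m) jn)"
    unfolding sorted_wrt_iff_nth_less
  proof (intro allI impI)
    fix p q assume pq: "p < q" "q < length (map (point m) jn)"
    define i j where "i = jn ! p" and "j = jn ! q"
    have ij: "i \<in> set jn" "j \<in> set jn" using pq by (auto simp: i_def j_def)
    have "i \<noteq> j" using jn_distinct pq by (simp add: i_def j_def nth_eq_iff_index_eq)
    have "pre j = take q jn"
      using pre_split[of "take q jn" j "drop (Suc q) jn"] id_take_nth_drop[of q jn] pq by (simp add: j_def)
    then have "bef i j" using pq by (auto simp: bef_def i_def in_set_conv_nth intro!: exI[of _ p])
    then have nb: "\<not> bef j i" using bef_asym ij by blast
    show "\<not> pt_le (map (point m) jn ! q) (map (point m) jn ! p)"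
    proof
      assume "pt_le (map (point m) jn ! q) (map (point m) jn ! p)"
      then have le: "X j \<le> X i" "X j + j \<le> X i + i" using pq by (simp_all add: i_def j_def point_def)
      show False
      proof (cases "i < j")
        case True
        then show ?thesis using chain_down[of i j] X_mono[of i j] nb ij le by (auto simp: jn_set)
      next
        case False
        then show ?thesis using chain_up[of j i] X_mono[of j i] nb ij le \<open>i \<noteq> j\<close> by (auto simp: jn_set)
      qed
    qed
  qed
  moreover have "\<not> pt_le (point m j) (point k i)" if "k < m" "i \<in> set jn" "j \<in> set jn" for k i j
    using that X_mono[of i j] X_mono[of j i] by (cases "i \<le> j") (auto simp: point_def jn_set)
  ultimately show ?case using Suc.IH by (auto simp: pl0_def sorted_wrt_append)
qed (simp add: pl0_def)

lemma v_abs_range: "1 \<le> \<bar>v x\<bar> \<and> \<bar>v x\<bar> \<le> int n + 1"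
  using v_range[of "x mod h"] v_abs by simp

lemma form_root: "q \<in> R \<Longrightarrow> q' \<in> R \<Longrightarrow> form n (root q) (root q') = dot n (evp q) (evp q')"
  by (simp add: form_kappa[OF sign_last(1), symmetric] E_root)

lemma sgn_eps: "sgn a * eps b (nat \<bar>a\<bar>) = of_bool (a = b) - of_bool (a = - b)" if "a \<noteq> 0"
  using that by (auto simp: eps_def sgn_if)

lemma dot_evp:
  "dot n (evp (x, y)) (evp (x', y')) =
    (of_bool (v x = v x') - of_bool (v x = - v x')) - (of_bool (v x = v y') - of_bool (v x = - v y'))
    - (of_bool (v y = v x') - of_bool (v y = - v x')) + (of_bool (v y = v y') - of_bool (v y = - v y'))"
proof -
  have nz: "v x \<noteq> 0" "v y \<noteq> 0" using v_abs_range[of x] v_abs_range[of y] by auto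
  show ?thesis
    using v_abs_range[of x] v_abs_range[of y] sgn_eps[OF nz(1)] sgn_eps[OF nz(2)]
    by (simp add: evp_def dot_ev ev_eps algebra_simps)
qed

lemma v_window_neq: "x < y \<Longrightarrow> y < x + h \<Longrightarrow> v x \<noteq> v y \<and> v x \<noteq> - v y \<and> v y \<noteq> v x \<and> v y \<noteq> - v x"
  using v_window[of x y] by auto

text \<open>Incomparable points are strictly nested intervals: their four ends are distinct places
  less than a period apart and carry labels of distinct absolute value.\<close>

lemma form_incomparable:
  assumes "q \<in> R" "q' \<in> R" "\<not> pt_le q q'" "\<not> pt_le q' q"
  shows "form n (root q) (root q') = 0"
proof -
  obtain x y x' y' where q: "q = (x, y)" "q' = (x', y')" by (metis surj_pair)
  have l: "x < y" "y < x + h" "x' < y'" "y' < x' + h" using R_len assms q by auto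
  have "v x \<noteq> v x' \<and> v x \<noteq> - v x' \<and> v x \<noteq> v y' \<and> v x \<noteq> - v y' \<and>
    v y \<noteq> v x' \<and> v y \<noteq> - v x' \<and> v y \<noteq> v y' \<and> v y \<noteq> - v y'"
  proof (cases "x < x'")
    case True
    then have "y' < y" using assms q by auto
    then show ?thesis
      using True l v_window_neq[of x x'] v_window_neq[of x y'] v_window_neq[of x' y] v_window_neq[of y' y] by simp
  next
    case False
    then have "x' < x" "y < y'" using assms q by auto
    then show ?thesis
      using l v_window_neq[of x' x] v_window_neq[of x' y] v_window_neq[of x y'] v_window_neq[of y y'] by simp
  qed
  then show ?thesis using form_root[OF assms(1,2)] by (simp add: q dot_evp)
qed

lemma form_cover:
  assumes "(x, y) \<in> R" "q' \<in> R" "q' = (x + 1, y) \<or> q' = (x, y + 1)"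
  shows "form n (root (x, y)) (root q') = 1"
proof -
  have l: "x < y" "y < x + h" using R_len assms by auto
  have nz: "v x \<noteq> 0" "v y \<noteq> 0" using v_abs_range[of x] v_abs_range[of y] by auto
  from assms(3) show ?thesis
  proof
    assume q': "q' = (x + 1, y)"
    then have "x + 1 < y" using R_len assms(2) by blast
    then show ?thesis
      using nz l v_window_neq[of x "x + 1"] v_window_neq[of x y] v_window_neq[of "x + 1" y] form_root[OF assms(1,2)]
      by (simp add: q' dot_evp)
  next
    assume q': "q' = (x, y + 1)"
    then have "y + 1 < x + h" using R_len assms(2) by blast
    then show ?thesis
      using nz l v_window_neq[of x "y + 1"] v_window_neq[of x y] v_window_neq[of y "y + 1"] form_root[OF assms(1,2)]
      by (simp add: q' dot_evp)
  qed
qed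

lemma v_eqD: "v x = v x' \<Longrightarrow> x \<le> 2 * n + 1 \<Longrightarrow> x' \<le> 2 * n + 1 \<Longrightarrow> x = x'"
proof (induction x x' rule: linorder_wlog)
  case (le x x')
  show ?case
  proof (rule ccontr)
    assume "x \<noteq> x'"
    then have "x + h \<le> x'" using v_window_neq[of x x'] le by (meson le_neq_implies_less not_less)
    then obtain z where z: "x' = z + h" "x \<le> z" by (metis add_le_cancel_right le_add_diff_inverse2 le_trans le_add2)
    have vz: "v z = - v x" using v_h[of z] z le by simp
    have "x \<noteq> z" using vz v_abs_range[of x] by auto
    then show False using vz v_window_neq[of x z] z le by auto
  qed
qed (metis)

lemma v_neg_eqD:
  assumes "v x = - v y" "x \<le> 2 * n + 1" "y \<le> 2 * n + 1"
  shows "x = y + h \<or> y = x + h"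
proof (cases "y \<le> n")
  case True
  then show ?thesis using v_eqD[of x "y + h"] v_h[of y] assms by simp
next
  case False
  then obtain z where z: "y = z + h" by (metis add.commute le_Suc_ex not_less_eq_eq Suc_eq_plus1)
  then show ?thesis using v_eqD[of x z] v_h[of z] assms by simp
qed

text \<open>A root has product 2 with itself, so equal vectors have labels agreeing in order or
  crosswise with opposite signs; intervals shorter than \<open>h\<close> exclude the latter.\<close>

lemma root_inj: "inj_on root R"
proof (rule inj_onI)
  fix q q' assume qq: "q \<in> R" "q' \<in> R" "root q = root q'"
  obtain x y x' y' where q: "q = (x, y)" "q' = (x', y')" by (metis surj_pair)
  have l: "x < y" "y < x + h" "x' < y'" "y' < x' + h" "y \<le> 2 * n" "y' \<le> 2 * n"
    using R_len R_bound qq q by auto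
  have eq: "evp (x, y) = evp (x', y')" using E_root[OF qq(1)] E_root[OF qq(2)] qq(3) q by simp
  have nz: "v x \<noteq> 0" "v y \<noteq> 0" "v x' \<noteq> 0" "v y' \<noteq> 0"
    using v_abs_range[of x] v_abs_range[of y] v_abs_range[of x'] v_abs_range[of y'] by auto
  have "dot n (evp (x, y)) (evp (x, y)) = dot n (evp (x, y)) (evp (x', y'))" by (simp add: eq)
  then have "(v x = v x' \<and> v y = v y') \<or> (v x = - v y' \<and> v y = - v x')"
    using nz v_window_neq[of x y] v_window_neq[of x' y'] l unfolding dot_evp by (auto split: if_splits simp: of_bool_def)
  then show "q = q'"
  proof
    assume "v x = v x' \<and> v y = v y'"
    then show ?thesis using v_eqD[of x x'] v_eqD[of y y'] l by (simp add: q)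
  next
    assume "v x = - v y' \<and> v y = - v x'"
    then show ?thesis using v_neg_eqD[of x y'] v_neg_eqD[of y x'] l by auto
  qed
qed

definition Inv :: "(nat \<times> nat) list \<Rightarrow> bool" where
  "Inv l \<longleftrightarrow> distinct l \<and> set l = R \<and> sorted_wrt (\<lambda>q q'. \<not> pt_le q' q) l"

lemma Inv_pl0: "Inv (pl0 h)"
proof -
  have "distinct (pl0 h)"
    unfolding distinct_conv_nth
  proof (intro allI impI)
    fix i j assume "i < length (pl0 h)" "j < length (pl0 h)" "i \<noteq> j"
    then show "pl0 h ! i \<noteq> pl0 h ! j"
      using pl0_sorted[of h] unfolding sorted_wrt_iff_nth_less by (metis linorder_neqE_nat order_refl)
  qed
  then show ?thesis using pl0_sorted set_pl0 by (simp add: Inv_def)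
qed

text \<open>Comparable neighbours in a linear extension form a covering pair, which is never orthogonal.\<close>
lemma Inv_adjacent:
  assumes "Inv (A @ q # q' # B)" "form n (root q) (root q') = 0"
  shows "\<not> pt_le q q'"
proof
  assume le: "pt_le q q'"
  obtain x y x' y' where q: "q = (x, y)" "q' = (x', y')" by (metis surj_pair)
  have R: "(x, y) \<in> R" "(x', y') \<in> R" "(x, y) \<noteq> (x', y')" "x \<le> x'" "y \<le> y'"
    using assms(1) le by (auto simp: Inv_def q)
  have l: "x < y" "y < x + h" "x' < y'" "y' < x' + h" using R_len R by auto
  \<comment> \<open>A point between \<open>q\<close> and \<open>q'\<close> would have to stand
    between these neighbours in the list.\<close>
  have gap: "z = q \<or> z = q'" if "z \<in> R" "pt_le q z" "pt_le z q'" for z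
    using that assms(1) by (fastforce simp: Inv_def sorted_wrt_append)
  have coverage: "\<not> (q' = (x + 1, y) \<or> q' = (x, y + 1))"
    using form_cover[of x y q'] R assms(2) q by auto
  consider "x < x'" "x + 1 < y" | "x < x'" "y = x + 1" | "x = x'" "y < y'" using R l by fastforce
  then show False
  proof cases
    case 1
    then have "(x + 1, y) \<in> R" using R l by (intro R_convex[OF R(1,2)]) auto
    then show False using gap[of "(x + 1, y)"] coverage 1 R q by auto
  next
    \<comment> \<open>An interval of length 1 cannot be shortened on the left, so it is lengthened
      on the right, which \<open>h > 2\<close> allows.\<close>
    case 2
    then have "(x, y + 1) \<in> R" using R l n3 by (intro R_convex[OF R(1,2)]) auto
    then show False using gap[of "(x, y + 1)"] coverage 2 R q l by auto
  next
    case 3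
    then have "(x, y + 1) \<in> R" using R l by (intro R_convex[OF R(1,2)]) auto
    then show False using gap[of "(x, y + 1)"] coverage 3 R q by auto
  qed
qed

lemma Inv_swap: "Inv (A @ q # q' # B) \<Longrightarrow> \<not> pt_le q q' \<Longrightarrow> Inv (A @ q' # q # B)"
  by (auto simp: Inv_def sorted_wrt_append)

text \<open>Commuting letters have orthogonal roots, hence incomparable points by
  \<open>Inv_adjacent\<close>, and swapping these keeps a linear extension.\<close>

lemma class_Inv:
  assumes "u \<in> comm_class n u0"
  shows "set u \<subseteq> idx n \<and> (\<exists>l. map root l = root_list n u \<and> Inv l)"
proof -
  have "(comm_step n)\<^sup>*\<^sup>* u0 u" using assms by (simp add: comm_class_def)
  then show ?thesis
  proof (induction rule: rtranclp_induct)
    case base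
    then show ?case using u0_idx root_pl0 Inv_pl0 by blast
  next
    case (step u w)
    then obtain l where l: "map root l = root_list n u" "Inv l" and u: "set u \<subseteq> idx n" by blast
    obtain a b i j where ab: "u = a @ i # j # b" "w = a @ j # i # b" "i \<noteq> j" "\<not> dynkin_edge n i j"
      using step(2) by (auto simp: comm_step_def)
    have idx: "i \<in> idx n" "j \<in> idx n" "set a \<subseteq> idx n" "set b \<subseteq> idx n" using u by (auto simp: ab)
    have c0: "cartan n i j = 0" using ab by (simp add: cartan_def)
    have "map root l = root_list n a @ word_elt n a (simple_root i) #
     word_elt n a (simple_refl n i (simple_root j)) # map (\<lambda>c. word_elt n a (simple_refl n i (simple_refl n j c))) (root_list n b)"
      by (simp add: l(1) ab(1) rlist_pair)
    then obtain A q q' B where lq: "l = A @ q # q' # B" "length A = length a"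
      "root q = word_elt n a (simple_root i)" "root q' = word_elt n a (simple_refl n i (simple_root j))"
      by (auto simp: map_eq_append_conv map_eq_Cons_conv dest: arg_cong[of _ _ length])
    have "form n (root q) (root q') = 0" using form_adjacent[OF n3 idx(1-3)] c0 lq by simp
    then have "Inv (A @ q' # q # B)" using Inv_adjacent Inv_swap l(2) lq(1) by blast
    moreover have "root_list n (a @ i # j # b) = map root A @ root q # root q' # map root B"
      using l(1) lq(1) ab(1) by simp
    then have "map root (A @ q' # q # B) = root_list n w"
      using rlist_swap[OF idx(1,2) c0] lq(2) ab(2) by simp
    moreover have "set w \<subseteq> idx n" using idx by (auto simp: ab(2))
    ultimately show ?case by blast
  qed
qed

definition S :: "(nat \<times> nat) list set" where
  "S = {l. set l \<subseteq> R \<and> (\<exists>u\<in>comm_class n u0. map root l = root_list n u)}"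

lemma S_Inv: "l \<in> S \<Longrightarrow> Inv l"
proof -
  assume "l \<in> S"
  then obtain u where u: "u \<in> comm_class n u0" "map root l = root_list n u" "set l \<subseteq> R" by (auto simp: S_def)
  then obtain l' where l': "map root l' = root_list n u" "Inv l'" using class_Inv by blast
  have "inj_on root (set l \<union> set l')" using u l' root_inj by (auto simp: Inv_def intro: inj_on_subset)
  then have "l = l'" using inj_on_map_eq_map[of root l l'] u(2) l'(1) by metis
  then show ?thesis using l' by simp
qed

text \<open>The other direction: incomparable neighbours have orthogonal roots, so their letters
  commute and the swapped list stays in the class.\<close>

lemma S_swap: "A @ q # q' # B \<in> S \<Longrightarrow> \<not> pt_le q q' \<Longrightarrow> A @ q' # q # B \<in> S"
proof -
  assume a: "A @ q # q' # B \<in> S" "\<not> pt_le q q'"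
  then obtain u where u: "u \<in> comm_class n u0" "root_list n u = map root A @ root q # root q' # map root B"
    and R: "set (A @ q # q' # B) \<subseteq> R" by (auto simp: S_def)
  have ui: "set u \<subseteq> idx n" using class_Inv u by blast
  have len: "length u = length A + Suc (Suc (length B))" using arg_cong[OF u(2), of length] by simp
  define a where "a = take (length A) u"
  have "length (drop (length A) u) = Suc (Suc (length B))" using len by simp
  then obtain i j b where b: "drop (length A) u = i # j # b" by (metis length_Suc_conv)
  have uab: "u = a @ i # j # b" "length a = length A" using b len by (auto simp: a_def) (metis append_take_drop_id)
  have idx: "i \<in> idx n" "j \<in> idx n" "set a \<subseteq> idx n" using ui by (auto simp: uab)
  have rq: "root q = word_elt n a (simple_root i)" "root q' = word_elt n a (simple_refl n i (simple_root j))"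
    using u(2) uab(2) by (auto simp: uab(1) rlist_pair append_eq_append_conv)
  have "\<not> pt_le q' q" using S_Inv[OF a(1)] by (auto simp: Inv_def sorted_wrt_append)
  then have "form n (root q) (root q') = 0" using form_incomparable a(2) R by simp
  then have c0: "cartan n i j = 0" using form_adjacent[OF n3 idx] rq by simp
  then have "i \<noteq> j" "\<not> dynkin_edge n i j" by (auto simp: cartan_def split: if_splits)
  then have "comm_step n u (a @ j # i # b)" by (auto simp: comm_step_def uab(1))
  then have "a @ j # i # b \<in> comm_class n u0" using u(1) by (auto simp: comm_class_def intro: rtranclp.rtrancl_into_rtrancl)
  moreover have "map root (A @ q' # q # B) = root_list n (a @ j # i # b)"
    using rlist_swap[OF idx(1,2) c0, of a b] u(2) uab by simp
  ultimately show ?thesis using R by (auto simp: S_def)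
qed

sublocale strip_class n h X S
proof
  show "S \<noteq> {}" using root_pl0 set_pl0 by (auto simp: S_def comm_class_def)
  show "\<exists>\<chi>::nat \<Rightarrow> int. (\<forall>x. \<chi> (x + h) = - \<chi> x) \<and> (\<forall>(x, y)\<in>R. \<chi> y < \<chi> x)"
    by (rule positive_functional)
qed (use S_Inv S_swap in \<open>auto simp: Inv_def\<close>)

end

section \<open>Distances, radii and socles\<close>

lemma bilex_list_mono:
  assumes "length l = length l'"
    and "\<And>t. t < length l \<Longrightarrow> count M (l ! t) = count N (l' ! t) \<and> count M' (l ! t) = count N' (l' ! t)"
    and "bilex_list l M M'"
  shows "bilex_list l' N N'"
proof -
  obtain k s where "k \<le> s" "s < length l" "\<And>t. t < k \<Longrightarrow> count M (l ! t) = count M' (l ! t)"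
    "\<And>t. s < t \<Longrightarrow> t < length l \<Longrightarrow> count M (l ! t) = count M' (l ! t)"
    "count M (l ! k) < count M' (l ! k)" "count M (l ! s) < count M' (l ! s)"
    using assms(3) by (auto simp: bilex_list_def)
  then show ?thesis
    unfolding bilex_list_def using assms(1,2) by (intro exI[of _ k] exI[of _ s]) simp
qed

lemma bilex_rlist: "bilex n u m m' \<longleftrightarrow> bilex_list (root_list n u) m m'"
proof -
  have "map (word_root n u) [0..<length u] ! t = word_root n u t" if "t < length u" for t
    using that by simp
  then show ?thesis
    unfolding bilex_def bilex_list_def length_rlist
    by (intro ex_cong1 conj_cong refl) (auto simp: root_list_def)
qed

lemma eps_add: "eps_coords n \<kappa> (\<lambda>i. c i + c' i) k = eps_coords n \<kappa> c k + eps_coords n \<kappa> c' k"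
  by (simp add: eps_coords_def algebra_simps)

lemma wt_add: "wt (add_mset c m) = (\<lambda>i. c i + wt m i)"
  by (simp add: wt_def)

lemma sum_eps_prefix: "sum (eps (int p)) {Suc 0..k} = of_bool (p \<le> k)" if "1 \<le> p"
proof -
  have "sum (eps (int p)) {Suc 0..k} = (\<Sum>j\<in>{Suc 0..k}. if j = p then 1 else 0)"
    by (rule sum.cong) (use that in \<open>auto simp: eps_def\<close>)
  then show ?thesis using that by (simp add: sum.delta)
qed

section \<open>Transport of weights and of the order from points to roots\<close>

context twisted
begin

abbreviation C :: "nat list set" where "C \<equiv> comm_class n u0"
abbreviation I :: "(nat \<times> nat) multiset \<Rightarrow> (nat \<Rightarrow> int) multiset" where "I M \<equiv> image_mset root M"

lemma count_I: "set_mset M \<subseteq> R \<Longrightarrow> q \<in> R \<Longrightarrow> count (I M) (root q) = count M q"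
proof (induction M)
  case (add p M)
  then have "root p = root q \<longleftrightarrow> p = q" using root_inj by (simp add: inj_on_eq_iff)
  then show ?case using add by simp
qed simp

lemma bilex_list_map:
  assumes "set l \<subseteq> R" "set_mset M \<subseteq> R" "set_mset M' \<subseteq> R"
  shows "bilex_list (map root l) (I M) (I M') \<longleftrightarrow> bilex_list l M M'"
proof -
  have c: "count (I M) (map root l ! t) = count M (l ! t) \<and> count (I M') (map root l ! t) = count M' (l ! t)"
    if "t < length l" for t
  proof -
    have "l ! t \<in> R" using that assms(1) nth_mem by blast
    then show ?thesis using that assms(2,3) count_I by simp
  qed
  show ?thesis
  proof
    assume "bilex_list (map root l) (I M) (I M')"
    then show "bilex_list l M M'" by (rule bilex_list_mono[rotated 2]) (use c in auto)
  next
    assume "bilex_list l M M'"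
    then show "bilex_list (map root l) (I M) (I M')" by (rule bilex_list_mono[rotated 2]) (use c in auto)
  qed
qed

lemma bilex_class:
  assumes "set_mset M \<subseteq> R" "set_mset M' \<subseteq> R"
  shows "(\<forall>u\<in>C. bilex n u (I M) (I M')) \<longleftrightarrow> (\<forall>l\<in>S. bilex_list l M M')"
proof
  assume a: "\<forall>u\<in>C. bilex n u (I M) (I M')"
  show "\<forall>l\<in>S. bilex_list l M M'"
  proof
    fix l assume "l \<in> S"
    then obtain u where "u \<in> C" "map root l = root_list n u" "set l \<subseteq> R" by (auto simp: S_def)
    then show "bilex_list l M M'" using a bilex_list_map[of l M M'] assms by (simp add: bilex_rlist)
  qed
next
  assume a: "\<forall>l\<in>S. bilex_list l M M'"
  show "\<forall>u\<in>C. bilex n u (I M) (I M')"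
  proof
    fix u assume u: "u \<in> C"
    then obtain l where l: "map root l = root_list n u" "Inv l" using class_Inv by blast
    then have "set l \<subseteq> R" by (simp add: Inv_def)
    then have "l \<in> S" using u l by (auto simp: S_def)
    then show "bilex n u (I M) (I M')" using a bilex_list_map[of l M M'] assms l \<open>set l \<subseteq> R\<close> by (simp add: bilex_rlist)
  qed
qed

lemma wt_I: "set_mset M \<subseteq> R \<Longrightarrow> wt (I M) \<in> root_lattice n \<and> E (wt (I M)) k = (\<Sum>q\<in>#M. evp q k)"
proof (induction M)
  case empty
  then show ?case by (simp add: wt_def root_lattice_def eps_coords_def)
next
  case (add q M)
  then show ?case using root_V[of q] E_root[of q] by (simp add: wt_add eps_add root_lattice_def)
qed

text \<open>As \<open>v\<close> maps \<open>0..n\<close> onto all labels, each antiperiodic function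
  comes from a linear functional on coordinates; conversely each coordinate of the vectors
  \<open>eps (v x)\<close> is antiperiodic in \<open>x\<close>.\<close>

lemma wt_eq_iff:
  assumes "set_mset M \<subseteq> R" "set_mset M' \<subseteq> R"
  shows "wt (I M) = wt (I M') \<longleftrightarrow> same_weight h M M'"
proof
  assume eq: "wt (I M) = wt (I M')"
  show "same_weight h M M'"
    unfolding same_weight_def
  proof (intro allI impI)
    fix \<chi> :: "nat \<Rightarrow> int" assume \<chi>: "\<forall>x. \<chi> (x + h) = - \<chi> x"
    \<comment> \<open>The functional with value \<open>\<chi> x\<close> on the unit vector of the
      label \<open>v x\<close>.\<close>
    define f where "f w = (\<Sum>x\<in>{0..n}. \<chi> x * w (nat (v x)))" for w :: "nat \<Rightarrow> int"
    have f1: "f (eps (v y)) = \<chi> y" for y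
    proof (induction y rule: less_induct)
      case (less y)
      show ?case
      proof (cases "y \<le> n")
        case True
        have "eps (v y) (nat (v x)) = (if x = y then 1 else 0)" if "x \<in> {0..n}" for x
          using v_range[OF True] v_range[of x] that True inj_onD[OF v_inj, of x y] by (auto simp: eps_def)
        then have "f (eps (v y)) = (\<Sum>x\<in>{0..n}. if x = y then \<chi> y else 0)"
          unfolding f_def by (intro sum.cong) auto
        then show ?thesis using True by (simp add: sum.delta)
      next
        case False
        then obtain z where z: "y = z + h" using less_eqE not_less_eq_eq by (metis Suc_eq_plus1 add.commute)
        have "eps (v y) = (\<lambda>k. - eps (v z) k)" by (rule ext) (simp only: z v_h eps_minus)
        then have "f (eps (v y)) = - f (eps (v z))" by (simp add: f_def sum_negf)
        then show ?thesis using less.IH[of z] z \<chi> by simp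
      qed
    qed
    have f2: "f (\<lambda>k. \<Sum>q\<in>#N. evp q k) = (\<Sum>q\<in>#N. \<chi> (fst q) - \<chi> (snd q))" for N
    proof (induction N)
      case (add q N)
      have "f (\<lambda>k. evp q k + (\<Sum>q\<in>#N. evp q k)) = f (eps (v (fst q))) - f (eps (v (snd q))) + f (\<lambda>k. \<Sum>q\<in>#N. evp q k)"
        by (simp add: f_def evp_def ev_eps algebra_simps sum.distrib sum_subtractf)
      then show ?case using add.IH by (simp add: f1)
    qed (simp add: f_def)
    have "(\<lambda>k. \<Sum>q\<in>#M. evp q k) = (\<lambda>k. \<Sum>q\<in>#M'. evp q k)"
      using wt_I[OF assms(1)] wt_I[OF assms(2)] eq by simp
    then show "(\<Sum>q\<in>#M. \<chi> (fst q) - \<chi> (snd q)) = (\<Sum>q\<in>#M'. \<chi> (fst q) - \<chi> (snd q))"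
      using f2[of M] f2[of M'] by simp
  qed
next
  assume eq: "same_weight h M M'"
  have "(\<Sum>q\<in>#M. evp q k) = (\<Sum>q\<in>#M'. evp q k)" for k
  proof -
    have a: "eps (v (x + h)) k = - eps (v x) k" for x by (simp only: v_h eps_minus)
    show ?thesis
      using eq[unfolded same_weight_def, rule_format, of "\<lambda>x. eps (v x) k", OF a] by (simp add: evp_def ev_eps)
  qed
  then have "E (wt (I M)) = E (wt (I M'))" using wt_I[OF assms(1)] wt_I[OF assms(2)] by (intro ext) metis
  moreover have "wt (I M) \<in> root_lattice n" "wt (I M') \<in> root_lattice n" using wt_I assms by blast+
  ultimately show "wt (I M) = wt (I M')" using eps_coords_eqD[OF n3 sign_last(1)] by blast
qed

lemma prec_iff:
  "set_mset M \<subseteq> R \<Longrightarrow> set_mset M' \<subseteq> R \<Longrightarrow> prec n C (I M) (I M') \<longleftrightarrow> below M M'"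
  unfolding prec_def below_def using wt_eq_iff bilex_class by simp

section \<open>Coefficients, folded multiplicities and the positive roots\<close>

lemma coef_diff:
  assumes c: "c \<in> root_lattice n" and e: "E c = ev (int p) (int r)" and lb: "1 \<le> p" "1 \<le> r"
  shows "k \<le> n - 1 \<Longrightarrow> c k = of_bool (p \<le> k) - of_bool (r \<le> k)"
    and "c n + c (n + 1) = of_bool (p \<le> n) - of_bool (r \<le> n)"
    and "c (n + 1) - c n = sign_last * (of_bool (p = n + 1) - of_bool (r = n + 1))"
proof -
  show "c k = of_bool (p \<le> k) - of_bool (r \<le> k)" if "k \<le> n - 1"
    using coeffs_from_eps(1)[OF n3 sign_last(1) c that] lb by (simp add: e ev_eps sum_subtractf sum_eps_prefix)
  show "c n + c (n + 1) = of_bool (p \<le> n) - of_bool (r \<le> n)"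
    using coeffs_from_eps(2)[OF n3 sign_last(1) c, of 0] lb by (simp add: e ev_eps sum_subtractf sum_eps_prefix)
  show "c (n + 1) - c n = sign_last * (of_bool (p = n + 1) - of_bool (r = n + 1))"
    using coeffs_from_eps(3)[OF n3 sign_last(1) c, of 0] lb by (auto simp: e ev_eps eps_def)
qed

lemma coef_sum:
  assumes c: "c \<in> root_lattice n" and e: "E c = ev (int p) (- int r)" and lb: "1 \<le> p" "1 \<le> r"
  shows "k \<le> n - 1 \<Longrightarrow> c k = of_bool (p \<le> k) + of_bool (r \<le> k)"
    and "c n + c (n + 1) = of_bool (p \<le> n) + of_bool (r \<le> n)"
    and "c (n + 1) - c n = sign_last * (of_bool (p = n + 1) + of_bool (r = n + 1))"
proof -
  show "c k = of_bool (p \<le> k) + of_bool (r \<le> k)" if "k \<le> n - 1"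
    using coeffs_from_eps(1)[OF n3 sign_last(1) c that] lb by (simp add: e ev_eps eps_minus sum.distrib sum_eps_prefix)
  show "c n + c (n + 1) = of_bool (p \<le> n) + of_bool (r \<le> n)"
    using coeffs_from_eps(2)[OF n3 sign_last(1) c, of 0] lb by (simp add: e ev_eps eps_minus sum.distrib sum_eps_prefix)
  show "c (n + 1) - c n = sign_last * (of_bool (p = n + 1) + of_bool (r = n + 1))"
    using coeffs_from_eps(3)[OF n3 sign_last(1) c, of 0] lb by (auto simp: e ev_eps eps_def)
qed

lemma root_type:
  assumes "(x, y) \<in> R"
  obtains p r where "1 \<le> p" "p < r" "r \<le> n + 1" "evp (x, y) = ev (int p) (int r)" "\<not> (x < n \<and> n < y)"
  | p r where "1 \<le> p" "p \<le> n + 1" "1 \<le> r" "r \<le> n" "p \<noteq> r" "evp (x, y) = ev (int p) (- int r)"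
      "x < n \<and> n < y \<longleftrightarrow> p \<le> n"
  using assms
proof (cases rule: R_split)
  case 1
  then show ?thesis using v_range[of x] v_range[of y] that(1)[of "nat (v x)" "nat (v y)"] by (simp add: evp_def)
next
  case 2
  define z where "z = y - h"
  have z: "y = z + h" "z < x" using 2 by (auto simp: z_def)
  have ne: "v z \<noteq> v n" "v x \<noteq> v z" "x \<noteq> n \<Longrightarrow> v x \<noteq> v n"
    using z 2 inj_onD[OF v_inj, of z n] inj_onD[OF v_inj, of x z] inj_onD[OF v_inj, of x n] by auto
  have "x < n \<longleftrightarrow> v x \<le> int n" using ne v_n v_range[of x] 2 by (cases "x = n") auto
  then show ?thesis
    using v_range[of x] v_range[of z] ne v_n 2 z that(2)[of "nat (v x)" "nat (v z)"] v_h[of z]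
    by (auto simp: evp_def)
next
  case (3 x' y')
  have "evp (x, y) = ev (v y') (v x')" by (simp only: 3 evp_def fst_conv snd_conv v_h ev_neg)
  then show ?thesis using v_range[of x'] v_range[of y'] that(1)[of "nat (v y')" "nat (v x')"] 3 by simp
qed

lemma root_nonneg:
  assumes "q \<in> R" "j \<in> idx n"
  shows "0 \<le> root q j"
proof -
  obtain x y where q: "q = (x, y)" by (metis surj_pair)
  let ?c = "root q"
  have V: "?c \<in> root_lattice n" and e: "E ?c = evp (x, y)" using root_V E_root assms q by auto
  have "(\<forall>k\<le>n - 1. 0 \<le> ?c k) \<and> 0 \<le> ?c n \<and> 0 \<le> ?c (n + 1)"
    using assms(1)[unfolded q]
  proof (cases rule: root_type)
    case (1 p r)
    note c = coef_diff[OF V e[unfolded 1] 1(1)]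
    have "1 \<le> r" using 1 by simp
    then show ?thesis using c sign_last(1) 1 by (auto simp: of_bool_def split: if_splits)
  next
    case (2 p r)
    note c = coef_sum[OF V e[unfolded 2] 2(1,3)]
    then show ?thesis using sign_last(1) 2 by (auto simp: of_bool_def split: if_splits)
  qed
  moreover have "j \<le> n - 1 \<or> j = n \<or> j = n + 1" using assms(2) by (auto simp: idx_def)
  ultimately show ?thesis by auto
qed

text \<open>For a sum of two labels up to \<open>n\<close> the two fork coefficients add up to 2. If
  one label is \<open>n + 1\<close>, they add up to 1 and no other coefficient exceeds 1.\<close>

lemma folded_mult_root:
  assumes "(x, y) \<in> R"
  shows "folded_mult n (root (x, y)) = (if x < n \<and> n < y then 2 else 1)"
proof -
  let ?c = "root (x, y)"
  have V: "?c \<in> root_lattice n" and e: "E ?c = evp (x, y)" using root_V E_root assms by auto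
  have fm: "folded_mult n ?c = m"
    if "\<And>k. 1 \<le> k \<Longrightarrow> k \<le> n - 1 \<Longrightarrow> ?c k \<le> m" "?c n + ?c (n + 1) \<le> m"
      "(\<exists>k. 1 \<le> k \<and> k \<le> n - 1 \<and> ?c k = m) \<or> ?c n + ?c (n + 1) = m" for m
    unfolding folded_mult_def by (rule Max_eqI) (use that in auto)
  from assms show ?thesis
  proof (cases rule: root_type)
    case (1 p r)
    have r: "1 \<le> r" using 1 by simp
    note c = coef_diff[OF V e[unfolded 1(4)] 1(1) r]
    have "folded_mult n ?c = 1"
    proof (rule fm)
      show "(\<exists>k. 1 \<le> k \<and> k \<le> n - 1 \<and> ?c k = 1) \<or> ?c n + ?c (n + 1) = 1"
      proof (cases "r = n + 1")
        case True then show ?thesis using c(2) 1 by simp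
      next
        case False
        then have "p \<le> n - 1" using 1 by simp
        then show ?thesis using c(1)[of p] 1 by (intro disjI1 exI[of _ p]) simp
      qed
    qed (use c in auto)
    then show ?thesis using 1(5) by simp
  next
    case (2 p r)
    note c = coef_sum[OF V e[unfolded 2(6)] 2(1,3)]
    have "folded_mult n ?c = (if p \<le> n then 2 else 1)"
      by (rule fm) (use c 2 in auto)
    then show ?thesis using 2(7) by simp
  qed
qed

lemma root_in_roots: "q \<in> R \<Longrightarrow> root q \<in> roots n"
proof -
  assume "q \<in> R"
  then have "root q \<in> set (root_list n u0)" using root_pl0 set_pl0 by (metis image_eqI set_map)
  then obtain k where k: "k < length u0" "root q = word_root n u0 k" by (auto simp: root_list_def)
  have "set (take k u0) \<subseteq> idx n" using set_take_subset u0_idx by (rule subset_trans)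
  moreover have "u0 ! k \<in> idx n" using u0_idx nth_mem[OF k(1)] by (rule subsetD)
  ultimately show ?thesis unfolding roots_def weyl_group_def k(2) word_root_def by blast
qed

definition valid :: "int \<Rightarrow> int \<Rightarrow> bool" where
  "valid a b \<longleftrightarrow> 1 \<le> \<bar>a\<bar> \<and> \<bar>a\<bar> \<le> int n + 1 \<and> 1 \<le> \<bar>b\<bar> \<and> \<bar>b\<bar> \<le> int n + 1 \<and> \<bar>a\<bar> \<noteq> \<bar>b\<bar>"

lemma valid_neg_last_label: "valid a b \<Longrightarrow> valid (neg_last_label n a) (neg_last_label n b)"
  by (auto simp: valid_def neg_last_label_def)

lemma valid_swap_labels: "valid a b \<Longrightarrow> 1 \<le> i \<Longrightarrow> i \<le> n \<Longrightarrow> valid (swap_labels i a) (swap_labels i b)"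
  by (auto simp: valid_def swap_labels_def split: if_splits)

lemma valid_step:
  assumes j: "j \<in> idx n"
  shows "\<exists>a b. valid a b \<and> E (simple_root j) = ev a b"
    and "c \<in> root_lattice n \<Longrightarrow> valid a b \<Longrightarrow> E c = ev a b \<Longrightarrow> \<exists>a b. valid a b \<and> E (simple_refl n j c) = ev a b"
proof -
  obtain \<kappa> :: int where k: "\<kappa> = 1 \<or> \<kappa> = - 1" "j = n \<longrightarrow> \<kappa> = 1" "j = n + 1 \<longrightarrow> \<kappa> = - 1" by (rule obtain_kappa)
  have orbit_rep: "1 \<le> orbit_rep n j" "orbit_rep n j \<le> n" using orbit_rep_range[OF n3 j] by auto
  have conv: "E c = eps_coords n \<kappa> c \<or> E c = neg_last n (eps_coords n \<kappa> c)" for c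
    using sign_last(1) k(1) eps_neg[of n \<kappa> c] by fastforce
  have conv': "eps_coords n \<kappa> c = E c \<or> eps_coords n \<kappa> c = neg_last n (E c)" for c using conv[of c] by auto
  have ex: "\<exists>a b. valid a b \<and> E c = ev a b" if "valid a b" "eps_coords n \<kappa> c = ev a b" for a b c
    using conv[of c] that valid_neg_last_label neg_last_ev by metis
  have "valid (int (orbit_rep n j)) (int (orbit_rep n j) + 1)" using orbit_rep by (simp add: valid_def)
  then show "\<exists>a b. valid a b \<and> E (simple_root j) = ev a b" using ex eps_simple_root[OF n3 j k(2,3)] by blast
  assume c: "c \<in> root_lattice n" "valid a b" "E c = ev a b"
  then obtain a' b' where "valid a' b'" "eps_coords n \<kappa> c = ev a' b'" using conv'[of c] valid_neg_last_label neg_last_ev by metis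
  then have "valid (swap_labels (orbit_rep n j) a') (swap_labels (orbit_rep n j) b')"
    "eps_coords n \<kappa> (simple_refl n j c) = ev (swap_labels (orbit_rep n j) a') (swap_labels (orbit_rep n j) b')"
    using valid_swap_labels orbit_rep eps_refl[OF n3 c(1) j k(2,3)] swap_coords_ev by simp_all
  then show "\<exists>a b. valid a b \<and> E (simple_refl n j c) = ev a b" using ex by blast
qed

lemma roots_ev: "c \<in> roots n \<Longrightarrow> c \<in> root_lattice n \<and> (\<exists>a b. valid a b \<and> E c = ev a b)"
proof -
  assume "c \<in> roots n"
  then obtain u i where u: "set u \<subseteq> idx n" "i \<in> idx n" "c = word_elt n u (simple_root i)"
    by (auto simp: roots_def weyl_group_def)
  have "word_elt n u (simple_root i) \<in> root_lattice n \<and> (\<exists>a b. valid a b \<and> E (word_elt n u (simple_root i)) = ev a b)"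
    using u(1)
  proof (induction u)
    case Nil
    then show ?case using simple_root_V valid_step(1) u(2) by simp
  next
    case (Cons j u)
    then show ?case using valid_step(2)[of j] simple_refl_V by fastforce
  qed
  then show ?thesis by (simp add: u)
qed

text \<open>For \<open>x < y \<le> n\<close> the difference of the labels occurs at
  \<open>(x, y)\<close> or, reversed, one period later, and their sum occurs at
  \<open>(y, x + h)\<close>.\<close>

lemma ev_in_R: "valid a b \<Longrightarrow> \<exists>q\<in>R. ev a b = evp q \<or> ev b a = evp q"
proof -
  have pair: "(\<exists>q\<in>R. ev (v x) (v y) = evp q \<or> ev (v y) (v x) = evp q) \<and> (\<exists>q\<in>R. ev (v x) (- v y) = evp q)"
    if "x < y" "y \<le> n" for x y
  proof
    have "v x \<noteq> v y" using v_window_neq[of x y] that by simp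
    then have "(x, y) \<in> R \<or> (x + h, y + h) \<in> R" using R_lo[of x y] R_hi[of x y] that by linarith
    moreover have "evp (x, y) = ev (v x) (v y)" "evp (x + h, y + h) = ev (v y) (v x)"
      by (simp_all only: evp_def fst_conv snd_conv v_h ev_neg)
    ultimately show "\<exists>q\<in>R. ev (v x) (v y) = evp q \<or> ev (v y) (v x) = evp q" by metis
    have "(y, x + h) \<in> R" using that by (intro R_mid) auto
    moreover have "evp (y, x + h) = ev (v x) (- v y)"
      using ev_neg[of "- v x" "v y"] by (simp only: evp_def fst_conv snd_conv v_h minus_minus)
    ultimately show "\<exists>q\<in>R. ev (v x) (- v y) = evp q" by metis
  qed
  assume val: "valid a b"
  have "\<bar>a\<bar> \<in> v ` {0..n}" "\<bar>b\<bar> \<in> v ` {0..n}" using val unfolding v_image by (auto simp: valid_def)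
  then obtain x y where xy: "\<bar>a\<bar> = v x" "x \<le> n" "\<bar>b\<bar> = v y" "y \<le> n" by auto
  have s: "a = v x \<or> a = - v x" "b = v y \<or> b = - v y" using xy by linarith+
  have "x \<noteq> y" using xy val by (auto simp: valid_def)
  then consider "x < y" | "y < x" by linarith
  then show ?thesis
  proof cases
    case 1
    from pair[OF 1 xy(4)] show ?thesis using s ev_neg[of "v x" "v y"] ev_neg[of "v y" "v x"]
        ev_neg[of "v x" "- v y"] ev_neg[of "v y" "- v x"] ev_neg[of "- v x" "v y"] by (elim disjE) auto
  next
    case 2
    from pair[OF 2 xy(2)] show ?thesis using s ev_neg[of "v x" "v y"] ev_neg[of "v y" "v x"]
        ev_neg[of "v x" "- v y"] ev_neg[of "v y" "- v x"] ev_neg[of "- v y" "v x"] by (elim disjE) auto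
  qed
qed

lemma pos_roots_eq: "pos_roots n = root ` R"
proof
  show "root ` R \<subseteq> pos_roots n" using root_in_roots root_nonneg by (auto simp: pos_roots_def)
  show "pos_roots n \<subseteq> root ` R"
  proof
    fix c assume c: "c \<in> pos_roots n"
    then have "c \<in> roots n" by (simp add: pos_roots_def)
    from roots_ev[OF this] obtain a b where ab: "c \<in> root_lattice n" "valid a b" "E c = ev a b" by blast
    from ev_in_R[OF ab(2)] obtain q where q: "q \<in> R" "E c = evp q \<or> ev b a = evp q" using ab(3) by metis
    from q(2) show "c \<in> root ` R"
    proof
      assume "E c = evp q"
      then show ?thesis using root_eqI[OF ab(1)] q(1) by blast
    next
      assume "ev b a = evp q"
      moreover have "E (\<lambda>k. - c k) = (\<lambda>k. - E c k)" by (rule ext) (simp add: eps_coords_def algebra_simps)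
      ultimately have "E (\<lambda>k. - c k) = evp q" using ab(3) ev_uminus[of b a] by (simp add: fun_eq_iff)
      moreover have "(\<lambda>k. - c k) \<in> root_lattice n" using ab(1) by (simp add: root_lattice_def)
      ultimately have "root q = (\<lambda>k. - c k)" by (rule root_eqI[rotated])
      \<comment> \<open>Both \<open>c\<close> and its negative are nonnegative, so \<open>c\<close>
        vanishes and equals \<open>root q\<close> after all.\<close>
      moreover have "0 \<le> root q k \<and> 0 \<le> c k" if "k \<in> idx n" for k
        using root_nonneg[OF q(1) that] c that by (simp add: pos_roots_def)
      ultimately have "c k = 0" for k using ab(1) by (cases "k \<in> idx n") (force simp: root_lattice_def)+
      then have "root q = c" using \<open>root q = (\<lambda>k. - c k)\<close> by (simp add: fun_eq_iff)
      then show ?thesis using q(1) by blast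
    qed
  qed
qed

lemma simple_root_diff:
  assumes "q \<in> R" "evp q = ev (int p) (int p + 1)" "1 \<le> p" "p \<le> n"
  shows "root q \<in> simple_roots n"
proof -
  define j where "j = (if p = n \<and> sign_last = - 1 then n + 1 else p)"
  have j: "j \<in> idx n" "j = n \<longrightarrow> sign_last = 1" "j = n + 1 \<longrightarrow> sign_last = - 1" "orbit_rep n j = p"
    using sign_last(1) assms(3,4) by (auto simp: j_def idx_def orbit_rep_def)
  have "root q = simple_root j"
    using eps_simple_root[OF n3 j(1-3)] assms(2) j(4) by (intro root_eqI simple_root_V j) simp
  then show ?thesis using j(1) by (simp add: simple_roots_def)
qed

text \<open>This is the simple root of whichever of \<open>n\<close>, \<open>n + 1\<close> does not
  occur in \<open>js\<close>: a plain difference for the opposite sign, which the sign change turns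
  into a sum.\<close>

lemma simple_root_sum:
  assumes "q \<in> R" "evp q = ev (int n) (- int n - 1)"
  shows "root q \<in> simple_roots n"
proof -
  define j where "j = (if sign_last = 1 then n + 1 else n)"
  have j: "j \<in> idx n" "j = n \<longrightarrow> - sign_last = 1" "j = n + 1 \<longrightarrow> - sign_last = - 1" "orbit_rep n j = n"
    using sign_last(1) n3 by (auto simp: j_def idx_def orbit_rep_def)
  have "E (simple_root j) = neg_last n (ev (int n) (int n + 1))"
    using eps_simple_root[OF n3 j(1-3)] j(4) eps_neg[of n sign_last] by (metis neg_last_neg_last)
  also have "\<dots> = evp q" using n3 by (simp add: neg_last_ev neg_last_label_def assms(2))
  finally have "root q = simple_root j" by (intro root_eqI simple_root_V j)
  then show ?thesis using j(1) by (simp add: simple_roots_def)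
qed

section \<open>Sequences, simplicity and pairs in terms of points\<close>

lemma is_seq_iff: "is_seq n m \<longleftrightarrow> (\<exists>M. set_mset M \<subseteq> R \<and> m = I M)"
proof
  assume m: "is_seq n m"
  define g where "g = inv_into R root"
  have m: "set_mset m \<subseteq> root ` R" using m by (simp add: is_seq_def pos_roots_eq)
  have "image_mset root (image_mset g m) = image_mset (\<lambda>x. x) m"
    unfolding multiset.map_comp
    by (rule image_mset_cong) (use m in \<open>auto simp: g_def f_inv_into_f\<close>)
  moreover have "set_mset (image_mset g m) \<subseteq> R" using m by (auto simp: g_def intro!: inv_into_into)
  ultimately have "m = I (image_mset g m)" "set_mset (image_mset g m) \<subseteq> R" by simp_all
  then show "\<exists>M. set_mset M \<subseteq> R \<and> m = I M" by metis
next
  assume "\<exists>M. set_mset M \<subseteq> R \<and> m = I M"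
  then show "is_seq n m" unfolding is_seq_def pos_roots_eq by (metis image_mono set_image_mset)
qed

lemma simple_pair_iff:
  "\<alpha> \<in> R \<Longrightarrow> \<beta> \<in> R \<Longrightarrow> simple_pair n C {#root \<alpha>, root \<beta>#} \<longleftrightarrow> \<not> (\<exists>M. set_mset M \<subseteq> R \<and> below M {#\<alpha>, \<beta>#})"
  using prec_iff[of _ "{#\<alpha>, \<beta>#}"] by (auto simp: simple_pair_def is_seq_iff)

lemma simple_seq_iff: "set_mset M \<subseteq> R \<Longrightarrow> simple_seq n C (I M) \<longleftrightarrow> simple_pts M"
proof -
  assume M: "set_mset M \<subseteq> R"
  have "root \<alpha> \<noteq> root \<beta> \<longleftrightarrow> \<alpha> \<noteq> \<beta>" if "\<alpha> \<in># M" "\<beta> \<in># M" for \<alpha> \<beta>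
    using inj_onD[OF root_inj, of \<alpha> \<beta>] that M by blast
  then have B: "(root \<alpha> \<noteq> root \<beta> \<longrightarrow> simple_pair n C {#root \<alpha>, root \<beta>#}) \<longleftrightarrow>
      (\<alpha> \<noteq> \<beta> \<longrightarrow> \<not> (\<exists>N. set_mset N \<subseteq> R \<and> below N {#\<alpha>, \<beta>#}))" if "\<alpha> \<in># M" "\<beta> \<in># M" for \<alpha> \<beta>
    using simple_pair_iff[of \<alpha> \<beta>] M that by blast
  have A: "simple_seq n C (I M) \<longleftrightarrow> size M = 1 \<or>
      (\<forall>\<alpha>\<in>#M. \<forall>\<beta>\<in>#M. root \<alpha> \<noteq> root \<beta> \<longrightarrow> simple_pair n C {#root \<alpha>, root \<beta>#})"
    by (simp add: simple_seq_def)
  show ?thesis unfolding A simple_pts_def using B by blast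
qed

lemma is_pair_iff: "is_pair n p \<longleftrightarrow> (\<exists>\<alpha>\<in>R. \<exists>\<beta>\<in>R. \<alpha> \<noteq> \<beta> \<and> p = I {#\<alpha>, \<beta>#})"
proof
  assume p: "is_pair n p"
  then obtain M where M: "set_mset M \<subseteq> R" "p = I M" by (auto simp: is_pair_def is_seq_iff)
  moreover have "size M = Suc (Suc 0)" using p M by (simp add: is_pair_def)
  then obtain \<alpha> \<beta> where ab: "M = {#\<alpha>, \<beta>#}" by (elim size_mset_SucE) simp
  moreover have "\<alpha> \<noteq> \<beta>"
  proof
    assume "\<alpha> = \<beta>"
    then have "count p (root \<alpha>) = 2" using M ab by simp
    moreover have "count p (root \<alpha>) \<le> 1" using p by (auto simp: is_pair_def)
    ultimately show False by simp
  qed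
  ultimately show "\<exists>\<alpha>\<in>R. \<exists>\<beta>\<in>R. \<alpha> \<noteq> \<beta> \<and> p = I {#\<alpha>, \<beta>#}" by auto
next
  assume "\<exists>\<alpha>\<in>R. \<exists>\<beta>\<in>R. \<alpha> \<noteq> \<beta> \<and> p = I {#\<alpha>, \<beta>#}"
  then obtain \<alpha> \<beta> where ab: "\<alpha> \<in> R" "\<beta> \<in> R" "\<alpha> \<noteq> \<beta>" "p = I {#\<alpha>, \<beta>#}" by blast
  then have "root \<alpha> \<noteq> root \<beta>" using root_inj by (simp add: inj_on_eq_iff)
  then show "is_pair n p" using ab by (auto simp: is_pair_def is_seq_def pos_roots_eq)
qed

lemma pair_cases:
  assumes "\<alpha> \<in> R" "\<beta> \<in> R" "\<alpha> \<noteq> \<beta>" "set_mset M \<subseteq> R" "below M {#\<alpha>, \<beta>#}"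
  obtains a b c d where "{#\<alpha>, \<beta>#} = {#(a, b), (c, d)#}" "(a, b) \<in> R" "(c, d) \<in> R" "a \<le> c" "b \<le> d" "(a, b) \<noteq> (c, d)"
proof -
  consider "pt_le \<alpha> \<beta>" | "pt_le \<beta> \<alpha>" using below_pair(1)[OF assms(5,1-4)] by blast
  then show thesis
  proof cases
    case 1
    then show ?thesis using that[of "fst \<alpha>" "snd \<alpha>" "fst \<beta>" "snd \<beta>"] assms by simp
  next
    case 2
    then show ?thesis using that[of "fst \<beta>" "snd \<beta>" "fst \<alpha>" "snd \<alpha>"] assms by (simp add: add_mset_commute)
  qed
qed

section \<open>Chains of non-simple sequences\<close>

definition chains :: "(nat \<Rightarrow> int) multiset \<Rightarrow> nat set" where
  "chains p = {length ms | ms. ms \<noteq> [] \<and> last ms = p \<and>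
     (\<forall>x\<in>set ms. is_seq n x \<and> \<not> simple_seq n C x) \<and> successively (prec n C) ms}"

lemma gdist_chains: "gdist n C p = (if simple_seq n C p then 0 else Max (chains p))"
  unfolding gdist_def chains_def ..

text \<open>Read the chain from its end: the member before the pair is a non-simple sequence below
  it, and by \<open>simple_below_below\<close> nothing non-simple lies below that one.\<close>

lemma chain_bound:
  assumes ab: "\<alpha> \<in> R" "\<beta> \<in> R" "\<alpha> \<noteq> \<beta>" and k: "k \<in> chains (I {#\<alpha>, \<beta>#})"
  shows "k \<le> 2" and "(\<And>M. set_mset M \<subseteq> R \<Longrightarrow> below M {#\<alpha>, \<beta>#} \<Longrightarrow> simple_pts M) \<Longrightarrow> k \<le> 1"
proof -
  let ?p = "{#\<alpha>, \<beta>#}"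
  have pR: "set_mset ?p \<subseteq> R" using ab by simp
  obtain ms where ms: "k = length ms" "ms \<noteq> []" "last ms = I ?p" "successively (prec n C) ms"
    "\<And>x. x \<in> set ms \<Longrightarrow> is_seq n x \<and> \<not> simple_seq n C x" using k by (auto simp: chains_def)
  define ms1 where "ms1 = butlast ms"
  have ms1: "ms = ms1 @ [I ?p]" using ms(2,3) by (metis append_butlast_last_id ms1_def)
  have pre: "\<exists>ms2 M. ms1 = ms2 @ [I M] \<and> set_mset M \<subseteq> R \<and> \<not> simple_pts M \<and> below M ?p" if ne: "ms1 \<noteq> []"
  proof -
    obtain ms2 x where x: "ms1 = ms2 @ [x]" using ne by (metis rev_exhaust)
    then have "is_seq n x" "\<not> simple_seq n C x" "prec n C x (I ?p)"
      using ms(4,5) ms1 by (auto simp: successively_append_iff)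
    moreover from this(1) obtain M where "set_mset M \<subseteq> R" "x = I M" using is_seq_iff by blast
    ultimately show ?thesis using x simple_seq_iff prec_iff[OF _ pR] by blast
  qed
  show "k \<le> 1" if "\<And>M. set_mset M \<subseteq> R \<Longrightarrow> below M ?p \<Longrightarrow> simple_pts M"
    using pre that ms1 ms(1) by (cases "ms1 = []") auto
  show "k \<le> 2"
  proof (cases "ms1 = []")
    case False
    then obtain ms2 M where M: "ms1 = ms2 @ [I M]" "set_mset M \<subseteq> R" "\<not> simple_pts M" "below M ?p" using pre by blast
    have "ms2 = []"
    proof (rule ccontr)
      assume "ms2 \<noteq> []"
      then obtain ms3 y where y: "ms2 = ms3 @ [y]" by (metis rev_exhaust)
      then have "is_seq n y" "\<not> simple_seq n C y" "prec n C y (I M)"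
        using ms(4,5) ms1 M(1) by (auto simp: successively_append_iff)
      moreover from this(1) obtain N where N: "set_mset N \<subseteq> R" "y = I N" using is_seq_iff by blast
      ultimately have N': "\<not> simple_pts N" "below N M" using simple_seq_iff prec_iff M(2) by blast+
      obtain a b c d where abcd: "{#\<alpha>, \<beta>#} = {#(a, b), (c, d)#}" "(a, b) \<in> R" "(c, d) \<in> R" "a \<le> c" "b \<le> d" "(a, b) \<noteq> (c, d)"
        by (rule pair_cases[OF ab M(2,4)])
      show False
        using simple_below_below[OF abcd(2-6) M(4)[unfolded abcd(1)] M(2,3) N'(2) N(1)] N'(1) by blast
    qed
    then show ?thesis using ms1 M ms(1) by simp
  qed (use ms1 ms(1) in simp)
qed

lemma gdist_le:
  assumes ab: "\<alpha> \<in> R" "\<beta> \<in> R" "\<alpha> \<noteq> \<beta>"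
  shows "gdist n C (I {#\<alpha>, \<beta>#}) \<le> 2"
    and "(\<And>M. set_mset M \<subseteq> R \<Longrightarrow> below M {#\<alpha>, \<beta>#} \<Longrightarrow> simple_pts M) \<Longrightarrow> gdist n C (I {#\<alpha>, \<beta>#}) \<le> 1"
    and "set_mset N \<subseteq> R \<Longrightarrow> below N {#\<alpha>, \<beta>#} \<Longrightarrow> 1 \<le> gdist n C (I {#\<alpha>, \<beta>#})"
    and "set_mset N \<subseteq> R \<Longrightarrow> below N {#\<alpha>, \<beta>#} \<Longrightarrow> \<not> simple_pts N \<Longrightarrow> 2 \<le> gdist n C (I {#\<alpha>, \<beta>#})"
proof -
  let ?p = "{#\<alpha>, \<beta>#}"
  have pR: "set_mset ?p \<subseteq> R" using ab by simp
  have fin: "finite (chains (I ?p))" using chain_bound(1)[OF ab] by (meson finite_atMost finite_subset subsetI atMost_iff)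
  have seq: "is_seq n (I ?p)" using is_seq_iff pR by blast
  have one: "1 \<in> chains (I ?p)" if "\<not> simple_seq n C (I ?p)"
  proof -
    have "1 = length [I ?p]" by simp
    then show ?thesis unfolding chains_def using that seq by fastforce
  qed
  have simple_pts: "simple_seq n C (I ?p) \<longleftrightarrow> simple_pts ?p" by (rule simple_seq_iff[OF pR])
  have mx: "gdist n C (I ?p) \<le> m" if "\<And>k. k \<in> chains (I ?p) \<Longrightarrow> k \<le> m" for m
  proof (cases "simple_seq n C (I ?p)")
    case False
    then have "Max (chains (I ?p)) \<in> chains (I ?p)" using Max_in[OF fin] one by blast
    then show ?thesis unfolding gdist_chains using that False by simp
  qed (simp add: gdist_chains)
  show "gdist n C (I ?p) \<le> 2" by (rule mx) (rule chain_bound(1)[OF ab])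
  show "gdist n C (I ?p) \<le> 1" if simple_pts: "\<And>M. set_mset M \<subseteq> R \<Longrightarrow> below M ?p \<Longrightarrow> simple_pts M"
    by (rule mx) (rule chain_bound(2)[OF ab _ simple_pts])
  assume N: "set_mset N \<subseteq> R" "below N ?p"
  then have ns: "\<not> simple_seq n C (I ?p)" using simple_pts_pair[OF ab(3)] simple_pts by blast
  then show "1 \<le> gdist n C (I ?p)" using one fin by (simp add: gdist_chains Max_ge)
  assume "\<not> simple_pts N"
  then have "\<not> simple_seq n C (I N)" "is_seq n (I N)" "prec n C (I N) (I ?p)"
    using N is_seq_iff simple_seq_iff prec_iff[OF N(1) pR] by blast+
  moreover have "2 = length [I N, I ?p]" by simp
  ultimately have "2 \<in> chains (I ?p)" unfolding chains_def using ns seq by fastforce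
  then show "2 \<le> gdist n C (I ?p)" using ns fin by (simp add: gdist_chains Max_ge)
qed

lemma socle_unique:
  assumes "\<alpha> \<in> R" "\<beta> \<in> R" "\<alpha> \<noteq> \<beta>"
  shows "\<exists>!s. is_socle n C (I {#\<alpha>, \<beta>#}) s"
proof -
  let ?p = "{#\<alpha>, \<beta>#}"
  have pR: "set_mset ?p \<subseteq> R" using assms by simp
  have inj: "I M = I M' \<Longrightarrow> M = M'" if "set_mset M \<subseteq> R" "set_mset M' \<subseteq> R" for M M'
  proof (rule multiset_eqI)
    fix q assume eq: "I M = I M'"
    show "count M q = count M' q"
    proof (cases "q \<in> R")
      case True then show ?thesis using count_I[OF that(1) True] count_I[OF that(2) True] eq by metis
    next
      case False then show ?thesis using that by (metis not_in_iff subsetD)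
    qed
  qed
  have sc: "is_socle n C (I ?p) (I M) \<longleftrightarrow> simple_pts M \<and> (M = ?p \<or> below M ?p)" if "set_mset M \<subseteq> R" for M
    unfolding is_socle_def using that is_seq_iff simple_seq_iff[OF that] prec_iff[OF that pR] inj[OF that pR] by blast
  obtain M where M: "set_mset M \<subseteq> R" "simple_pts M \<and> (M = ?p \<or> below M ?p)"
    and uniq: "\<And>N. set_mset N \<subseteq> R \<Longrightarrow> simple_pts N \<and> (N = ?p \<or> below N ?p) \<Longrightarrow> N = M"
    using ex1_socle[OF assms] by (metis (no_types, lifting))
  show ?thesis
  proof (rule ex1I)
    show "is_socle n C (I ?p) (I M)" using sc[OF M(1)] M(2) by blast
  next
    fix s assume s: "is_socle n C (I ?p) s"
    then obtain N where N: "set_mset N \<subseteq> R" "s = I N" using is_seq_iff by (auto simp: is_socle_def)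
    then have "N = M" using uniq[OF N(1)] sc[OF N(1)] s by blast
    then show "s = I M" using N by simp
  qed
qed

lemma folded_mult_Max: "Max {folded_mult n \<gamma> | \<gamma>. \<gamma> \<in> pos_roots n} = 2"
proof (rule Max_eqI)
  have sub: "{folded_mult n \<gamma> | \<gamma>. \<gamma> \<in> pos_roots n} \<subseteq> {1, 2}"
    using folded_mult_root by (auto simp: pos_roots_eq split: if_splits)
  then show "finite {folded_mult n \<gamma> | \<gamma>. \<gamma> \<in> pos_roots n}" by (rule finite_subset) simp
  show "y \<le> 2" if "y \<in> {folded_mult n \<gamma> | \<gamma>. \<gamma> \<in> pos_roots n}" for y using that sub by auto
  have "(1, n + 1) \<in> R" using n3 by (intro R_mid) auto
  then show "2 \<in> {folded_mult n \<gamma> | \<gamma>. \<gamma> \<in> pos_roots n}"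
    using folded_mult_root[of 1 "n + 1"] n3 by (force simp: pos_roots_eq)
qed

section \<open>Radii of positive roots\<close>

lemma rds_eqI:
  assumes q: "q \<in> R"
    and up: "\<And>\<alpha> \<beta>. \<alpha> \<in> R \<Longrightarrow> \<beta> \<in> R \<Longrightarrow> \<alpha> \<noteq> \<beta> \<Longrightarrow> below {#q#} {#\<alpha>, \<beta>#} \<Longrightarrow> gdist n C (I {#\<alpha>, \<beta>#}) \<le> m"
    and ex: "\<exists>\<alpha>\<in>R. \<exists>\<beta>\<in>R. \<alpha> \<noteq> \<beta> \<and> below {#q#} {#\<alpha>, \<beta>#} \<and> m \<le> gdist n C (I {#\<alpha>, \<beta>#})"
  shows "rds n C (root q) = m"
proof -
  let ?G = "{gdist n C p | p. is_pair n p \<and> prec n C {#root q#} p}"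
  have pq: "prec n C {#root q#} (I {#\<alpha>, \<beta>#}) \<longleftrightarrow> below {#q#} {#\<alpha>, \<beta>#}" if "\<alpha> \<in> R" "\<beta> \<in> R" for \<alpha> \<beta>
    using prec_iff[of "{#q#}" "{#\<alpha>, \<beta>#}"] that q by simp
  have G: "g \<le> m" if g: "g \<in> ?G" for g
  proof -
    obtain p where p: "g = gdist n C p" "is_pair n p" "prec n C {#root q#} p" using g by blast
    obtain \<alpha> \<beta> where "\<alpha> \<in> R" "\<beta> \<in> R" "\<alpha> \<noteq> \<beta>" "p = I {#\<alpha>, \<beta>#}" using p(2) is_pair_iff by blast
    then show ?thesis using up pq p by blast
  qed
  obtain \<alpha> \<beta> where ab: "\<alpha> \<in> R" "\<beta> \<in> R" "\<alpha> \<noteq> \<beta>" "below {#q#} {#\<alpha>, \<beta>#}" "m \<le> gdist n C (I {#\<alpha>, \<beta>#})"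
    using ex by blast
  then have "is_pair n (I {#\<alpha>, \<beta>#})" "prec n C {#root q#} (I {#\<alpha>, \<beta>#})" using is_pair_iff pq by blast+
  then have mem: "gdist n C (I {#\<alpha>, \<beta>#}) \<in> ?G" by blast
  have "gdist n C (I {#\<alpha>, \<beta>#}) = m" using G[OF mem] ab(5) by simp
  then have "m \<in> ?G" using mem by simp
  moreover have "finite ?G" using G by (meson finite_atMost finite_subset subsetI atMost_iff)
  ultimately show ?thesis unfolding rds_def using G by (intro Max_eqI)
qed

text \<open>The witness pair meets at the place \<open>n\<close>, which carries the largest label,
  so that \<open>(y - h, n)\<close> is in the slice. With \<open>b = c = n\<close> the nested
  exchange has empty inner interval and is the root itself, while the crossing exchange is
  non-simple.\<close>

lemma rds_two:
  assumes R: "(x, y) \<in> R" and xy: "x < n" "n < y"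
  shows "rds n C (root (x, y)) = 2"
proof (rule rds_eqI[OF R])
  fix \<alpha> \<beta> assume "\<alpha> \<in> R" "\<beta> \<in> R" "\<alpha> \<noteq> \<beta>"
  then show "gdist n C (I {#\<alpha>, \<beta>#}) \<le> 2" by (rule gdist_le(1))
next
  define a where "a = y - h"
  have a: "y = a + h" "a < x" using xy R_len[OF R] by (auto simp: a_def)
  have "v a < v n" using v_n v_range[of a] inj_onD[OF v_inj, of a n] a xy by fastforce
  then have R1: "(a, n) \<in> R" using R_lo[of a n] a xy by simp
  have R2: "(n, x + h) \<in> R" using xy by (intro R_mid) auto
  have ord: "a \<le> n" "n \<le> x + h" "(a, n) \<noteq> (n, x + h)" "x + h > a + h" "n \<le> n" using a xy by auto
  have "below {#(x, y)#} {#(a, n), (n, x + h)#}"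
    using below_long(2)[OF R1 R2 ord] a by (simp add: segment_def)
  moreover note mid = middle_crossing[OF R1 R2 ord]
  have "2 \<le> gdist n C (I {#(a, n), (n, x + h)#})"
    using mid(2,3) by (intro gdist_le(4)[OF R1 R2 ord(3) _ mid(6) mid(4)]) simp
  ultimately show "\<exists>\<alpha>\<in>R. \<exists>\<beta>\<in>R. \<alpha> \<noteq> \<beta> \<and> below {#(x, y)#} {#\<alpha>, \<beta>#} \<and> 2 \<le> gdist n C (I {#\<alpha>, \<beta>#})"
    using R1 R2 ord(3) by blast
qed

text \<open>A non-simple sequence below the pair needs \<open>a + h < d\<close> and
  \<open>c \<le> b\<close>. A single root below such a pair can only be
  \<open>(d - h, a + h)\<close>, which passes strictly over \<open>n\<close> since
  \<open>d \<le> 2 * n\<close>.\<close>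

lemma gdist_one:
  assumes R: "(x, y) \<in> R" and xy: "\<not> (x < n \<and> n < y)" and ab: "\<alpha> \<in> R" "\<beta> \<in> R" "\<alpha> \<noteq> \<beta>"
    and p: "below {#(x, y)#} {#\<alpha>, \<beta>#}"
  shows "gdist n C (I {#\<alpha>, \<beta>#}) \<le> 1"
proof (rule gdist_le(2)[OF ab])
  fix M assume M: "set_mset M \<subseteq> R" "below M {#\<alpha>, \<beta>#}"
  have q: "set_mset {#(x, y)#} \<subseteq> R" using R by simp
  obtain a b c d where abcd: "{#\<alpha>, \<beta>#} = {#(a, b), (c, d)#}" and
    o: "(a, b) \<in> R" "(c, d) \<in> R" "a \<le> c" "b \<le> d" "(a, b) \<noteq> (c, d)"
    by (rule pair_cases[OF ab q p])
  show "simple_pts M"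
  proof (rule ccontr)
    assume "\<not> simple_pts M"
    then have dc: "d > a + h" "c \<le> b" using not_simple_below[OF o M(2)[unfolded abcd] M(1)] by blast+
    have "{#(x, y)#} = {#(d - h, a + h)#} + segment c b"
    proof -
      have "{#(x, y)#} \<noteq> segment (d - h) b + segment c (a + h)"
        unfolding middle_crossing(1)[OF o dc] by simp
      then show ?thesis using below_cases[OF o p[unfolded abcd] q] dc(1) less_asym by blast
    qed
    then have "x = d - h" "y = a + h" by (auto simp: segment_def split: if_splits)
    then show False using xy R_bound[OF o(2)] n3 by auto
  qed
qed

text \<open>Three exchanges with an empty second interval: a cut at an interior place, or an
  extension to the left or to the right whose surplus is cancelled by its negative one period
  away.\<close>

lemma between_root:
  assumes R: "(x, y) \<in> R" and p: "(x, z) \<in> R \<and> (z, y) \<in> R \<or> z < x \<and> (z, y) \<in> R \<and> (z + h, x + h) \<in> R \<or>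
      h \<le> y \<and> y < z + h \<and> (y - h, z) \<in> R \<and> (x, z + h) \<in> R"
  shows "\<exists>\<alpha>\<in>R. \<exists>\<beta>\<in>R. \<alpha> \<noteq> \<beta> \<and> below {#(x, y)#} {#\<alpha>, \<beta>#}"
  using p
proof (elim disjE conjE)
  assume z: "(x, z) \<in> R" "(z, y) \<in> R"
  then have o: "x \<le> z" "z \<le> y" "(x, z) \<noteq> (z, y)" "y < x + h" "x < z" "z < y" "z \<le> z" using R_len[of x z] R_len[of z y] R_len[OF R] by auto
  have "below {#(x, y)#} {#(x, z), (z, y)#}" using below_short(2)[OF z o] by (simp add: segment_def)
  then show ?thesis using z o(3) by blast
next
  assume z: "z < x" "(z, y) \<in> R" "(z + h, x + h) \<in> R"
  have o: "z \<le> z + h" "y \<le> x + h" "(z, y) \<noteq> (z + h, x + h)" "x + h > z + h" "x + h - h \<le> y" "z + h \<le> z + h"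
    using z R_len[OF R] by auto
  have "below {#(x, y)#} {#(z, y), (z + h, x + h)#}"
    using below_middle(2)[OF z(2,3) o] R_len[OF R] by (simp add: segment_def)
  then show ?thesis using z o(3) by blast
next
  assume z: "h \<le> y" "y < z + h" "(y - h, z) \<in> R" "(x, z + h) \<in> R"
  have o: "y - h \<le> x" "z \<le> z + h" "(y - h, z) \<noteq> (x, z + h)" "z + h > y - h + h" "z + h - h \<le> z" "x \<le> y - h + h"
    using z R_len[OF R] by auto
  have "segment (z + h - h) z + segment x (y - h + h) = {#(x, y)#}" using z R_len[OF R] by (simp add: segment_def)
  then have "below {#(x, y)#} {#(y - h, z), (x, z + h)#}" using below_middle(2)[OF z(3,4) o] by simp
  then show ?thesis using z o(3) by blast
qed

lemma label_pos: "1 \<le> l \<Longrightarrow> l \<le> int n \<Longrightarrow> \<exists>z<n. v z = l"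
proof -
  assume "1 \<le> l" "l \<le> int n"
  then have "l \<in> v ` {X n..<X n + n}" using v_level[of n] n3 by simp
  then show ?thesis by (auto simp: X_n)
qed

text \<open>Split off a difference of consecutive labels: \<open>z\<close> is the place of the
  successor of the smaller label. Each possible position of \<open>z\<close> relative to the
  interval matches one case of \<open>between_root\<close>.\<close>

lemma decomposable:
  assumes R: "(x, y) \<in> R" and xy: "\<not> (x < n \<and> n < y)" and ns: "root (x, y) \<notin> simple_roots n"
  shows "\<exists>\<alpha>\<in>R. \<exists>\<beta>\<in>R. \<alpha> \<noteq> \<beta> \<and> below {#(x, y)#} {#\<alpha>, \<beta>#}"
proof -
  have "\<exists>z. (x, z) \<in> R \<and> (z, y) \<in> R \<or> z < x \<and> (z, y) \<in> R \<and> (z + h, x + h) \<in> R \<or>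
      h \<le> y \<and> y < z + h \<and> (y - h, z) \<in> R \<and> (x, z + h) \<in> R"
    using R
  proof (cases rule: R_split)
    case 1
    have "v y \<noteq> v x + 1"
    proof
      assume e: "v y = v x + 1"
      have r: "1 \<le> v x" "v x \<le> int n" using e v_range[of x] v_range[of y] 1 by auto
      then have "1 \<le> nat (v x)" "nat (v x) \<le> n" by linarith+
      then show False using ns simple_root_diff[OF R, of "nat (v x)"] r e by (simp add: evp_def)
    qed
    then obtain z where z: "z < n" "v z = v x + 1" using label_pos[of "v x + 1"] v_range[of x] v_range[of y] 1 by auto
    have lt: "v x < v z" "v z < v y" using z 1 \<open>v y \<noteq> v x + 1\<close> by auto
    then have "z \<noteq> x" "z \<noteq> y" by auto
    \<comment> \<open>From \<open>v x < v y\<close> it follows that \<open>y\<close> lies on the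
      rising slope, so labels beyond \<open>y\<close> exceed \<open>v y\<close>.\<close>
    have "\<not> y < z"
      using 1 lt v_decr[of x y] v_incr[of y z] z by (metis less_asym less_imp_le not_less)
    then consider "z < x" | "x < z" "z < y" using \<open>z \<noteq> x\<close> \<open>z \<noteq> y\<close> by linarith
    then show ?thesis
    proof cases
      case a: 1
      then have "(z, y) \<in> R" "(z + h, x + h) \<in> R" using R_lo[of z y] R_hi[of z x] lt 1 by auto
      then show ?thesis using a by blast
    next
      case a: 2
      then have "(x, z) \<in> R" "(z, y) \<in> R" using R_lo[of x z] R_lo[of z y] lt 1 by auto
      then show ?thesis by blast
    qed
  next
    case 2
    then have "x = n" using xy by simp
    \<comment> \<open>The root is the sum of the labels \<open>v w\<close> and \<open>n + 1\<close>,
      hence simple if \<open>v w = n\<close>.\<close>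
    define w where "w = y - h"
    have w: "y = w + h" "w < n" using 2 \<open>x = n\<close> by (auto simp: w_def)
    have vw: "v w \<le> int n" using v_range[of w] v_n inj_onD[OF v_inj, of w n] w by fastforce
    have "v w \<noteq> int n"
    proof
      assume "v w = int n"
      then have "v y = - int n" using v_h[of w] w by simp
      then have "evp (x, y) = ev (int n) (- int n - 1)"
        using v_n \<open>x = n\<close> ev_neg[of "- int n - 1" "int n"] by (simp add: evp_def add.commute)
      then show False using ns simple_root_sum[OF R] by blast
    qed
    then obtain z where z: "z < n" "v z = v w + 1" using label_pos[of "v w + 1"] v_range[of w] vw w by auto
    then have "z \<noteq> w" by auto
    then consider "w < z" | "z < w" by linarith
    then show ?thesis
    proof cases
      case a: 1
      then have "(w, z) \<in> R" "(n, z + h) \<in> R" using R_lo[of w z] z R_mid[of n "z + h"] by auto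
      then show ?thesis using a w \<open>x = n\<close> by (intro exI[of _ z]) simp
    next
      case a: 2
      then have "(n, z + h) \<in> R" "(z + h, w + h) \<in> R" using R_hi[of z w] z w R_mid[of n "z + h"] by auto
      then show ?thesis using w \<open>x = n\<close> by blast
    qed
  next
    case (3 x' y')
    have "v x' \<noteq> v y' + 1"
    proof
      assume e: "v x' = v y' + 1"
      have ev: "evp (x, y) = ev (v y') (v x')" by (simp only: 3 evp_def fst_conv snd_conv v_h ev_neg)
      have r: "1 \<le> v y'" "v y' \<le> int n" using e v_range[of x'] v_range[of y'] 3 by auto
      then have "1 \<le> nat (v y')" "nat (v y') \<le> n" by linarith+
      then show False using ns simple_root_diff[OF R, of "nat (v y')"] r e ev by simp
    qed
    then obtain z where z: "z < n" "v z = v y' + 1"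
      using label_pos[of "v y' + 1"] v_range[of x'] v_range[of y'] 3 by auto
    have lt: "v y' < v z" "v z < v x'" using z 3 \<open>v x' \<noteq> v y' + 1\<close> by auto
    then have "z \<noteq> x'" "z \<noteq> y'" by auto
    have "\<not> z < x'"
      using 3 lt v_decr[of z x'] v_incr[of x' y'] by (metis less_asym less_imp_le not_less)
    then consider "x' < z" "z < y'" | "y' < z" using \<open>z \<noteq> x'\<close> \<open>z \<noteq> y'\<close> by linarith
    then show ?thesis
    proof cases
      case a: 1
      then have "(x' + h, z + h) \<in> R" "(z + h, y' + h) \<in> R" using R_hi[of x' z] R_hi[of z y'] lt 3 z by auto
      then show ?thesis using 3 by blast
    next
      case a: 2
      then have "(y', z) \<in> R" "(x' + h, z + h) \<in> R" using R_hi[of x' z] R_lo[of y' z] lt 3 z by auto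
      then show ?thesis using 3 a by (intro exI[of _ z]) simp
    qed
  qed
  then show ?thesis using between_root[OF R] by blast
qed

lemma rds_root:
  assumes R: "(x, y) \<in> R" and ns: "root (x, y) \<notin> simple_roots n"
  shows "int (rds n C (root (x, y))) = folded_mult n (root (x, y))"
proof (cases "x < n \<and> n < y")
  case True
  then show ?thesis using rds_two[OF R] folded_mult_root[OF R] by simp
next
  case False
  have "rds n C (root (x, y)) = 1"
  proof (rule rds_eqI[OF R])
    show "\<exists>\<alpha>\<in>R. \<exists>\<beta>\<in>R. \<alpha> \<noteq> \<beta> \<and> below {#(x, y)#} {#\<alpha>, \<beta>#} \<and> 1 \<le> gdist n C (I {#\<alpha>, \<beta>#})"
      using decomposable[OF R False ns] gdist_le(3)[of _ _ "{#(x, y)#}"] R by fastforce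
  qed (use gdist_one[OF R False] in blast)
  then show ?thesis using folded_mult_root[OF R] False by simp
qed

end

theorem theorem8p11:
  fixes n :: nat and C :: "nat list set"
  assumes "n \<ge> 3" and "twisted_adapted n C"
  shows "(\<forall>\<alpha>\<in>pos_roots n. \<forall>\<beta>\<in>pos_roots n. is_pair n {#\<alpha>, \<beta>#} \<longrightarrow>
            int (gdist n C {#\<alpha>, \<beta>#}) \<le> Max {folded_mult n \<gamma> | \<gamma>. \<gamma> \<in> pos_roots n}) \<and>
         Max {folded_mult n \<gamma> | \<gamma>. \<gamma> \<in> pos_roots n} = 2 \<and>
         (\<forall>\<gamma>\<in>pos_roots n - simple_roots n. int (rds n C \<gamma>) = folded_mult n \<gamma>) \<and>
         (\<forall>p. is_pair n p \<longrightarrow> (\<exists>!s. is_socle n C p s))"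
proof -
  obtain js where js: "length js = n" "set js \<subseteq> idx n" "\<forall>i\<in>idx n. \<exists>!k. k < length js \<and> js ! k \<in> {i, vee n i}"
    and C: "C = comm_class n (twisted_word n js)"
    using assms(2) unfolding twisted_adapted_def by blast
  interpret twisted n js by unfold_locales (use assms(1) js in auto)
  have C: "C = comm_class n u0" unfolding C u0_def ..
  have "int (gdist n C p) \<le> 2" if p: "is_pair n p" for p
  proof -
    obtain \<alpha> \<beta> where ab: "\<alpha> \<in> R" "\<beta> \<in> R" "\<alpha> \<noteq> \<beta>" "p = I {#\<alpha>, \<beta>#}" using p is_pair_iff by blast
    then show ?thesis unfolding C ab(4) using gdist_le(1)[OF ab(1-3)] by simp
  qed
  moreover have "int (rds n C \<gamma>) = folded_mult n \<gamma>" if g: "\<gamma> \<in> pos_roots n - simple_roots n" for \<gamma>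
  proof -
    obtain x y where "(x, y) \<in> R" "\<gamma> = root (x, y)" using g unfolding pos_roots_eq by auto
    then show ?thesis using rds_root g unfolding C by blast
  qed
  moreover have "\<exists>!s. is_socle n C p s" if p: "is_pair n p" for p
  proof -
    obtain \<alpha> \<beta> where ab: "\<alpha> \<in> R" "\<beta> \<in> R" "\<alpha> \<noteq> \<beta>" "p = I {#\<alpha>, \<beta>#}" using p is_pair_iff by blast
    show ?thesis unfolding C ab(4) by (rule socle_unique[OF ab(1-3)])
  qed
  ultimately show ?thesis using folded_mult_Max by simp
qed

end
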